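(* Let $\Omega_1$ and $\Omega_2$ be Lipschitz domains from $\mathcal L(M,\mathcal C_1,\ldots,\mathcal C_N)$ with Hausdorff distance $d$ small. Fix $m\ge1$ and let $J_m$ be the multiplicity of the Dirichlet eigenvalue $\Lambda_m(\Omega_1)$. Then the $J_m$ Dirichlet eigenvalues $\Lambda_k(\Omega_2)$, $k=1,\ldots,J_m$, of $\Omega_2$ near $\Lambda_m(\Omega_1)$ satisfy $$|\Lambda_k(\Omega_2)-\Lambda_m(\Omega_1)|\le C\,d\qquad\text{for every }k=1,2,\ldots,J_m,$$ with a constant $C$ independent of $d$.
   Context: The class $\mathcal L(M,\mathcal C_1,\ldots,\mathcal C_N)$: $M>0$ is a constant and $\mathcal C_1,\ldots,\mathcal C_N$ are fixed cylinders, $\mathcal C_k=\{(y',y_n): y'\in B'_{r_k}(0),\ |y_n|<\delta_k\}$ in an orthogonal coordinate system attached to $\mathcal C_k$ with origin at its center ($B'_{r_k}(0)$ is a ball in $\mathbf{R}^{n-1}$). A bounded domain $\Omega\subset\mathbf{R}^n$ belongs to the class if its boundary is covered by the cylinders and $\mathcal C_k\cap\Omega=\mathcal C_k\cap\{y_n>h_k(y')\}$ with $h_k$ Lipschitz with constant $M$. For $\Omega_j$ these functions are denoted $h_k^{(j)}$, $j=1,2$, and $h_k^{(1)}(0)=0$. $d$ is the Hausdorff distance between $\Omega_1$ and $\Omega_2$; it is comparable to $\max_k\sup_{B'_{r_k}(0)}|h_k^{(1)}-h_k^{(2)}|$, which is assumed small. $\Omega_1$ is fixed and $C$ does not depend on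 $\Omega_2$. $0<\Lambda_1(\Omega_1)<\Lambda_2(\Omega_1)<\cdots$ are the distinct eigenvalues of $-\Delta u=\Lambda u$ in $\Omega_1$, $u\in H_0^1(\Omega_1)$ (weak formulation). For $d$ small there are precisely $J_m$ eigenvalues (counted with multiplicity) of the Dirichlet Laplacian on $\Omega_2$ in a small neighborhood of $\Lambda_m(\Omega_1)$, denoted $\Lambda_k(\Omega_2)$, $k=1,\ldots,J_m$.
   Formalization: The graphs of the functions h_k over B'_{r_k}(0) are required to stay inside the cylinders, |h_k| < delta_k, for both domains; otherwise h_k is not determined by the domain and thin slits along cylinder faces would violate the estimate. *)

theory Defs
  imports "HOL-Analysis.Analysis"
begin

text \<open>
  Euclidean $n$-space is an arbitrary type of class \<^class>\<open>euclidean_space\<close>, so that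
  $n = DIM('a) \ge 1$.
\<close>

section \<open>The class of Lipschitz domains\<close>

text \<open>
  An orthogonal coordinate system attached to a cylinder is given, up to an irrelevant rotation
  of the variables $y'$, by its origin \<open>center\<close> and the unit vector \<open>direction\<close> of the $y_n$-axis.
  The space of the variables $y'$, i.e. $R^{n-1}$, is the orthogonal complement of \<open>direction\<close>.
\<close>

datatype 'a cylinder =
  Cylinder (center: 'a) (direction: 'a) (radius: real) (half_height: real)

definition valid_cylinder :: "'a::euclidean_space cylinder \<Rightarrow> bool" where
  "valid_cylinder Z \<longleftrightarrow> norm (direction Z) = 1 \<and> radius Z > 0 \<and> half_height Z > 0"

definition last_coord :: "'a::euclidean_space cylinder \<Rightarrow> 'a \<Rightarrow> real" where
  "last_coord Z x = (x - center Z) \<bullet> direction Z"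

definition first_coords :: "'a::euclidean_space cylinder \<Rightarrow> 'a \<Rightarrow> 'a" where
  "first_coords Z x = (x - center Z) - last_coord Z x *\<^sub>R direction Z"

definition base_ball :: "'a::euclidean_space cylinder \<Rightarrow> 'a set" where
  "base_ball Z = {y. y \<bullet> direction Z = 0 \<and> norm y < radius Z}"

definition cylinder_set :: "'a::euclidean_space cylinder \<Rightarrow> 'a set" where
  "cylinder_set Z = {x. first_coords Z x \<in> base_ball Z \<and> \<bar>last_coord Z x\<bar> < half_height Z}"

text \<open>
  The graph of $h$ is required to stay inside the cylinder. Otherwise $h$ would not be determined
  by the domain, and $\sup |h^{(1)} - h^{(2)}|$ would not be comparable to the
  Hausdorff distance of the domains.
\<close>

definition graph_in_cylinder ::
    "real \<Rightarrow> 'a::euclidean_space cylinder \<Rightarrow> ('a \<Rightarrow> real) \<Rightarrow> 'a set \<Rightarrow> bool" where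
  "graph_in_cylinder M Z h \<Omega> \<longleftrightarrow>
     M-lipschitz_on (base_ball Z) h \<and>
     (\<forall>y\<in>base_ball Z. \<bar>h y\<bar> < half_height Z) \<and>
     cylinder_set Z \<inter> \<Omega> = cylinder_set Z \<inter> {x. last_coord Z x > h (first_coords Z x)}"

definition bounded_domain :: "'a::euclidean_space set \<Rightarrow> bool" where
  "bounded_domain \<Omega> \<longleftrightarrow> open \<Omega> \<and> connected \<Omega> \<and> \<Omega> \<noteq> {} \<and> bounded \<Omega>"

definition lipschitz_domain_with ::
    "real \<Rightarrow> nat \<Rightarrow> (nat \<Rightarrow> 'a::euclidean_space cylinder) \<Rightarrow> (nat \<Rightarrow> 'a \<Rightarrow> real) \<Rightarrow> 'a set \<Rightarrow> bool"
  where
  "lipschitz_domain_with M N Z h \<Omega> \<longleftrightarrow>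
     bounded_domain \<Omega> \<and>
     frontier \<Omega> \<subseteq> (\<Union>k\<in>{1..N}. cylinder_set (Z k)) \<and>
     (\<forall>k\<in>{1..N}. graph_in_cylinder M (Z k) (h k) \<Omega>)"

definition lipschitz_class ::
    "real \<Rightarrow> nat \<Rightarrow> (nat \<Rightarrow> 'a::euclidean_space cylinder) \<Rightarrow> 'a set set" where
  "lipschitz_class M N Z = {\<Omega>. \<exists>h. lipschitz_domain_with M N Z h \<Omega>}"

text \<open>Meaningful for bounded nonempty sets, where both suprema are finite.\<close>

definition hausdorff_dist :: "'a::metric_space set \<Rightarrow> 'a set \<Rightarrow> real" where
  "hausdorff_dist A B = max (SUP x\<in>A. infdist x B) (SUP y\<in>B. infdist y A)"


section \<open>Sobolev spaces\<close>

primrec Ck :: "nat \<Rightarrow> ('a::euclidean_space \<Rightarrow> real) \<Rightarrow> bool" where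
  "Ck 0 f \<longleftrightarrow> continuous_on UNIV f"
| "Ck (Suc k) f \<longleftrightarrow>
     (\<forall>x. f differentiable (at x)) \<and> (\<forall>b\<in>Basis. Ck k (\<lambda>x. frechet_derivative f (at x) b))"

definition test_function :: "'a::euclidean_space set \<Rightarrow> ('a \<Rightarrow> real) \<Rightarrow> bool" where
  "test_function \<Omega> \<phi> \<longleftrightarrow>
     (\<forall>k. Ck k \<phi>) \<and> compact (closure {x. \<phi> x \<noteq> 0}) \<and> closure {x. \<phi> x \<noteq> 0} \<subseteq> \<Omega>"

definition grad :: "('a::euclidean_space \<Rightarrow> real) \<Rightarrow> 'a \<Rightarrow> 'a" where
  "grad f x = (\<Sum>b\<in>Basis. frechet_derivative f (at x) b *\<^sub>R b)"

definition L2 :: "'a::euclidean_space set \<Rightarrow> ('a \<Rightarrow> 'b::euclidean_space) \<Rightarrow> bool" where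
  "L2 \<Omega> f \<longleftrightarrow> f \<in> borel_measurable (lebesgue_on \<Omega>) \<and>
            integrable (lebesgue_on \<Omega>) (\<lambda>x. (norm (f x))\<^sup>2)"

definition weak_gradient ::
    "'a::euclidean_space set \<Rightarrow> ('a \<Rightarrow> real) \<Rightarrow> ('a \<Rightarrow> 'a) \<Rightarrow> bool" where
  "weak_gradient \<Omega> u g \<longleftrightarrow>
     (\<forall>\<phi>. test_function \<Omega> \<phi> \<longrightarrow>
        (\<forall>b\<in>Basis. (\<integral>x. u x * frechet_derivative \<phi> (at x) b \<partial>lebesgue_on \<Omega>)
                  = - (\<integral>x. (g x \<bullet> b) * \<phi> x \<partial>lebesgue_on \<Omega>)))"

text \<open>
  Sobolev functions are represented by pairs of a function and (a representative of) its weak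
  gradient; only the values on $\Omega$, up to null sets, matter.
\<close>

definition H1 :: "'a::euclidean_space set \<Rightarrow> ('a \<Rightarrow> real) \<Rightarrow> ('a \<Rightarrow> 'a) \<Rightarrow> bool" where
  "H1 \<Omega> u g \<longleftrightarrow> L2 \<Omega> u \<and> L2 \<Omega> g \<and> weak_gradient \<Omega> u g"

text \<open>The closure of the test functions in the norm of $H^1(\Omega)$.\<close>

definition H1_0 :: "'a::euclidean_space set \<Rightarrow> ('a \<Rightarrow> real) \<Rightarrow> ('a \<Rightarrow> 'a) \<Rightarrow> bool" where
  "H1_0 \<Omega> u g \<longleftrightarrow> H1 \<Omega> u g \<and>
     (\<exists>\<phi> :: nat \<Rightarrow> 'a \<Rightarrow> real. (\<forall>j. test_function \<Omega> (\<phi> j)) \<and>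
        (\<lambda>j. \<integral>x. (u x - \<phi> j x)\<^sup>2 + (norm (g x - grad (\<phi> j) x))\<^sup>2 \<partial>lebesgue_on \<Omega>)
          \<longlonglongrightarrow> 0)"


section \<open>Dirichlet eigenvalues\<close>

definition dirichlet_eigenspace :: "'a::euclidean_space set \<Rightarrow> real \<Rightarrow> ('a \<Rightarrow> real) set" where
  "dirichlet_eigenspace \<Omega> \<mu> =
     {u. \<exists>g. H1_0 \<Omega> u g \<and>
        (\<forall>v w. H1_0 \<Omega> v w \<longrightarrow>
           (\<integral>x. g x \<bullet> w x \<partial>lebesgue_on \<Omega>) = \<mu> * (\<integral>x. u x * v x \<partial>lebesgue_on \<Omega>))}"

definition dirichlet_eigenvalue :: "'a::euclidean_space set \<Rightarrow> real \<Rightarrow> bool" where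
  "dirichlet_eigenvalue \<Omega> \<mu> \<longleftrightarrow>
     (\<exists>u\<in>dirichlet_eigenspace \<Omega> \<mu>. \<not> (AE x in lebesgue_on \<Omega>. u x = 0))"

text \<open>
  The eigenspace, modulo equality almost everywhere, has a basis of $J$ elements. In particular
  $J = 0$ if \<open>\<mu>\<close> is not an eigenvalue.
\<close>

definition dirichlet_multiplicity :: "'a::euclidean_space set \<Rightarrow> real \<Rightarrow> nat \<Rightarrow> bool" where
  "dirichlet_multiplicity \<Omega> \<mu> J \<longleftrightarrow>
     (\<exists>u :: nat \<Rightarrow> 'a \<Rightarrow> real.
        (\<forall>i\<in>{1..J}. u i \<in> dirichlet_eigenspace \<Omega> \<mu>) \<and>
        (\<forall>c :: nat \<Rightarrow> real.
           (AE x in lebesgue_on \<Omega>. (\<Sum>i\<in>{1..J}. c i * u i x) = 0) \<longrightarrow> (\<forall>i\<in>{1..J}. c i = 0)) \<and>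
        (\<forall>v\<in>dirichlet_eigenspace \<Omega> \<mu>. \<exists>c :: nat \<Rightarrow> real.
           AE x in lebesgue_on \<Omega>. v x = (\<Sum>i\<in>{1..J}. c i * u i x)))"

text \<open>
  \<open>\<Lambda> 1, \<dots>, \<Lambda> J\<close> are precisely the eigenvalues lying in \<open>U\<close>, each repeated according to its
  multiplicity.
\<close>

definition lists_eigenvalues_in ::
    "'a::euclidean_space set \<Rightarrow> real set \<Rightarrow> nat \<Rightarrow> (nat \<Rightarrow> real) \<Rightarrow> bool" where
  "lists_eigenvalues_in \<Omega> U J \<Lambda> \<longleftrightarrow>
     (\<forall>k\<in>{1..J}. \<Lambda> k \<in> U) \<and>
     (\<forall>\<mu>\<in>U. dirichlet_multiplicity \<Omega> \<mu> (card {k\<in>{1..J}. \<Lambda> k = \<mu>}))"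

end

theory Submission
  imports Defs "HOL-Library.Function_Algebras"
begin

text \<open>
  If $d$ is small, the graphs of the two domains are uniformly close, at distance at most $(2 +
  5M)\,d$, but their gradients need not be close. A change of variables that maps one domain onto
  the other is therefore in general not close to the identity in $C^1$. The proof moves the
  domains past each other instead. Cutting off the axes of the cylinders gives one smooth vector
  field $V$, transversal to $\partial\Omega_1$ in all the cylinders at once. For a suitable $t =
  C_0 d$ the map $\Psi = \mathrm{id} + tV$ satisfies $\Psi(x)\in\Omega_1 \Rightarrow x\in\Omega_2$
  and $\Psi(x)\in\Omega_2 \Rightarrow x\in\Omega_1$ (\<open>transversal_field\<close>).
  Consequently $\varphi\mapsto\varphi\circ\Psi$ sends test functions of either domain to test
  functions of the other one. Since $V$ is fixed, $\Psi$ is $C^1$-close to the identity, and this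
  map raises the Dirichlet integral at most by a factor $1 + O(t)$ and lowers the square integral
  at most by a factor $1 - O(t)$ (\<open>transplantation_estimates\<close>).

  The rest is variational. By Glazman's principle the number $N(\kappa)$ of eigenvalues below
  $\kappa$ is the largest dimension of a space on which the energy is less than $\kappa$ times the
  square integral (\<open>complete_below_exists\<close>, \<open>negative_family_card_le\<close>), and such a space can be
  chosen to consist of test functions (\<open>negative_family_approximation\<close>). Transplantation then gives
  $N_1(\kappa)\le N_2(\kappa + s)$ and $N_2(\kappa)\le N_1(\kappa + s)$ with $s = O(d)$
  (\<open>domain_transplantation_count\<close>). Near $\Lambda_m(\Omega_1)$ the function $N_1$ has a single
  jump, of height $J_m$; hence the jumps of $N_2$ near this point have total height $J_m$ and lie
  within distance $s$ of it (\<open>counting_stability\<close>).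

  That the spectrum is discrete is derived from an inequality for test functions of a bounded
  domain: up to the squares of finitely many bounded functionals, namely mean values over the
  cells of a grid, the square integral is at most $\epsilon$ times the Dirichlet integral
  (\<open>compactness_inequality\<close>). With this form of Rellich's theorem, a minimising sequence for the
  Rayleigh quotient has a subsequence that converges in norm (\<open>rayleigh_minimiser\<close>), and spaces of
  small Rayleigh quotient have bounded dimension (\<open>negative_family_bounded\<close>). Both facts are proved
  for an abstract pair of semidefinite forms, which is realised by the pairs of a function and its
  weak gradient in $H_0^1$ (\<open>sobolev_form_pair\<close>).
\<close>

section \<open>Smooth functions\<close>

lemma Ck_Suc_imp_Ck: "Ck (Suc k) f \<Longrightarrow> Ck k f"
proof (induction k arbitrary: f)
  case 0
  then show ?case
    by (auto intro!: continuous_at_imp_continuous_on differentiable_imp_continuous_within)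
next
  case (Suc k)
  then show ?case by (metis Ck.simps(2))
qed

lemma Ck_imp_continuous: "Ck k f \<Longrightarrow> continuous_on UNIV f"
proof (induction k)
  case (Suc k)
  then show ?case using Ck_Suc_imp_Ck by blast
qed simp

lemma Ck_const: "Ck k (\<lambda>x. c)"
  by (induction k arbitrary: c) auto

lemma frechet_derivative_eqI: "(f has_derivative f') (at x) \<Longrightarrow> frechet_derivative f (at x) v = f' v"
  by (metis frechet_derivative_at)

lemma frechet_derivative_add:
  assumes "f differentiable at x" "g differentiable at x"
  shows "frechet_derivative (\<lambda>x. f x + g x) (at x) v = frechet_derivative f (at x) v + frechet_derivative g (at x) v"
  using assms by (intro frechet_derivative_eqI has_derivative_add) (auto simp: frechet_derivative_works[symmetric])

lemma frechet_derivative_mult: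
  fixes f g :: "'a::real_normed_vector \<Rightarrow> real"
  assumes "f differentiable at x" "g differentiable at x"
  shows "frechet_derivative (\<lambda>x. f x * g x) (at x) v
    = f x * frechet_derivative g (at x) v + frechet_derivative f (at x) v * g x"
  using assms by (intro frechet_derivative_eqI has_derivative_mult) (auto simp: frechet_derivative_works[symmetric])

lemma frechet_derivative_cmult:
  fixes f :: "'a::real_normed_vector \<Rightarrow> real"
  assumes "f differentiable at x"
  shows "frechet_derivative (\<lambda>x. c * f x) (at x) v = c * frechet_derivative f (at x) v"
  using frechet_derivative_mult[of "\<lambda>_. c" x f v] assms by simp

lemma Ck_add: "Ck k f \<Longrightarrow> Ck k g \<Longrightarrow> Ck k (\<lambda>x. f x + g x)"
proof (induction k arbitrary: f g)
  case 0 then show ?case by (auto intro: continuous_intros)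
next
  case (Suc k)
  have "Ck k (\<lambda>x. frechet_derivative f (at x) b + frechet_derivative g (at x) b)" if "b \<in> Basis" for b
    using Suc.prems that by (intro Suc.IH) auto
  then show ?case using Suc.prems by (simp add: frechet_derivative_add differentiable_add)
qed

lemma Ck_mult: "Ck k f \<Longrightarrow> Ck k g \<Longrightarrow> Ck k (\<lambda>x. f x * g x)"
proof (induction k arbitrary: f g)
  case 0 then show ?case by (auto intro: continuous_intros)
next
  case (Suc k)
  have "Ck k f" "Ck k g" using Suc.prems Ck_Suc_imp_Ck by blast+
  then have "Ck k (\<lambda>x. f x * frechet_derivative g (at x) b + frechet_derivative f (at x) b * g x)" if "b \<in> Basis" for b
    using Suc.prems that by (intro Ck_add Suc.IH) auto
  then show ?case using Suc.prems by (simp add: frechet_derivative_mult differentiable_mult)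
qed

lemma Ck_sum: "(\<And>i. i \<in> I \<Longrightarrow> Ck k (f i)) \<Longrightarrow> Ck k (\<lambda>x. \<Sum>i\<in>I. f i x)"
  by (induction I rule: infinite_finite_induct) (auto intro: Ck_const Ck_add)

lemma Ck_inner_const: "Ck k (\<lambda>x. x \<bullet> c)"
proof (cases k)
  case (Suc j)
  have "((\<lambda>x. x \<bullet> c) has_derivative (\<lambda>x. x \<bullet> c)) (at x)" for x :: 'a
    by (auto intro!: derivative_eq_intros)
  then have "frechet_derivative (\<lambda>x. x \<bullet> c) (at x) b = b \<bullet> c" "(\<lambda>x. x \<bullet> c) differentiable at x" for x b :: 'a
    by (auto intro!: frechet_derivative_eqI simp: differentiable_def)
  then show ?thesis using Suc by (simp add: Ck_const)
qed (auto intro: continuous_intros)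

lemma has_derivative_frechet: "f differentiable at x \<Longrightarrow> (f has_derivative frechet_derivative f (at x)) (at x)"
  by (simp add: frechet_derivative_works[symmetric])

lemma grad_inner:
  fixes f :: "'a::euclidean_space \<Rightarrow> real"
  assumes "f differentiable at x"
  shows "frechet_derivative f (at x) v = grad f x \<bullet> v"
proof -
  have lin: "linear (frechet_derivative f (at x))"
    using has_derivative_linear[OF has_derivative_frechet[OF assms]] .
  have "frechet_derivative f (at x) v = frechet_derivative f (at x) (\<Sum>b\<in>Basis. (v \<bullet> b) *\<^sub>R b)"
    by (simp add: euclidean_representation)
  also have "\<dots> = (\<Sum>b\<in>Basis. (v \<bullet> b) * frechet_derivative f (at x) b)"
    by (simp add: linear_sum[OF lin] linear_scale[OF lin])
  also have "\<dots> = grad f x \<bullet> v"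
    by (simp add: grad_def inner_sum_left inner_commute[of v] mult.commute)
  finally show ?thesis .
qed

text \<open>
  The chain rule is stated in coordinates of the inner map, since these are what \<open>Ck\<close> speaks about.
\<close>

lemma frechet_derivative_compose:
  fixes f :: "'b::euclidean_space \<Rightarrow> real" and g :: "'a::euclidean_space \<Rightarrow> 'b"
  assumes f: "f differentiable at (g x)" and g: "\<And>i. i \<in> Basis \<Longrightarrow> (\<lambda>x. g x \<bullet> i) differentiable at x"
  shows "(\<lambda>x. f (g x)) differentiable at x"
    and "frechet_derivative (\<lambda>x. f (g x)) (at x) v
      = (\<Sum>i\<in>Basis. frechet_derivative f (at (g x)) i * frechet_derivative (\<lambda>x. g x \<bullet> i) (at x) v)"
proof -
  let ?G = "\<lambda>v. \<Sum>i\<in>Basis. frechet_derivative (\<lambda>x. g x \<bullet> i) (at x) v *\<^sub>R i"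
  have "((\<lambda>x. \<Sum>i\<in>Basis. (g x \<bullet> i) *\<^sub>R i) has_derivative ?G) (at x)"
    by (intro has_derivative_sum has_derivative_scaleR_left has_derivative_frechet g)
  then have "(g has_derivative ?G) (at x)" by (simp add: euclidean_representation)
  from has_derivative_compose[OF this has_derivative_frechet[OF f]]
  have d: "((\<lambda>x. f (g x)) has_derivative (\<lambda>v. frechet_derivative f (at (g x)) (?G v))) (at x)" .
  then show "(\<lambda>x. f (g x)) differentiable at x" by (auto simp: differentiable_def)
  have lin: "linear (frechet_derivative f (at (g x)))"
    using has_derivative_linear[OF has_derivative_frechet[OF f]] .
  show "frechet_derivative (\<lambda>x. f (g x)) (at x) v
      = (\<Sum>i\<in>Basis. frechet_derivative f (at (g x)) i * frechet_derivative (\<lambda>x. g x \<bullet> i) (at x) v)"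
    unfolding frechet_derivative_eqI[OF d]
    by (simp add: linear_sum[OF lin] linear_scale[OF lin] mult.commute)
qed

lemma Ck_compose:
  fixes f :: "'b::euclidean_space \<Rightarrow> real" and g :: "'a::euclidean_space \<Rightarrow> 'b"
  assumes "Ck k f" "\<And>i. i \<in> Basis \<Longrightarrow> Ck k (\<lambda>x. g x \<bullet> i)"
  shows "Ck k (\<lambda>x. f (g x))"
  using assms
proof (induction k arbitrary: f)
  case 0
  have "continuous_on UNIV g"
    using 0 by (subst continuous_on_componentwise) auto
  then show ?case using 0 by (auto intro: continuous_on_compose2)
next
  case (Suc k)
  have d: "f differentiable at y" "i \<in> Basis \<Longrightarrow> (\<lambda>x. g x \<bullet> i) differentiable at x" for x y i
    using Suc.prems by auto
  have "Ck k (\<lambda>x. \<Sum>i\<in>Basis. frechet_derivative f (at (g x)) i * frechet_derivative (\<lambda>x. g x \<bullet> i) (at x) b)"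
    if "b \<in> Basis" for b
  proof (intro Ck_sum Ck_mult)
    fix i :: 'b assume i: "i \<in> Basis"
    show "Ck k (\<lambda>x. frechet_derivative f (at (g x)) i)"
    proof (rule Suc.IH)
      show "Ck k (\<lambda>y. frechet_derivative f (at y) i)" using Suc.prems(1) i unfolding Ck.simps by blast
      show "Ck k (\<lambda>x. g x \<bullet> j)" if "j \<in> Basis" for j using Suc.prems(2)[OF that] by (rule Ck_Suc_imp_Ck)
    qed
    show "Ck k (\<lambda>x. frechet_derivative (\<lambda>x. g x \<bullet> i) (at x) b)"
      using Suc.prems(2)[OF i] that unfolding Ck.simps by blast
  qed
  then show ?case using d by (simp add: frechet_derivative_compose)
qed

text \<open>
  For \<open>n = 0\<close> this is the classical smooth function that is flat at the origin. The factor
  \<open>(1 / s) ^ n\<close> makes the family closed under differentiation, up to linear combinations.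
\<close>

definition flat_exp :: "nat \<Rightarrow> real \<Rightarrow> real" where
  "flat_exp n s = (if s > 0 then (1 / s) ^ n * exp (- (1 / s)) else 0)"

text \<open>
  The exponential series dominates its term of degree \<open>n + 2\<close>. A quadratic bound is what makes the
  derivative at the origin vanish.
\<close>

lemma flat_exp_le: "\<bar>flat_exp n s\<bar> \<le> fact (n + 2) * s\<^sup>2"
proof (cases "s > 0")
  case True
  have "(1 / s) ^ (n + 2) / fact (n + 2) \<le> exp (1 / s)"
  proof -
    have s: "summable (\<lambda>k. (1 / s) ^ k /\<^sub>R fact k)" by (rule summable_exp_generic)
    have "(\<Sum>k\<in>{n+2}. (1 / s) ^ k /\<^sub>R fact k) \<le> (\<Sum>k. (1 / s) ^ k /\<^sub>R fact k)"
      using True by (intro sum_le_suminf s) auto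
    then show ?thesis by (simp add: exp_def field_simps)
  qed
  moreover define y where "y = 1 / s"
  ultimately have "y ^ (n + 2) \<le> fact (n + 2) * exp y" by (subst (asm) pos_divide_le_eq) (auto simp: mult.commute)
  then have "y ^ (n + 2) * exp (- y) \<le> fact (n + 2) * exp y * exp (- y)"
    by (rule mult_right_mono) simp
  also have "\<dots> = fact (n + 2)" using exp_minus_inverse[of y] by (simp add: mult.assoc)
  finally have "y ^ (n + 2) * exp (- y) * s\<^sup>2 \<le> fact (n + 2) * s\<^sup>2"
    by (rule mult_right_mono) simp
  moreover have "y ^ (n + 2) * s\<^sup>2 = y ^ n"
  proof -
    have "y ^ 2 * s\<^sup>2 = 1" using True by (simp add: y_def field_simps)
    then show ?thesis unfolding power_add mult.assoc by simp
  qed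
  ultimately have "y ^ n * exp (- y) \<le> fact (n + 2) * s\<^sup>2"
    by (metis (no_types, opaque_lifting) mult.assoc mult.commute)
  then have "(1 / s) ^ n * exp (- (1 / s)) \<le> fact (n + 2) * s\<^sup>2" unfolding y_def .
  then show ?thesis using True by (simp add: flat_exp_def)
qed (simp add: flat_exp_def)

lemma flat_exp_has_derivative:
  "(flat_exp n has_real_derivative flat_exp (n + 2) s - n * flat_exp (n + 1) s) (at s)"
proof -
  consider "s > 0" | "s < 0" | "s = 0" by linarith
  then show ?thesis
  proof cases
    case 1
    have "((\<lambda>s. (1 / s) ^ n * exp (- (1 / s))) has_real_derivative
       (1 / s) ^ (n + 2) * exp (- (1 / s)) - n * ((1 / s) ^ (n + 1) * exp (- (1 / s)))) (at s)"
    proof -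
      have d1: "((\<lambda>s. 1 / s) has_real_derivative - ((1 / s)\<^sup>2)) (at s)"
        using 1 by (auto intro!: derivative_eq_intros simp: power2_eq_square field_simps)
      have d2: "((\<lambda>s. exp (- (1 / s))) has_real_derivative exp (- (1 / s)) * (1 / s)\<^sup>2) (at s)"
        using DERIV_fun_exp[OF DERIV_minus[OF d1]] by simp
      show ?thesis
      proof (cases n)
        case 0 then show ?thesis using d2 by (simp add: power2_eq_square mult.commute)
      next
        case (Suc m)
        then show ?thesis
          using DERIV_mult[OF DERIV_power_Suc[OF d1, of m] d2] by (simp add: power2_eq_square algebra_simps)
      qed
    qed
    then have "((\<lambda>s. (1 / s) ^ n * exp (- (1 / s))) has_real_derivative
       flat_exp (n + 2) s - n * flat_exp (n + 1) s) (at s)" using 1 by (simp add: flat_exp_def)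
    then show ?thesis
      by (rule has_field_derivative_transform_within_open[where S="{0<..}"]) (use 1 in \<open>auto simp: flat_exp_def\<close>)
  next
    case 2
    have "((\<lambda>s. 0) has_real_derivative flat_exp (n + 2) s - n * flat_exp (n + 1) s) (at s)"
      using 2 by (simp add: flat_exp_def)
    then show ?thesis
      by (rule has_field_derivative_transform_within_open[where S="{..<0}"]) (use 2 in \<open>auto simp: flat_exp_def\<close>)
  next
    case 3
    have "(\<lambda>h. flat_exp n h / h) \<midarrow>0\<rightarrow> 0"
    proof (rule Lim_null_comparison)
      show "\<forall>\<^sub>F h in at 0. norm (flat_exp n h / h) \<le> fact (n + 2) * \<bar>h\<bar>"
      proof (rule always_eventually, rule allI)
        fix h :: real
        show "norm (flat_exp n h / h) \<le> fact (n + 2) * \<bar>h\<bar>"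
        proof (cases "h = 0")
          case False
          have "norm (flat_exp n h / h) \<le> fact (n + 2) * h\<^sup>2 / \<bar>h\<bar>"
            using flat_exp_le[of n h] False by (simp add: divide_right_mono)
          also have "\<dots> = fact (n + 2) * \<bar>h\<bar>" using False by (simp add: power2_eq_square field_simps abs_if)
          finally show ?thesis .
        qed simp
      qed
      show "((\<lambda>h. fact (n + 2) * \<bar>h\<bar>) \<longlongrightarrow> 0) (at (0::real))"
        by (intro tendsto_mult_right_zero tendsto_rabs_zero tendsto_ident_at)
    qed
    then show ?thesis using 3 by (simp add: DERIV_def flat_exp_def[of _ 0])
  qed
qed

lemma Ck_flat_exp: "Ck k (flat_exp n)"
proof (induction k arbitrary: n)
  case 0
  have "isCont (flat_exp n) s" for s using flat_exp_has_derivative by (rule DERIV_isCont)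
  then show ?case by (auto intro: continuous_at_imp_continuous_on)
next
  case (Suc k)
  have d: "(flat_exp n has_derivative (\<lambda>v. (flat_exp (n + 2) s - n * flat_exp (n + 1) s) * v)) (at s)" for s
    using flat_exp_has_derivative unfolding has_field_derivative_def .
  have "Ck k (\<lambda>s. flat_exp (n + 2) s + (- real n) * flat_exp (n + 1) s)"
    by (intro Ck_add Ck_mult Ck_const Suc.IH)
  then show ?case using d by (auto simp: frechet_derivative_eqI[OF d] differentiable_def)
qed

definition bump :: "'a::euclidean_space \<Rightarrow> real \<Rightarrow> 'a \<Rightarrow> real" where
  "bump p r x = flat_exp 0 (r\<^sup>2 - (norm (x - p))\<^sup>2)"

lemma bump_nonneg: "0 \<le> bump p r x"
  by (simp add: bump_def flat_exp_def)

lemma bump_pos_iff: "r > 0 \<Longrightarrow> 0 < bump p r x \<longleftrightarrow> norm (x - p) < r"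
  using power_strict_mono[of "norm (x - p)" r 2] power2_less_imp_less[of "norm (x - p)" r]
  by (auto simp: bump_def flat_exp_def)

lemma bump_le_1: "bump p r x \<le> 1"
  by (simp add: bump_def flat_exp_def)

lemma Ck_bump: "Ck k (bump p r)"
proof -
  have "Ck k (\<lambda>x. r\<^sup>2 + (-1) * (\<Sum>b\<in>Basis. (x \<bullet> b + - (p \<bullet> b)) * (x \<bullet> b + - (p \<bullet> b))))"
    by (intro Ck_add Ck_mult Ck_sum Ck_const Ck_inner_const)
  moreover have "r\<^sup>2 + (-1) * (\<Sum>b\<in>Basis. (x \<bullet> b + - (p \<bullet> b)) * (x \<bullet> b + - (p \<bullet> b))) = r\<^sup>2 - (norm (x - p))\<^sup>2" for x
  proof -
    have "(norm (x - p))\<^sup>2 = (\<Sum>b\<in>Basis. (x \<bullet> b - p \<bullet> b) * (x \<bullet> b - p \<bullet> b))"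
      unfolding power2_norm_eq_inner by (subst euclidean_inner) (simp add: inner_diff_left)
    then show ?thesis by (simp del: power2_eq_square)
  qed
  ultimately have "Ck k (\<lambda>x. r\<^sup>2 - (norm (x - p))\<^sup>2)" by simp
  then have "Ck k (\<lambda>x. flat_exp 0 (r\<^sup>2 - (norm (x - p))\<^sup>2))"
    by (intro Ck_compose[OF Ck_flat_exp]) simp
  then show ?thesis by (simp add: bump_def[abs_def])
qed

section \<open>Test functions\<close>

lemma test_function_differentiable: "test_function \<Omega> \<phi> \<Longrightarrow> \<phi> differentiable at x"
  unfolding test_function_def by (metis Ck.simps(2))

lemma test_function_continuous: "test_function \<Omega> \<phi> \<Longrightarrow> continuous_on S \<phi>"
  unfolding test_function_def by (metis Ck.simps(1) continuous_on_subset subset_UNIV)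

lemma test_function_mono: "test_function \<Omega> \<phi> \<Longrightarrow> \<Omega> \<subseteq> \<Omega>' \<Longrightarrow> test_function \<Omega>' \<phi>"
  unfolding test_function_def by blast

lemma test_function_outside: "test_function \<Omega> \<phi> \<Longrightarrow> x \<notin> \<Omega> \<Longrightarrow> \<phi> x = 0"
  unfolding test_function_def using closure_subset[of "{x. \<phi> x \<noteq> 0}"] by fast

lemma test_function_restrict_support:
  assumes "\<And>k. Ck k \<psi>" "closure {x. \<psi> x \<noteq> 0} \<subseteq> K" "compact K" "K \<subseteq> \<Omega>"
  shows "test_function \<Omega> \<psi>"
proof -
  have "compact (K \<inter> closure {x. \<psi> x \<noteq> 0})" using assms by (intro compact_Int_closed) auto
  moreover have "K \<inter> closure {x. \<psi> x \<noteq> 0} = closure {x. \<psi> x \<noteq> 0}" using assms(2) by blast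
  ultimately show ?thesis unfolding test_function_def using assms by auto
qed

lemma test_function_add:
  assumes "test_function \<Omega> f" "test_function \<Omega> g"
  shows "test_function \<Omega> (\<lambda>x. f x + g x)"
proof (rule test_function_restrict_support)
  show "Ck k (\<lambda>x. f x + g x)" for k using assms by (auto simp: test_function_def intro: Ck_add)
  show "closure {x. f x + g x \<noteq> 0} \<subseteq> closure {x. f x \<noteq> 0} \<union> closure {x. g x \<noteq> 0}"
    unfolding closure_Un[symmetric] by (rule closure_mono) auto
qed (use assms in \<open>auto simp: test_function_def\<close>)

lemma test_function_mult:
  assumes "test_function \<Omega> f" "\<And>k. Ck k g"
  shows "test_function \<Omega> (\<lambda>x. f x * g x)"
proof (rule test_function_restrict_support)
  show "Ck k (\<lambda>x. f x * g x)" for k using assms by (auto simp: test_function_def intro: Ck_mult)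
  show "closure {x. f x * g x \<noteq> 0} \<subseteq> closure {x. f x \<noteq> 0}"
    by (rule closure_mono) auto
qed (use assms in \<open>auto simp: test_function_def\<close>)

lemma test_function_scale: "test_function \<Omega> f \<Longrightarrow> test_function \<Omega> (\<lambda>x. c * f x)"
  using test_function_mult[of \<Omega> f "\<lambda>_. c", OF _ Ck_const] by (simp add: mult.commute)

lemma test_function_zero: "test_function \<Omega> (\<lambda>x. 0)"
  by (simp add: test_function_def Ck_const)

lemma frechet_derivative_outside_support:
  assumes "x \<notin> closure {x. \<phi> x \<noteq> (0::real)}"
  shows "frechet_derivative \<phi> (at x) v = 0"
proof (rule frechet_derivative_eqI)
  show "(\<phi> has_derivative (\<lambda>v. 0)) (at x)"
    by (rule has_derivative_transform_within_open[where s="- closure {x. \<phi> x \<noteq> 0}" and f="\<lambda>_. 0"])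
       (use assms closure_subset[of "{x. \<phi> x \<noteq> 0}"] in auto)
qed

lemma grad_outside_support:
  "x \<notin> closure {x. \<phi> x \<noteq> (0::real)} \<Longrightarrow> grad \<phi> x = 0"
  by (simp add: grad_def frechet_derivative_outside_support)

lemma test_function_frechet_derivative:
  assumes "test_function \<Omega> \<phi>" "b \<in> Basis"
  shows "test_function \<Omega> (\<lambda>x. frechet_derivative \<phi> (at x) b)"
proof (rule test_function_restrict_support)
  have "Ck (Suc k) \<phi>" for k using assms by (simp add: test_function_def)
  then show "Ck k (\<lambda>x. frechet_derivative \<phi> (at x) b)" for k using assms(2) by (metis Ck.simps(2))
  have "{x. frechet_derivative \<phi> (at x) b \<noteq> 0} \<subseteq> closure {x. \<phi> x \<noteq> 0}"
    using frechet_derivative_outside_support[of _ \<phi> b] by blast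
  then show "closure {x. frechet_derivative \<phi> (at x) b \<noteq> 0} \<subseteq> closure {x. \<phi> x \<noteq> 0}"
    by (simp add: closure_minimal)
qed (use assms in \<open>auto simp: test_function_def\<close>)

lemma test_function_continuous_grad: "test_function \<Omega> \<phi> \<Longrightarrow> continuous_on S (grad \<phi>)"
  unfolding grad_def[abs_def]
  by (intro continuous_intros test_function_continuous[OF test_function_frechet_derivative])

lemma test_function_grad_outside: "test_function \<Omega> \<phi> \<Longrightarrow> x \<notin> \<Omega> \<Longrightarrow> grad \<phi> x = 0"
  by (rule grad_outside_support) (auto simp: test_function_def)

lemma grad_add:
  "test_function \<Omega> f \<Longrightarrow> test_function \<Omega> g \<Longrightarrow> grad (\<lambda>x. f x + g x) = (\<lambda>x. grad f x + grad g x)"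
  by (simp add: grad_def[abs_def] frechet_derivative_add test_function_differentiable sum.distrib scaleR_left_distrib)

lemma grad_scale:
  "test_function \<Omega> f \<Longrightarrow> grad (\<lambda>x. c * f x) = (\<lambda>x. c *\<^sub>R grad f x)"
  by (simp add: grad_def[abs_def] frechet_derivative_cmult test_function_differentiable scaleR_sum_right)

lemma grad_zero: "grad (\<lambda>x. 0) = (\<lambda>x. 0)"
  by (simp add: grad_def[abs_def] frechet_derivative_const)

text \<open>
  A map at bounded distance from the identity is proper, so that the preimage of the support is
  compact again.
\<close>

lemma test_function_compose:
  fixes \<Psi> :: "'a::euclidean_space \<Rightarrow> 'a"
  assumes \<phi>: "test_function \<Omega>\<^sub>1 \<phi>" and \<Psi>: "\<And>k i. i \<in> Basis \<Longrightarrow> Ck k (\<lambda>x. \<Psi> x \<bullet> i)"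
    and near: "\<And>x. norm (\<Psi> x - x) \<le> K" and into: "\<And>x. \<Psi> x \<in> \<Omega>\<^sub>1 \<Longrightarrow> x \<in> \<Omega>\<^sub>2"
  shows "test_function \<Omega>\<^sub>2 (\<lambda>x. \<phi> (\<Psi> x))"
proof (rule test_function_restrict_support)
  let ?S = "closure {x. \<phi> x \<noteq> 0}"
  have cont: "continuous_on UNIV \<Psi>"
    using \<Psi>[THEN Ck_imp_continuous] by (subst continuous_on_componentwise) auto
  show "Ck k (\<lambda>x. \<phi> (\<Psi> x))" for k
    by (rule Ck_compose[OF _ \<Psi>]) (use \<phi> in \<open>simp_all add: test_function_def\<close>)
  have cl: "closed (\<Psi> -` ?S)" using cont by (intro closed_vimage) auto
  have "bounded ?S" using \<phi> by (auto simp: test_function_def intro: compact_imp_bounded)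
  then obtain R where R: "\<And>x. x \<in> ?S \<Longrightarrow> norm x \<le> R" by (auto simp: bounded_iff)
  have "norm x \<le> R + K" if "\<Psi> x \<in> ?S" for x
    using R[OF that] near[of x] norm_triangle_ineq[of "\<Psi> x" "x - \<Psi> x"] by (simp add: norm_minus_commute)
  then have "bounded (\<Psi> -` ?S)" by (auto simp: bounded_iff)
  then show "compact (\<Psi> -` ?S)" using cl by (simp add: compact_eq_bounded_closed)
  show "closure {x. \<phi> (\<Psi> x) \<noteq> 0} \<subseteq> \<Psi> -` ?S"
    by (rule closure_minimal[OF _ cl]) (auto intro: closure_subset[THEN subsetD])
  show "\<Psi> -` ?S \<subseteq> \<Omega>\<^sub>2" using into \<phi> by (auto simp: test_function_def)
qed

section \<open>Integration of test functions\<close>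

abbreviation dirichlet_integral :: "('a::euclidean_space \<Rightarrow> real) \<Rightarrow> real" where
  "dirichlet_integral \<phi> \<equiv> \<integral>x. (norm (grad \<phi> x))\<^sup>2 \<partial>lborel"

abbreviation square_integral :: "('a::euclidean_space \<Rightarrow> real) \<Rightarrow> real" where
  "square_integral \<phi> \<equiv> \<integral>x. (\<phi> x)\<^sup>2 \<partial>lborel"

lemma integrable_continuous_compact_support:
  fixes f :: "'a::euclidean_space \<Rightarrow> 'b::euclidean_space"
  assumes "continuous_on UNIV f" "compact K" "\<And>x. x \<notin> K \<Longrightarrow> f x = 0"
  shows "integrable lborel f"
proof -
  have "integrable lborel (\<lambda>x. indicator K x *\<^sub>R f x)"
    using assms by (intro borel_integrable_compact continuous_on_subset[OF assms(1)]) auto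
  moreover have "(\<lambda>x. indicator K x *\<^sub>R f x) = f" using assms(3) by (auto simp: indicator_def)
  ultimately show ?thesis by simp
qed

lemma test_function_integrable:
  assumes "test_function \<Omega> \<phi>"
  shows "integrable lborel \<phi>"
proof (rule integrable_continuous_compact_support[of _ "closure {x. \<phi> x \<noteq> 0}"])
  show "continuous_on UNIV \<phi>" using assms by (rule test_function_continuous)
  show "compact (closure {x. \<phi> x \<noteq> 0})" using assms by (simp add: test_function_def)
  show "\<phi> x = 0" if "x \<notin> closure {x. \<phi> x \<noteq> 0}" for x
    using that closure_subset[of "{x. \<phi> x \<noteq> 0}"] by auto
qed

lemma test_function_norm_grad_integrable:
  assumes "test_function \<Omega> \<phi>"
  shows "integrable lborel (\<lambda>x. (norm (grad \<phi> x))\<^sup>2)"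
proof (rule integrable_continuous_compact_support[of _ "closure {x. \<phi> x \<noteq> 0}"])
  show "continuous_on UNIV (\<lambda>x. (norm (grad \<phi> x))\<^sup>2)"
    by (intro continuous_intros test_function_continuous_grad[OF assms])
qed (use assms in \<open>auto simp: test_function_def grad_outside_support\<close>)

lemma test_function_power2_integrable:
  assumes "test_function \<Omega> \<phi>"
  shows "integrable lborel (\<lambda>x. (\<phi> x)\<^sup>2)"
  using test_function_integrable[OF test_function_mult[of \<Omega> \<phi> \<phi>]] assms
  by (simp add: power2_eq_square test_function_def del: Ck.simps)

lemma test_function_bounded_grad:
  assumes "test_function \<Omega> \<phi>"
  shows "\<exists>G. \<forall>x. norm (grad \<phi> x) \<le> G"
proof -
  let ?K = "closure {x. \<phi> x \<noteq> 0}"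
  have "bounded (grad \<phi> ` ?K)"
    using assms by (intro compact_imp_bounded compact_continuous_image test_function_continuous_grad[OF assms])
      (auto simp: test_function_def)
  then obtain G where "\<And>x. x \<in> ?K \<Longrightarrow> norm (grad \<phi> x) \<le> G" by (auto simp: bounded_iff)
  moreover have "x \<notin> ?K \<Longrightarrow> norm (grad \<phi> x) = 0" for x by (simp add: grad_outside_support)
  ultimately have "norm (grad \<phi> x) \<le> max G 0" for x by (metis le_max_iff_disj order_refl)
  then show ?thesis by blast
qed

lemma test_function_Lipschitz:
  assumes "test_function \<Omega> \<phi>" "\<And>x. norm (grad \<phi> x) \<le> G"
  shows "\<bar>\<phi> x - \<phi> y\<bar> \<le> G * norm (x - y)"
proof -
  have "norm (\<phi> x - \<phi> y) \<le> G * norm (x - y)"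
  proof (rule differentiable_bound[where S=UNIV and f'="\<lambda>x v. grad \<phi> x \<bullet> v"])
    fix z
    have "(\<phi> has_derivative frechet_derivative \<phi> (at z)) (at z)"
      using assms by (intro has_derivative_frechet test_function_differentiable)
    moreover have "frechet_derivative \<phi> (at z) = (\<lambda>v. grad \<phi> z \<bullet> v)"
      using grad_inner[OF test_function_differentiable[OF assms(1)]] by auto
    ultimately show "(\<phi> has_derivative (\<lambda>v. grad \<phi> z \<bullet> v)) (at z within UNIV)" by simp
    show "onorm (\<lambda>v. grad \<phi> z \<bullet> v) \<le> G"
    proof (rule onorm_le)
      fix v
      have "norm (grad \<phi> z \<bullet> v) \<le> norm (grad \<phi> z) * norm v" by (simp add: Cauchy_Schwarz_ineq2)
      also have "\<dots> \<le> G * norm v" by (intro mult_right_mono assms(2)) simp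
      finally show "norm (grad \<phi> z \<bullet> v) \<le> G * norm v" .
    qed
  qed auto
  then show ?thesis by simp
qed

definition difference_quotient :: "('a::euclidean_space \<Rightarrow> real) \<Rightarrow> 'a \<Rightarrow> nat \<Rightarrow> 'a \<Rightarrow> real" where
  "difference_quotient \<phi> z n x = real (Suc n) * (\<phi> (x + z /\<^sub>R real (Suc n)) - \<phi> x)"

lemma difference_quotient_tendsto:
  assumes "test_function \<Omega> \<phi>"
  shows "(\<lambda>n. difference_quotient \<phi> z n x) \<longlonglongrightarrow> grad \<phi> x \<bullet> z"
proof -
  have d: "(\<phi> has_derivative frechet_derivative \<phi> (at x)) (at (x + 0 *\<^sub>R z))"
    using assms by (simp add: has_derivative_frechet test_function_differentiable)
  have "((\<lambda>t. x + t *\<^sub>R z) has_derivative (\<lambda>t. t *\<^sub>R z)) (at 0)"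
    by (auto intro!: derivative_eq_intros)
  from has_derivative_compose[OF this d]
  have "((\<lambda>t. \<phi> (x + t *\<^sub>R z)) has_derivative (\<lambda>t. frechet_derivative \<phi> (at x) (t *\<^sub>R z))) (at 0)" .
  moreover have "(\<lambda>t. frechet_derivative \<phi> (at x) (t *\<^sub>R z)) = (\<lambda>t. (grad \<phi> x \<bullet> z) * t)"
    using grad_inner[OF test_function_differentiable[OF assms]] by auto
  ultimately have "((\<lambda>t. \<phi> (x + t *\<^sub>R z)) has_real_derivative grad \<phi> x \<bullet> z) (at 0)"
    by (simp add: has_field_derivative_def)
  then have "((\<lambda>t. (\<phi> (x + t *\<^sub>R z) - \<phi> x) / t) \<longlongrightarrow> grad \<phi> x \<bullet> z) (at 0)"
    by (simp add: DERIV_def)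
  moreover have "filterlim (\<lambda>n. 1 / real (Suc n)) (at 0) sequentially"
    unfolding filterlim_at using LIMSEQ_Suc[OF lim_1_over_n] by (auto intro!: always_eventually)
  ultimately have "(\<lambda>n. (\<phi> (x + (1 / real (Suc n)) *\<^sub>R z) - \<phi> x) / (1 / real (Suc n))) \<longlonglongrightarrow> grad \<phi> x \<bullet> z"
    by (rule filterlim_compose)
  then show ?thesis by (simp add: difference_quotient_def divide_inverse mult.commute)
qed

text \<open>
  A single integrable majorant for all step sizes at most \<open>norm z\<close>: the function is Lipschitz
  continuous, and its support, enlarged by \<open>norm z\<close>, is bounded.
\<close>

lemma difference_quotient_bound:
  assumes "test_function \<Omega> \<phi>"
  shows "\<exists>G R. \<forall>n x. \<bar>difference_quotient \<phi> z n x\<bar> \<le> G * indicator (cball 0 R) x"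
proof -
  obtain G where G: "\<And>x. norm (grad \<phi> x) \<le> G" using test_function_bounded_grad[OF assms] by blast
  have "bounded (closure {x. \<phi> x \<noteq> 0})" using assms by (auto simp: test_function_def intro: compact_imp_bounded)
  then obtain R where R: "\<And>x. x \<in> closure {x. \<phi> x \<noteq> 0} \<Longrightarrow> norm x \<le> R" by (auto simp: bounded_iff)
  have R': "\<phi> x = 0" if "norm x > R" for x
    using R[of x] closure_subset[of "{x. \<phi> x \<noteq> 0}"] that by force
  have "\<bar>difference_quotient \<phi> z n x\<bar> \<le> G * norm z * indicator (cball 0 (R + norm z)) x" for n x
  proof (cases "norm x \<le> R + norm z")
    case True
    have "\<bar>\<phi> (x + z /\<^sub>R real (Suc n)) - \<phi> x\<bar> \<le> G * norm (x + z /\<^sub>R real (Suc n) - x)"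
      by (rule test_function_Lipschitz[OF assms G])
    also have "\<dots> = G * norm z / real (Suc n)" by (simp add: divide_inverse)
    finally have "real (Suc n) * \<bar>\<phi> (x + z /\<^sub>R real (Suc n)) - \<phi> x\<bar> \<le> real (Suc n) * (G * norm z / real (Suc n))"
      by (intro mult_left_mono) auto
    then show ?thesis using True by (simp add: difference_quotient_def abs_mult)
  next
    case False
    have "norm (z /\<^sub>R real (Suc n)) \<le> norm z" by (simp add: field_simps mult_left_le_one_le)
    then have "norm (x + z /\<^sub>R real (Suc n)) > R"
      using False norm_triangle_ineq2[of x "- (z /\<^sub>R real (Suc n))"] by simp
    moreover have "norm x > R" using False norm_ge_zero[of z] by linarith
    ultimately show ?thesis using R' False by (simp add: difference_quotient_def)
  qed
  then show ?thesis by blast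
qed

lemma lborel_translate_integral:
  fixes f :: "'a::euclidean_space \<Rightarrow> real"
  assumes "f \<in> borel_measurable borel"
  shows "(\<integral>x. f (x + c) \<partial>lborel) = (\<integral>x. f x \<partial>lborel)"
    and "integrable lborel (\<lambda>x. f (x + c)) \<longleftrightarrow> integrable lborel f"
proof -
  have "(\<integral>x. f x \<partial>distr lborel borel ((+) c)) = (\<integral>x. f (c + x) \<partial>lborel)"
    by (rule integral_distr) (use assms in auto)
  then show "(\<integral>x. f (x + c) \<partial>lborel) = (\<integral>x. f x \<partial>lborel)"
    unfolding lborel_distr_plus by (simp add: add.commute)
  have "integrable (distr lborel borel ((+) c)) f \<longleftrightarrow> integrable lborel (\<lambda>x. f (c + x))"
    by (rule integrable_distr_eq) (use assms in auto)
  then show "integrable lborel (\<lambda>x. f (x + c)) \<longleftrightarrow> integrable lborel f"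
    unfolding lborel_distr_plus by (simp add: add.commute)
qed

lemma test_function_borel: "test_function \<Omega> \<phi> \<Longrightarrow> \<phi> \<in> borel_measurable borel"
  by (rule borel_measurable_continuous_onI, erule test_function_continuous)

lemma test_function_continuous_translate:
  "test_function \<Omega> \<phi> \<Longrightarrow> continuous_on S (\<lambda>x. \<phi> (x + z))"
  by (rule continuous_on_compose2[where t=UNIV and g=\<phi>])
     (auto intro: test_function_continuous continuous_intros)

lemma difference_quotient_borel:
  "test_function \<Omega> \<phi> \<Longrightarrow> difference_quotient \<phi> z n \<in> borel_measurable borel"
  unfolding difference_quotient_def[abs_def]
  by (intro borel_measurable_continuous_onI continuous_on_mult continuous_on_diff continuous_on_const
      test_function_continuous_translate test_function_continuous)

lemma integrable_indicator_cball: "integrable lborel (\<lambda>x::'a::euclidean_space. G * indicator (cball 0 R) x :: real)"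
proof -
  have "integrable lborel (\<lambda>x::'a. indicator (cball 0 R) x *\<^sub>R G)"
    by (intro borel_integrable_compact continuous_intros compact_cball)
  then show ?thesis by (simp add: mult.commute)
qed

text \<open>
  Every difference quotient has integral zero by translation invariance, and the derivative is their
  dominated limit.
\<close>

lemma integral_directional_derivative_zero:
  assumes "test_function \<Omega> \<phi>"
  shows "(\<integral>x. grad \<phi> x \<bullet> z \<partial>lborel) = 0"
proof -
  obtain G R where GR: "\<And>n x. \<bar>difference_quotient \<phi> z n x\<bar> \<le> G * indicator (cball 0 R) x"
    using difference_quotient_bound[OF assms] by blast
  have "(\<lambda>n. \<integral>x. difference_quotient \<phi> z n x \<partial>lborel) \<longlonglongrightarrow> (\<integral>x. grad \<phi> x \<bullet> z \<partial>lborel)"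
  proof (rule integral_dominated_convergence[where w="\<lambda>x. G * indicator (cball 0 R) x"])
    show "(\<lambda>x. grad \<phi> x \<bullet> z) \<in> borel_measurable lborel"
      using assms by (simp add: borel_measurable_continuous_onI continuous_on_inner test_function_continuous_grad)
    show "integrable lborel (\<lambda>x. G * indicat_real (cball 0 R) x)" by (rule integrable_indicator_cball)
    show "AE x in lborel. norm (difference_quotient \<phi> z n x) \<le> G * indicator (cball 0 R) x" for n
      using GR by simp
    show "AE x in lborel. (\<lambda>n. difference_quotient \<phi> z n x) \<longlonglongrightarrow> grad \<phi> x \<bullet> z"
      using difference_quotient_tendsto[OF assms] by simp
  qed (use difference_quotient_borel[OF assms] in simp)
  moreover have "(\<integral>x. difference_quotient \<phi> z n x \<partial>lborel) = 0" for n
  proof -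
    have i: "integrable lborel \<phi>" "integrable lborel (\<lambda>x. \<phi> (x + z /\<^sub>R real (Suc n)))"
      using assms test_function_integrable[OF assms] by (auto simp: lborel_translate_integral(2) test_function_borel)
    then show ?thesis
      using lborel_translate_integral(1)[OF test_function_borel[OF assms], of "z /\<^sub>R real (Suc n)"]
      by (simp add: difference_quotient_def)
  qed
  ultimately show ?thesis by (simp add: LIMSEQ_const_iff)
qed

lemma integration_by_parts:
  assumes f: "test_function \<Omega> f" and g: "test_function \<Omega> g" and b: "b \<in> Basis"
  shows "(\<integral>x. f x * frechet_derivative g (at x) b \<partial>lborel) = - (\<integral>x. (grad f x \<bullet> b) * g x \<partial>lborel)"
proof -
  have sm: "Ck k f" "Ck k g" for k using f g by (auto simp: test_function_def simp del: Ck.simps)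
  have fg: "test_function \<Omega> (\<lambda>x. f x * g x)" by (rule test_function_mult[OF f sm(2)])
  have d: "f differentiable at x" "g differentiable at x" for x using f g test_function_differentiable by blast+
  have "grad (\<lambda>x. f x * g x) x \<bullet> b = f x * frechet_derivative g (at x) b + (grad f x \<bullet> b) * g x" for x
    using grad_inner[OF test_function_differentiable[OF fg], of x b] grad_inner[OF d(1), of x b] d
    by (simp add: frechet_derivative_mult)
  then have "(\<integral>x. f x * frechet_derivative g (at x) b + (grad f x \<bullet> b) * g x \<partial>lborel) = 0"
    using integral_directional_derivative_zero[OF fg, of b] by simp
  moreover have "integrable lborel (\<lambda>x. f x * frechet_derivative g (at x) b)"
    by (rule test_function_integrable[of \<Omega>])
       (use test_function_mult[OF test_function_frechet_derivative[OF g b] sm(1)] in \<open>simp add: mult.commute\<close>)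
  moreover have "integrable lborel (\<lambda>x. (grad f x \<bullet> b) * g x)"
    using test_function_integrable[OF test_function_mult[OF test_function_frechet_derivative[OF f b] sm(2)]] grad_inner[OF d(1), of _ b]
    by simp
  ultimately show ?thesis by simp
qed

text \<open>
  The translation by \<open>z\<close> is split into \<open>n + 1\<close> equal steps. The Cauchy--Schwarz inequality for the
  telescoping sum and translation invariance bound the left-hand side, for each \<open>n\<close>, by the square
  integral of the difference quotient with step \<open>z / (n + 1)\<close>, which converges as \<open>n\<close> grows.
\<close>

lemma translation_L2_estimate:
  assumes "test_function \<Omega> \<phi>"
  shows "(\<integral>x. (\<phi> (x + z) - \<phi> x)\<^sup>2 \<partial>lborel) \<le> (norm z)\<^sup>2 * dirichlet_integral \<phi>"
proof -
  obtain G R where GR: "\<And>n x. \<bar>difference_quotient \<phi> z n x\<bar> \<le> G * indicator (cball 0 R) x"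
    using difference_quotient_bound[OF assms] by blast
  have "(\<lambda>n. \<integral>x. (difference_quotient \<phi> z n x)\<^sup>2 \<partial>lborel) \<longlonglongrightarrow> (\<integral>x. (grad \<phi> x \<bullet> z)\<^sup>2 \<partial>lborel)"
  proof (rule integral_dominated_convergence[where w="\<lambda>x. G\<^sup>2 * indicator (cball 0 R) x"])
    show "(\<lambda>x. (grad \<phi> x \<bullet> z)\<^sup>2) \<in> borel_measurable lborel"
      using assms by (simp add: borel_measurable_continuous_onI continuous_on_inner continuous_on_power test_function_continuous_grad)
    show "integrable lborel (\<lambda>x. G\<^sup>2 * indicat_real (cball 0 R) x)" by (rule integrable_indicator_cball)
    show "AE x in lborel. (\<lambda>n. (difference_quotient \<phi> z n x)\<^sup>2) \<longlonglongrightarrow> (grad \<phi> x \<bullet> z)\<^sup>2"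
      using difference_quotient_tendsto[OF assms] by (simp add: tendsto_power)
    show "AE x in lborel. norm ((difference_quotient \<phi> z n x)\<^sup>2) \<le> G\<^sup>2 * indicator (cball 0 R) x" for n
    proof (rule AE_I2)
      fix x
      have "(\<bar>difference_quotient \<phi> z n x\<bar>)\<^sup>2 \<le> (G * indicator (cball 0 R) x)\<^sup>2"
        using GR[of n x] by (intro power_mono) auto
      then show "norm ((difference_quotient \<phi> z n x)\<^sup>2) \<le> G\<^sup>2 * indicator (cball 0 R) x"
        by (cases "x \<in> cball 0 R") auto
    qed
  qed (use difference_quotient_borel[OF assms] in simp)
  moreover have "(\<integral>x. (\<phi> (x + z) - \<phi> x)\<^sup>2 \<partial>lborel) \<le> (\<integral>x. (difference_quotient \<phi> z n x)\<^sup>2 \<partial>lborel)" for n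
  proof -
    define w where "w = z /\<^sub>R real (Suc n)"
    define d where "d = (\<lambda>x. (\<phi> (x + w) - \<phi> x)\<^sup>2)"
    have cd: "continuous_on UNIV d" unfolding d_def
      by (intro continuous_on_power continuous_on_diff test_function_continuous_translate[OF assms] test_function_continuous[OF assms])
    then have md: "d \<in> borel_measurable borel" by (rule borel_measurable_continuous_onI)
    have dq: "d x = (difference_quotient \<phi> z n x)\<^sup>2 / (real (Suc n))\<^sup>2" for x
      by (simp add: d_def difference_quotient_def w_def power_mult_distrib)
    have id: "integrable lborel d"
    proof (rule Bochner_Integration.integrable_bound[OF integrable_indicator_cball[of "G\<^sup>2" R]])
      show "AE x in lborel. norm (d x) \<le> norm (G\<^sup>2 * indicator (cball 0 R) x :: real)"
      proof (rule AE_I2)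
        fix x
        have "(difference_quotient \<phi> z n x)\<^sup>2 \<le> (G * indicator (cball 0 R) x)\<^sup>2"
          using power_mono[OF GR[of n x], of 2] by simp
        moreover have "d x \<le> (difference_quotient \<phi> z n x)\<^sup>2" unfolding dq
          by (rule divide_left_mono[of 1, simplified]) auto
        moreover have "d x \<ge> 0" by (simp add: d_def)
        ultimately show "norm (d x) \<le> norm (G\<^sup>2 * indicator (cball 0 R) x :: real)"
          by (cases "x \<in> cball 0 R") auto
      qed
    qed (use md in simp)
    have tr: "integrable lborel (\<lambda>x. d (x + real i *\<^sub>R w))" "(\<integral>x. d (x + real i *\<^sub>R w) \<partial>lborel) = integral\<^sup>L lborel d" for i
      using id md by (auto simp: lborel_translate_integral)
    have z: "z = real (Suc n) *\<^sub>R w" by (simp add: w_def)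
    have point: "(\<phi> (x + z) - \<phi> x)\<^sup>2 \<le> real (Suc n) * (\<Sum>i<Suc n. d (x + real i *\<^sub>R w))" for x
    proof -
      have "\<phi> (x + z) - \<phi> x = (\<Sum>i<Suc n. \<phi> (x + real (Suc i) *\<^sub>R w) - \<phi> (x + real i *\<^sub>R w))"
        using sum_lessThan_telescope[of "\<lambda>i. \<phi> (x + real i *\<^sub>R w)" "Suc n"] by (simp add: z)
      also have "\<dots> = (\<Sum>i<Suc n. 1 * (\<phi> (x + real (Suc i) *\<^sub>R w) - \<phi> (x + real i *\<^sub>R w)))" by simp
      also have "\<dots>\<^sup>2 \<le> (\<Sum>i<Suc n. 1\<^sup>2) * (\<Sum>i<Suc n. (\<phi> (x + real (Suc i) *\<^sub>R w) - \<phi> (x + real i *\<^sub>R w))\<^sup>2)"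
        by (rule Cauchy_Schwarz_ineq_sum)
      also have "\<dots> = real (Suc n) * (\<Sum>i<Suc n. d (x + real i *\<^sub>R w))"
        by (simp add: d_def scaleR_left_distrib add_ac)
      finally show ?thesis .
    qed
    have "(\<integral>x. (\<phi> (x + z) - \<phi> x)\<^sup>2 \<partial>lborel) \<le> (\<integral>x. real (Suc n) * (\<Sum>i<Suc n. d (x + real i *\<^sub>R w)) \<partial>lborel)"
    proof (rule Bochner_Integration.integral_mono')
      show "integrable lborel (\<lambda>x. real (Suc n) * (\<Sum>i<Suc n. d (x + real i *\<^sub>R w)))"
        by (intro integrable_mult_right Bochner_Integration.integrable_sum tr)
      show "0 \<le> real (Suc n) * (\<Sum>i<Suc n. d (x + real i *\<^sub>R w))" for x
        by (intro mult_nonneg_nonneg sum_nonneg) (auto simp: d_def)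
    qed (use point in simp)
    also have "\<dots> = real (Suc n) * (\<Sum>i<Suc n. integral\<^sup>L lborel d)"
      by (subst integral_mult_right_zero) (simp only: Bochner_Integration.integral_sum[OF tr(1)] tr(2))
    also have "\<dots> = (\<integral>x. (difference_quotient \<phi> z n x)\<^sup>2 \<partial>lborel)"
      by (simp add: dq[abs_def] power2_eq_square flip: dq)
    finally show ?thesis .
  qed
  ultimately have "(\<integral>x. (\<phi> (x + z) - \<phi> x)\<^sup>2 \<partial>lborel) \<le> (\<integral>x. (grad \<phi> x \<bullet> z)\<^sup>2 \<partial>lborel)"
    by (intro LIMSEQ_le_const) auto
  also have "\<dots> \<le> (\<integral>x. (norm z)\<^sup>2 * (norm (grad \<phi> x))\<^sup>2 \<partial>lborel)"
  proof (rule Bochner_Integration.integral_mono')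
    show "integrable lborel (\<lambda>x. (norm z)\<^sup>2 * (norm (grad \<phi> x))\<^sup>2)"
      by (intro integrable_mult_right test_function_norm_grad_integrable[OF assms])
    show "(grad \<phi> x \<bullet> z)\<^sup>2 \<le> (norm z)\<^sup>2 * (norm (grad \<phi> x))\<^sup>2" for x
      using Cauchy_Schwarz_ineq[of "grad \<phi> x" z] by (simp add: power2_norm_eq_inner mult.commute)
  qed auto
  finally show ?thesis by simp
qed

section \<open>Rellich compactness as an inequality\<close>

text \<open>
  The level sets are the half-open cubes of a grid of mesh \<open>h\<close>. Indices vanish off the basis, so that
  they are determined by the cube.
\<close>

definition cell_index :: "real \<Rightarrow> 'a::euclidean_space \<Rightarrow> 'a \<Rightarrow> int" where
  "cell_index h x = (\<lambda>b. if b \<in> Basis then \<lfloor>(x \<bullet> b) / h\<rfloor> else 0)"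

lemma cell_vimage_eq:
  fixes k :: "'a::euclidean_space \<Rightarrow> int" and h :: real
  assumes h: "h > 0" and k: "\<And>b. b \<notin> Basis \<Longrightarrow> k b = 0"
  defines "l \<equiv> \<Sum>b\<in>Basis. (h * k b) *\<^sub>R b" and "u \<equiv> \<Sum>b\<in>Basis. (h * (k b + 1)) *\<^sub>R b"
  shows "{x. cell_index h x = k} = {x. \<forall>b\<in>Basis. l \<bullet> b \<le> x \<bullet> b \<and> x \<bullet> b < u \<bullet> b}"
proof -
  have l: "l \<bullet> b = h * k b" "u \<bullet> b = h * (k b + 1)" if "b \<in> Basis" for b
    using that by (auto simp: l_def u_def inner_sum_left_Basis)
  have "\<lfloor>(x \<bullet> b) / h\<rfloor> = k b \<longleftrightarrow> h * k b \<le> x \<bullet> b \<and> x \<bullet> b < h * (k b + 1)" for x b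
    using h by (auto simp: floor_eq_iff field_simps)
  then show ?thesis using l k by (auto simp: cell_index_def fun_eq_iff)
qed

text \<open>
  The half-open cube lies between an open and a closed box of the same measure.
\<close>

lemma cell_measure:
  fixes k :: "'a::euclidean_space \<Rightarrow> int" and h :: real
  assumes h: "h > 0" and k: "\<And>b. b \<notin> Basis \<Longrightarrow> k b = 0"
  shows "{x. cell_index h x = k} \<in> sets borel" "emeasure lborel {x. cell_index h x = k} = ennreal (h ^ DIM('a))"
proof -
  define l where "l = (\<Sum>b\<in>Basis. (h * k b) *\<^sub>R b)"
  define u where "u = (\<Sum>b\<in>Basis. (h * (k b + 1)) *\<^sub>R b)"
  let ?Q = "{x. \<forall>b\<in>Basis. l \<bullet> b \<le> x \<bullet> b \<and> x \<bullet> b < u \<bullet> b}"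
  have Q: "{x. cell_index h x = k} = ?Q" unfolding l_def u_def by (rule cell_vimage_eq[OF h k])
  have l: "l \<bullet> b = h * k b" "u \<bullet> b = h * (k b + 1)" if "b \<in> Basis" for b
    using that by (auto simp: l_def u_def inner_sum_left_Basis)
  have lu: "l \<bullet> b \<le> u \<bullet> b" "(u - l) \<bullet> b = h" if "b \<in> Basis" for b
    using that h by (auto simp: l inner_diff_left algebra_simps)
  have "?Q = (\<Inter>b\<in>Basis. {x. l \<bullet> b \<le> x \<bullet> b} \<inter> {x. x \<bullet> b < u \<bullet> b})" by auto
  also have "\<dots> \<in> sets borel" by (intro sets.countable_INT'' sets.finite_INT) auto
  finally show m: "{x. cell_index h x = k} \<in> sets borel" unfolding Q .
  have e: "emeasure lborel (box l u) = ennreal (h ^ DIM('a))" "emeasure lborel (cbox l u) = ennreal (h ^ DIM('a))"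
    using lu by (auto simp: emeasure_lborel_box emeasure_lborel_cbox)
  have "emeasure lborel (box l u) \<le> emeasure lborel ?Q"
    by (rule emeasure_mono) (use m Q in \<open>auto simp: box_def less_imp_le\<close>)
  moreover have "emeasure lborel ?Q \<le> emeasure lborel (cbox l u)"
    by (rule emeasure_mono) (auto simp: cbox_def less_imp_le)
  ultimately show "emeasure lborel {x. cell_index h x = k} = ennreal (h ^ DIM('a))"
    unfolding Q e by (rule antisym[rotated])
qed

lemma cell_index_diff:
  assumes h: "h > 0" and eq: "cell_index h x = cell_index h y" and b: "b \<in> Basis"
  shows "\<bar>(x - y) \<bullet> b\<bar> \<le> h"
proof -
  have f: "\<lfloor>(x \<bullet> b) / h\<rfloor> = \<lfloor>(y \<bullet> b) / h\<rfloor>" using fun_cong[OF eq, of b] b by (simp add: cell_index_def)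
  have "(x \<bullet> b) / h < \<lfloor>(x \<bullet> b) / h\<rfloor> + 1" "\<lfloor>(x \<bullet> b) / h\<rfloor> \<le> (x \<bullet> b) / h"
     "(y \<bullet> b) / h < \<lfloor>(y \<bullet> b) / h\<rfloor> + 1" "\<lfloor>(y \<bullet> b) / h\<rfloor> \<le> (y \<bullet> b) / h" by linarith+
  then have "\<bar>(x \<bullet> b) / h - (y \<bullet> b) / h\<bar> \<le> 1" using f by linarith
  then show ?thesis using h by (simp add: inner_diff_left field_simps flip: diff_divide_distrib)
qed

lemma finite_cells:
  fixes \<Omega> :: "'a::euclidean_space set"
  assumes "bounded \<Omega>"
  shows "finite (cell_index h ` \<Omega>)"
proof -
  obtain R where R: "\<And>x. x \<in> \<Omega> \<Longrightarrow> norm x \<le> R" using assms by (auto simp: bounded_iff)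
  define m where "m = \<lceil>R / \<bar>h\<bar>\<rceil> + 1"
  have "cell_index h x \<in> {f. \<forall>b. (b \<in> Basis \<longrightarrow> f b \<in> {-m..m}) \<and> (b \<notin> Basis \<longrightarrow> f b = 0)}" if "x \<in> \<Omega>" for x
  proof -
    have "\<lfloor>(x \<bullet> b) / h\<rfloor> \<in> {-m..m}" if b: "b \<in> Basis" for b
    proof -
      have "\<bar>x \<bullet> b\<bar> \<le> R" using Basis_le_norm[OF b, of x] R[OF \<open>x \<in> \<Omega>\<close>] by linarith
      then have "\<bar>(x \<bullet> b) / h\<bar> \<le> R / \<bar>h\<bar>" by (simp add: abs_divide divide_right_mono)
      then have "- (R / \<bar>h\<bar>) \<le> (x \<bullet> b) / h" "(x \<bullet> b) / h \<le> R / \<bar>h\<bar>" by linarith+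
      then show ?thesis unfolding m_def by (simp, linarith)
    qed
    then show ?thesis by (auto simp: cell_index_def)
  qed
  then show ?thesis
    by (intro finite_subset[OF _ finite_set_of_finite_funs[of Basis "{-m..m}" 0]]) auto
qed

lemma lborel_translate_nn_integral:
  fixes f :: "'a::euclidean_space \<Rightarrow> ennreal"
  assumes "f \<in> borel_measurable borel"
  shows "(\<integral>\<^sup>+x. f (c + x) \<partial>lborel) = (\<integral>\<^sup>+x. f x \<partial>lborel)"
proof -
  have "(\<integral>\<^sup>+x. f x \<partial>distr lborel borel ((+) c)) = (\<integral>\<^sup>+x. f (c + x) \<partial>lborel)"
    by (rule nn_integral_distr) (use assms in auto)
  then show ?thesis unfolding lborel_distr_plus by simp
qed

text \<open>
  The cube \<open>B\<close> contains all differences of two points in one grid cell. By Fubini's theorem the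
  integral over it reduces to the estimate for single translations, which have length at most
  \<open>DIM('a) * h\<close>.
\<close>

lemma averaged_translation_estimate:
  fixes \<phi> :: "'a::euclidean_space \<Rightarrow> real" and h :: real
  assumes \<phi>: "test_function \<Omega> \<phi>" and h: "h > 0"
  defines "B \<equiv> cbox (- (\<Sum>b\<in>Basis. h *\<^sub>R b)) (\<Sum>b\<in>Basis. h *\<^sub>R b :: 'a)"
  shows "(\<integral>\<^sup>+x. \<integral>\<^sup>+z. indicator B z * ennreal ((\<phi> (x + z) - \<phi> x)\<^sup>2) \<partial>lborel \<partial>lborel)
    \<le> ennreal ((2 * h) ^ DIM('a) * ((DIM('a) * h)\<^sup>2 * dirichlet_integral \<phi>))"
proof -
  have [measurable]: "\<phi> \<in> borel_measurable borel" by (rule test_function_borel[OF \<phi>])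
  let ?G = "\<integral>x. (norm (grad \<phi> x))\<^sup>2 \<partial>lborel"
  have G0: "?G \<ge> 0" by simp
  have inB: "norm z \<le> DIM('a) * h" if "z \<in> B" for z :: 'a
  proof -
    have "norm z \<le> (\<Sum>b\<in>Basis. \<bar>z \<bullet> b\<bar>)" by (rule norm_le_l1)
    also have "\<dots> \<le> (\<Sum>b\<in>(Basis::'a set). h)"
    proof (rule sum_mono)
      fix b :: 'a assume b: "b \<in> Basis"
      have "(\<Sum>b\<in>Basis. h *\<^sub>R b :: 'a) \<bullet> b = h" using b inner_sum_left_Basis[of b "\<lambda>_. h"] by simp
      then have "- h \<le> z \<bullet> b" "z \<bullet> b \<le> h" using that b by (auto simp: B_def mem_box inner_minus_left)
      then show "\<bar>z \<bullet> b\<bar> \<le> h" by linarith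
    qed
    finally show ?thesis by simp
  qed
  have Bm: "emeasure lborel B = ennreal ((2 * h) ^ DIM('a))"
  proof -
    have "(\<Sum>b\<in>Basis. h *\<^sub>R b :: 'a) \<bullet> b = h" if "b \<in> Basis" for b
      using that inner_sum_left_Basis[of b "\<lambda>_. h"] by simp
    then show ?thesis using h by (simp add: B_def emeasure_lborel_cbox inner_minus_left inner_diff_left inner_add_left)
  qed
  have "(\<integral>\<^sup>+x. \<integral>\<^sup>+z. indicator B z * ennreal ((\<phi> (x + z) - \<phi> x)\<^sup>2) \<partial>lborel \<partial>lborel)
      = (\<integral>\<^sup>+z. \<integral>\<^sup>+x. indicator B z * ennreal ((\<phi> (x + z) - \<phi> x)\<^sup>2) \<partial>lborel \<partial>lborel)"
    by (rule lborel_pair.Fubini') (simp add: B_def)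
  also have "\<dots> = (\<integral>\<^sup>+z. indicator B z * (\<integral>\<^sup>+x. ennreal ((\<phi> (x + z) - \<phi> x)\<^sup>2) \<partial>lborel) \<partial>lborel)"
    by (intro nn_integral_cong nn_integral_cmult) simp
  also have "\<dots> \<le> (\<integral>\<^sup>+z. indicator B z * ennreal ((DIM('a) * h)\<^sup>2 * ?G) \<partial>lborel)"
  proof (intro nn_integral_mono)
    fix z :: 'a
    show "indicator B z * (\<integral>\<^sup>+x. ennreal ((\<phi> (x + z) - \<phi> x)\<^sup>2) \<partial>lborel)
      \<le> indicator B z * ennreal ((DIM('a) * h)\<^sup>2 * ?G)"
    proof (cases "z \<in> B")
      case True
      have int: "integrable lborel (\<lambda>x. (\<phi> (x + z) - \<phi> x)\<^sup>2)"
      proof -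
        have "integrable lborel (\<lambda>x. (\<phi> (x + z))\<^sup>2)"
          using lborel_translate_integral(2)[of "\<lambda>x. (\<phi> x)\<^sup>2" z] test_function_power2_integrable[OF \<phi>] by simp
        then have "integrable lborel (\<lambda>x. 2 * (\<phi> (x + z))\<^sup>2 + 2 * (\<phi> x)\<^sup>2)"
          using test_function_power2_integrable[OF \<phi>] by simp
        then show ?thesis
        proof (rule Bochner_Integration.integrable_bound)
          have "norm ((\<phi> (x + z) - \<phi> x)\<^sup>2) \<le> norm (2 * (\<phi> (x + z))\<^sup>2 + 2 * (\<phi> x)\<^sup>2)" for x
          proof -
            have "(\<phi> (x + z) - \<phi> x)\<^sup>2 + (\<phi> (x + z) + \<phi> x)\<^sup>2 = 2 * (\<phi> (x + z))\<^sup>2 + 2 * (\<phi> x)\<^sup>2"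
              by (simp add: power2_eq_square algebra_simps)
            then have "(\<phi> (x + z) - \<phi> x)\<^sup>2 \<le> 2 * (\<phi> (x + z))\<^sup>2 + 2 * (\<phi> x)\<^sup>2"
              by (metis le_add_same_cancel1 zero_le_power2)
            then show ?thesis by simp
          qed
          then show "AE x in lborel. norm ((\<phi> (x + z) - \<phi> x)\<^sup>2) \<le> norm (2 * (\<phi> (x + z))\<^sup>2 + 2 * (\<phi> x)\<^sup>2)" by simp
        qed simp
      qed
      have "(\<integral>\<^sup>+x. ennreal ((\<phi> (x + z) - \<phi> x)\<^sup>2) \<partial>lborel) = ennreal (\<integral>x. (\<phi> (x + z) - \<phi> x)\<^sup>2 \<partial>lborel)"
        by (rule nn_integral_eq_integral[OF int]) simp
      also have "\<dots> \<le> ennreal ((norm z)\<^sup>2 * ?G)"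
        by (rule ennreal_leI[OF translation_L2_estimate[OF \<phi>]])
      also have "\<dots> \<le> ennreal ((DIM('a) * h)\<^sup>2 * ?G)"
        using inB[OF True] G0 by (intro ennreal_leI mult_right_mono power_mono) auto
      finally show ?thesis by (intro mult_left_mono) auto
    qed simp
  qed
  also have "\<dots> = ennreal ((DIM('a) * h)\<^sup>2 * ?G) * emeasure lborel B"
    by (subst mult.commute, rule nn_integral_cmult_indicator) (simp add: B_def)
  also have "\<dots> = ennreal ((2 * h) ^ DIM('a) * ((DIM('a) * h)\<^sup>2 * ?G))"
    unfolding Bm using h by (subst ennreal_mult[symmetric]) (auto simp: mult.commute)
  finally show ?thesis .
qed

text \<open>
  On a cell \<open>Q\<close>, expanding the square shows that $|Q|\int_Q\varphi^2 - (\int_Q\varphi)^2$ is half of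
  the double integral of $(\varphi(x) - \varphi(y))^2$ over \<open>Q \<times> Q\<close>. Two points of the same cell differ by a
  translation in a cube of side \<open>2 * h\<close>, so that summing over the cells leaves a single averaged
  translation estimate.
\<close>

lemma cell_oscillation_estimate:
  fixes \<phi> :: "'a::euclidean_space \<Rightarrow> real" and h :: real
  assumes \<phi>: "test_function \<Omega> \<phi>" and h: "h > 0" and \<Omega>: "bounded \<Omega>"
  defines "Q \<equiv> (\<lambda>k. {x. cell_index h x = k})" and "I \<equiv> cell_index h ` \<Omega>"
  shows "h ^ DIM('a) * square_integral \<phi> \<le> (\<Sum>k\<in>I. (\<integral>x. indicator (Q k) x * \<phi> x \<partial>lborel)\<^sup>2)
    + (2 * h) ^ DIM('a) * ((DIM('a) * h)\<^sup>2 * dirichlet_integral \<phi>)"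
proof -
  have [measurable]: "\<phi> \<in> borel_measurable borel" by (rule test_function_borel[OF \<phi>])
  have finI: "finite I" unfolding I_def by (rule finite_cells[OF \<Omega>])
  have Q[measurable]: "Q k \<in> sets borel" and Qm: "emeasure lborel (Q k) = ennreal (h ^ DIM('a))" if "k \<in> I" for k
  proof -
    have "b \<notin> Basis \<Longrightarrow> k b = 0" for b using that by (auto simp: I_def cell_index_def)
    then show "Q k \<in> sets borel" "emeasure lborel (Q k) = ennreal (h ^ DIM('a))"
      unfolding Q_def using cell_measure[OF h] by blast+
  qed
  let ?m = "h ^ DIM('a)"
  have m: "?m > 0" using h by simp
  have Qmeas: "measure lborel (Q k) = ?m" if "k \<in> I" for k using Qm[OF that] m by (simp add: measure_def)
  have iQ: "integrable lborel (indicat_real (Q k))" if "k \<in> I" for k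
    using Q[OF that] Qm[OF that] by simp
  have i1: "integrable lborel (\<lambda>x. indicator (Q k) x * \<phi> x)" if "k \<in> I" for k
    using integrable_mult_indicator[of "Q k" lborel \<phi>] Q[OF that] test_function_integrable[OF \<phi>] by simp
  have i2: "integrable lborel (\<lambda>x. indicator (Q k) x * (\<phi> x)\<^sup>2)" if "k \<in> I" for k
    using integrable_mult_indicator[of "Q k" lborel "\<lambda>x. (\<phi> x)\<^sup>2"] Q[OF that] test_function_power2_integrable[OF \<phi>] by simp
  define a where "a = (\<lambda>k. \<integral>x. indicator (Q k) x * \<phi> x \<partial>lborel)"
  define c where "c = (\<lambda>k. \<integral>x. indicator (Q k) x * (\<phi> x)\<^sup>2 \<partial>lborel)"
  define F where "F = (\<lambda>k x. ?m * (\<phi> x)\<^sup>2 - 2 * \<phi> x * a k + c k)"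
  have F_int: "integrable lborel (\<lambda>y. indicator (Q k) y * (\<phi> x - \<phi> y)\<^sup>2)"
    and F_eq: "F k x = (\<integral>y. indicator (Q k) y * (\<phi> x - \<phi> y)\<^sup>2 \<partial>lborel)" if "k \<in> I" for k x
  proof -
    have e: "(\<lambda>y. indicator (Q k) y * (\<phi> x - \<phi> y)\<^sup>2)
      = (\<lambda>y. (\<phi> x)\<^sup>2 * indicator (Q k) y - 2 * \<phi> x * (indicator (Q k) y * \<phi> y) + indicator (Q k) y * (\<phi> y)\<^sup>2)"
      by (auto simp: fun_eq_iff indicator_def power2_diff)
    show "integrable lborel (\<lambda>y. indicator (Q k) y * (\<phi> x - \<phi> y)\<^sup>2)"
      unfolding e using i1[OF that] i2[OF that] iQ[OF that] by simp
    have "(\<integral>y. indicator (Q k) y * (\<phi> x - \<phi> y)\<^sup>2 \<partial>lborel)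
        = (\<phi> x)\<^sup>2 * measure lborel (Q k) - 2 * \<phi> x * a k + c k"
      unfolding e a_def c_def using i1[OF that] i2[OF that] iQ[OF that] by simp
    then show "F k x = (\<integral>y. indicator (Q k) y * (\<phi> x - \<phi> y)\<^sup>2 \<partial>lborel)"
      by (simp add: F_def Qmeas[OF that] mult.commute)
  qed
  define f where "f = (\<lambda>x. \<Sum>k\<in>I. indicator (Q k) x * F k x)"
  have fe: "indicator (Q k) x * F k x = ?m * (indicator (Q k) x * (\<phi> x)\<^sup>2) - 2 * a k * (indicator (Q k) x * \<phi> x) + c k * indicator (Q k) x" for k x
    by (simp add: F_def algebra_simps)
  have if1: "integrable lborel (\<lambda>x. indicator (Q k) x * F k x)" if "k \<in> I" for k
    unfolding fe using i1[OF that] i2[OF that] iQ[OF that] by simp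
  have if2: "(\<integral>x. indicator (Q k) x * F k x \<partial>lborel) = 2 * ?m * c k - 2 * (a k)\<^sup>2" if "k \<in> I" for k
    unfolding fe using i1[OF that] i2[OF that] iQ[OF that]
    by (simp add: Qmeas[OF that] power2_eq_square a_def c_def)
  have f_int: "integrable lborel f" unfolding f_def by (intro Bochner_Integration.integrable_sum if1)
  have "(\<integral>x. f x \<partial>lborel) = (\<Sum>k\<in>I. 2 * ?m * c k - 2 * (a k)\<^sup>2)"
    unfolding f_def using if1 if2 by (simp add: Bochner_Integration.integral_sum)
  also have "\<dots> = 2 * ?m * (\<Sum>k\<in>I. c k) - 2 * (\<Sum>k\<in>I. (a k)\<^sup>2)"
    by (simp add: sum_subtractf sum_distrib_left)
  also have "(\<Sum>k\<in>I. c k) = (\<integral>x. (\<Sum>k\<in>I. indicator (Q k) x * (\<phi> x)\<^sup>2) \<partial>lborel)"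
    unfolding c_def using i2 by (simp add: Bochner_Integration.integral_sum)
  also have "(\<lambda>x. (\<Sum>k\<in>I. indicator (Q k) x * (\<phi> x)\<^sup>2)) = (\<lambda>x. (\<phi> x)\<^sup>2)"
  proof
    fix x
    show "(\<Sum>k\<in>I. indicator (Q k) x * (\<phi> x)\<^sup>2) = (\<phi> x)\<^sup>2"
    proof (cases "x \<in> \<Omega>")
      case True
      have "(\<Sum>k\<in>I. indicator (Q k) x * (\<phi> x)\<^sup>2) = (\<Sum>k\<in>I. if k = cell_index h x then (\<phi> x)\<^sup>2 else 0)"
        by (intro sum.cong) (auto simp: Q_def)
      also have "\<dots> = (\<phi> x)\<^sup>2" using finI True by (simp add: I_def)
      finally show ?thesis .
    next
      case False
      then show ?thesis using test_function_outside[OF \<phi>] by simp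
    qed
  qed
  finally have fval: "(\<integral>x. f x \<partial>lborel) = 2 * ?m * square_integral \<phi> - 2 * (\<Sum>k\<in>I. (a k)\<^sup>2)" .
  define B where "B = cbox (- (\<Sum>b\<in>Basis. h *\<^sub>R b)) (\<Sum>b\<in>Basis. h *\<^sub>R b :: 'a)"
  have [measurable]: "B \<in> sets borel" by (simp add: B_def)
  have Fnn: "F k x \<ge> 0" if "k \<in> I" for k x unfolding F_eq[OF that] by (rule integral_nonneg_AE) simp
  have f0: "f x \<ge> 0" for x unfolding f_def by (intro sum_nonneg) (simp add: Fnn)
  have point: "ennreal (f x) \<le> (\<integral>\<^sup>+z. indicator B z * ennreal ((\<phi> (x + z) - \<phi> x)\<^sup>2) \<partial>lborel)" for x
  proof (cases "cell_index h x \<in> I")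
    case False
    then have "f x = 0" unfolding f_def by (intro sum.neutral) (auto simp: Q_def indicator_def)
    then show ?thesis by simp
  next
    case True
    let ?k = "cell_index h x"
    have "f x = (\<Sum>k\<in>I. if k = ?k then F ?k x else 0)" unfolding f_def by (intro sum.cong) (auto simp: Q_def)
    also have "\<dots> = F ?k x" using finI True by simp
    finally have "ennreal (f x) = (\<integral>\<^sup>+y. ennreal (indicator (Q ?k) y * (\<phi> x - \<phi> y)\<^sup>2) \<partial>lborel)"
      unfolding F_eq[OF True] using F_int[OF True] by (subst nn_integral_eq_integral) auto
    also have "\<dots> = (\<integral>\<^sup>+z. ennreal (indicator (Q ?k) (x + z) * (\<phi> x - \<phi> (x + z))\<^sup>2) \<partial>lborel)"
      by (rule lborel_translate_nn_integral[symmetric]) (use Q[OF True] in measurable)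
    also have "\<dots> \<le> (\<integral>\<^sup>+z. indicator B z * ennreal ((\<phi> (x + z) - \<phi> x)\<^sup>2) \<partial>lborel)"
    proof (rule nn_integral_mono)
      fix z
      have "z \<in> B" if "x + z \<in> Q ?k"
      proof -
        have "\<bar>(x + z - x) \<bullet> b\<bar> \<le> h" if "b \<in> Basis" for b
          using cell_index_diff[OF h _ that, of "x + z" x] \<open>x + z \<in> Q ?k\<close> by (simp add: Q_def)
        then have "- h \<le> z \<bullet> b" "z \<bullet> b \<le> h" if "b \<in> Basis" for b using that by (force simp: abs_le_iff)+
        moreover have "(\<Sum>b\<in>Basis. h *\<^sub>R b :: 'a) \<bullet> b = h" if "b \<in> Basis" for b
          using that inner_sum_left_Basis[of b "\<lambda>_. h"] by simp
        ultimately show ?thesis by (auto simp: B_def mem_box inner_minus_left)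
      qed
      then show "ennreal (indicator (Q ?k) (x + z) * (\<phi> x - \<phi> (x + z))\<^sup>2) \<le> indicator B z * ennreal ((\<phi> (x + z) - \<phi> x)\<^sup>2)"
        by (auto simp: indicator_def power2_commute[of "\<phi> x"])
    qed
    finally show ?thesis .
  qed
  let ?G = "\<integral>x. (norm (grad \<phi> x))\<^sup>2 \<partial>lborel"
  have "ennreal (\<integral>x. f x \<partial>lborel) = (\<integral>\<^sup>+x. ennreal (f x) \<partial>lborel)"
    using f_int f0 by (simp add: nn_integral_eq_integral)
  also have "\<dots> \<le> (\<integral>\<^sup>+x. \<integral>\<^sup>+z. indicator B z * ennreal ((\<phi> (x + z) - \<phi> x)\<^sup>2) \<partial>lborel \<partial>lborel)"
    by (intro nn_integral_mono point)
  also have "\<dots> \<le> ennreal ((2 * h) ^ DIM('a) * ((DIM('a) * h)\<^sup>2 * ?G))"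
    unfolding B_def by (rule averaged_translation_estimate[OF \<phi> h])
  finally have "(\<integral>x. f x \<partial>lborel) \<le> (2 * h) ^ DIM('a) * ((DIM('a) * h)\<^sup>2 * ?G)"
    using h by (subst (asm) ennreal_le_iff) auto
  moreover have "0 \<le> (2 * h) ^ DIM('a) * ((DIM('a) * h)\<^sup>2 * ?G)" using h by simp
  ultimately have "2 * ?m * square_integral \<phi> \<le> 2 * (\<Sum>k\<in>I. (a k)\<^sup>2) + 2 * ((2 * h) ^ DIM('a) * ((DIM('a) * h)\<^sup>2 * ?G))"
    using fval by linarith
  then show ?thesis by (simp add: a_def)
qed

text \<open>
  On the subspace of finite codimension on which the mean values over the cells vanish, the square
  integral is at most \<open>\<epsilon>\<close> times the Dirichlet integral. The mesh is chosen such that the factor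
  $2^n n^2 h^2$ from the oscillation estimate becomes $\epsilon / 2^n$.
\<close>

lemma compactness_inequality:
  fixes \<Omega> :: "'a::euclidean_space set"
  assumes \<Omega>: "bounded \<Omega>" and \<epsilon>: "\<epsilon> > 0"
  shows "\<exists>(C :: 'a set set) c. finite C \<and> c > 0 \<and> (\<forall>Q\<in>C. Q \<in> sets borel \<and> emeasure lborel Q < \<infinity>) \<and>
    (\<forall>\<phi>. test_function \<Omega> \<phi> \<longrightarrow> square_integral \<phi> \<le> \<epsilon> * dirichlet_integral \<phi>
        + (\<Sum>Q\<in>C. c * (\<integral>x. indicator Q x * \<phi> x \<partial>lborel)\<^sup>2))"
proof -
  let ?n = "DIM('a)"
  define h where "h = sqrt \<epsilon> / (2 ^ ?n * ?n)"
  have n: "real ?n > 0" by simp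
  have h: "h > 0" using \<epsilon> by (simp add: h_def)
  define Q where "Q = (\<lambda>k. {x::'a. cell_index h x = k})"
  define I where "I = cell_index h ` \<Omega>"
  have finI: "finite I" unfolding I_def by (rule finite_cells[OF \<Omega>])
  have inj: "inj_on Q I" by (rule inj_onI) (auto simp: I_def Q_def)
  have QB: "Q k \<in> sets borel" "emeasure lborel (Q k) < \<infinity>" if "k \<in> I" for k
  proof -
    have "b \<notin> Basis \<Longrightarrow> k b = 0" for b using that by (auto simp: I_def cell_index_def)
    then show "Q k \<in> sets borel" "emeasure lborel (Q k) < \<infinity>"
      unfolding Q_def using cell_measure[OF h, of k] by auto
  qed
  have "square_integral \<phi> \<le> \<epsilon> * dirichlet_integral \<phi>
        + (\<Sum>k\<in>I. (1 / h ^ ?n) * (\<integral>x. indicator (Q k) x * \<phi> x \<partial>lborel)\<^sup>2)" if "test_function \<Omega> \<phi>" for \<phi>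
  proof -
    let ?G = "\<integral>x. (norm (grad \<phi> x))\<^sup>2 \<partial>lborel"
    have "h ^ ?n * square_integral \<phi> \<le> (\<Sum>k\<in>I. (\<integral>x. indicator (Q k) x * \<phi> x \<partial>lborel)\<^sup>2)
       + (2 * h) ^ ?n * ((?n * h)\<^sup>2 * ?G)"
      unfolding Q_def I_def by (rule cell_oscillation_estimate[OF that h \<Omega>])
    then have "(1 / h ^ ?n) * (h ^ ?n * square_integral \<phi>) \<le> (1 / h ^ ?n) * ((\<Sum>k\<in>I. (\<integral>x. indicator (Q k) x * \<phi> x \<partial>lborel)\<^sup>2)
       + (2 * h) ^ ?n * ((?n * h)\<^sup>2 * ?G))"
      using h by (intro mult_left_mono) auto
    also have "\<dots> = (\<Sum>k\<in>I. (1 / h ^ ?n) * (\<integral>x. indicator (Q k) x * \<phi> x \<partial>lborel)\<^sup>2) + (2 ^ ?n * (?n * h)\<^sup>2) * ?G"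
      using h by (simp add: sum_distrib_left distrib_left power_mult_distrib)
    also have "(2 ^ ?n * (?n * h)\<^sup>2) * ?G \<le> \<epsilon> * ?G"
    proof (rule mult_right_mono)
      have "2 ^ ?n * (?n * h)\<^sup>2 = \<epsilon> / 2 ^ ?n"
        using \<epsilon> n by (simp add: h_def power_mult_distrib power_divide power2_eq_square)
      also have "\<dots> \<le> \<epsilon>" using \<epsilon> by (simp add: field_simps)
      finally show "2 ^ ?n * (?n * h)\<^sup>2 \<le> \<epsilon>" .
    qed simp
    finally show ?thesis using h by simp
  qed
  then have "\<forall>\<phi>. test_function \<Omega> \<phi> \<longrightarrow> square_integral \<phi> \<le> \<epsilon> * dirichlet_integral \<phi>
        + (\<Sum>Q\<in>Q ` I. (1 / h ^ ?n) * (\<integral>x. indicator Q x * \<phi> x \<partial>lborel)\<^sup>2)"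
    by (simp add: sum.reindex[OF inj])
  moreover have "1 / h ^ ?n > 0" using h by simp
  ultimately show ?thesis using finI QB by (intro exI[of _ "Q ` I"] exI[of _ "1 / h ^ ?n"]) auto
qed

section \<open>Cylinders and graphs\<close>

lemma coords_shift:
  assumes "norm (direction Z) = 1"
  shows "last_coord Z (x + s *\<^sub>R direction Z) = last_coord Z x + s"
    and "first_coords Z (x + s *\<^sub>R direction Z) = first_coords Z x"
proof -
  have d: "direction Z \<bullet> direction Z = 1" using assms by (simp add: norm_eq_1)
  show l: "last_coord Z (x + s *\<^sub>R direction Z) = last_coord Z x + s"
    by (simp add: last_coord_def inner_diff_left inner_add_left d)
  show "first_coords Z (x + s *\<^sub>R direction Z) = first_coords Z x"
    unfolding first_coords_def l by (simp add: algebra_simps)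
qed

lemma first_coords_orthogonal:
  assumes "norm (direction Z) = 1"
  shows "first_coords Z x \<bullet> direction Z = 0"
proof -
  have d: "direction Z \<bullet> direction Z = 1" using assms by (simp add: norm_eq_1)
  show ?thesis by (simp add: first_coords_def last_coord_def inner_diff_left d)
qed

lemma last_coord_Lipschitz:
  assumes "norm (direction Z) = 1"
  shows "\<bar>last_coord Z x - last_coord Z y\<bar> \<le> norm (x - y)"
proof -
  have "last_coord Z x - last_coord Z y = (x - y) \<bullet> direction Z"
    by (simp add: last_coord_def inner_diff_left)
  then show ?thesis using Cauchy_Schwarz_ineq2[of "x - y" "direction Z"] assms by simp
qed

lemma first_coords_Lipschitz:
  assumes "norm (direction Z) = 1"
  shows "norm (first_coords Z x - first_coords Z y) \<le> norm (x - y)"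
proof -
  define w where "w = x - y"
  define a where "a = w \<bullet> direction Z"
  have d: "direction Z \<bullet> direction Z = 1" using assms by (simp add: norm_eq_1)
  have e: "first_coords Z x - first_coords Z y = w - a *\<^sub>R direction Z"
    by (simp add: first_coords_def last_coord_def w_def a_def inner_diff_left algebra_simps)
  have "(w - a *\<^sub>R direction Z) \<bullet> (w - a *\<^sub>R direction Z) = w \<bullet> w - a * a"
    using d by (simp add: inner_diff_left inner_diff_right inner_commute[of "direction Z" w] flip: a_def)
  then have "(norm (w - a *\<^sub>R direction Z))\<^sup>2 \<le> (norm w)\<^sup>2" by (simp add: power2_norm_eq_inner)
  then show ?thesis unfolding e using power2_le_imp_le by (metis norm_ge_zero w_def)
qed

lemma point_with_coords:
  assumes "norm (direction Z) = 1" "y \<bullet> direction Z = 0"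
  shows "last_coord Z (center Z + y + s *\<^sub>R direction Z) = s"
    and "first_coords Z (center Z + y + s *\<^sub>R direction Z) = y"
proof -
  have d: "direction Z \<bullet> direction Z = 1" using assms by (simp add: norm_eq_1)
  show l: "last_coord Z (center Z + y + s *\<^sub>R direction Z) = s"
    using assms by (simp add: last_coord_def inner_add_left d)
  show "first_coords Z (center Z + y + s *\<^sub>R direction Z) = y"
    unfolding first_coords_def l by (simp add: algebra_simps)
qed

lemma continuous_coords:
  "continuous_on S (last_coord Z)" "continuous_on S (first_coords Z)"
  unfolding last_coord_def[abs_def] first_coords_def[abs_def] by (intro continuous_intros)+

lemma cylinder_set_iff:
  assumes "norm (direction Z) = 1"
  shows "x \<in> cylinder_set Z \<longleftrightarrow> norm (first_coords Z x) < radius Z \<and> \<bar>last_coord Z x\<bar> < half_height Z"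
  using first_coords_orthogonal[OF assms] by (simp add: cylinder_set_def base_ball_def)

lemma open_cylinder_set:
  assumes "norm (direction Z) = 1"
  shows "open (cylinder_set Z)"
proof -
  have "cylinder_set Z = {x. norm (first_coords Z x) < radius Z} \<inter> {x. \<bar>last_coord Z x\<bar> < half_height Z}"
    using cylinder_set_iff[OF assms] by auto
  moreover have "open {x. norm (first_coords Z x) < radius Z}" "open {x. \<bar>last_coord Z x\<bar> < half_height Z}"
    by (intro open_Collect_less continuous_intros continuous_coords)+
  ultimately show ?thesis by auto
qed

lemma graph_domain_iff:
  assumes "graph_in_cylinder M Z h \<Omega>" "x \<in> cylinder_set Z"
  shows "x \<in> \<Omega> \<longleftrightarrow> h (first_coords Z x) < last_coord Z x"
  using assms unfolding graph_in_cylinder_def by blast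

lemma graph_domain_upward:
  assumes "graph_in_cylinder M Z h \<Omega>" "norm (direction Z) = 1" "s \<ge> 0"
    and "x \<in> cylinder_set Z" "x - s *\<^sub>R direction Z \<in> cylinder_set Z" "x - s *\<^sub>R direction Z \<in> \<Omega>"
  shows "x \<in> \<Omega>"
  using assms coords_shift[OF assms(2), of x "-s"]
  by (simp add: graph_domain_iff[OF assms(1)])

text \<open>
  The part of the cylinder strictly below the graph is open and disjoint from the domain.
\<close>

lemma frontier_on_graph:
  assumes g: "graph_in_cylinder M Z h \<Omega>" and Z: "norm (direction Z) = 1" and \<Omega>: "open \<Omega>"
    and x: "x \<in> frontier \<Omega>" "x \<in> cylinder_set Z"
  shows "last_coord Z x = h (first_coords Z x)"
proof (rule ccontr)
  assume ne: "last_coord Z x \<noteq> h (first_coords Z x)"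
  have "x \<notin> \<Omega>" using x \<Omega> by (simp add: frontier_def interior_open)
  then have lt: "last_coord Z x < h (first_coords Z x)" using ne graph_domain_iff[OF g x(2)] by simp
  have ch: "continuous_on (base_ball Z) h" using g by (auto simp: graph_in_cylinder_def intro: lipschitz_on_continuous_on)
  have "continuous_on (cylinder_set Z) (\<lambda>x. h (first_coords Z x) - last_coord Z x)"
    by (intro continuous_intros continuous_coords continuous_on_compose2[OF ch]) (auto simp: cylinder_set_def)
  then have "open (cylinder_set Z \<inter> (\<lambda>x. h (first_coords Z x) - last_coord Z x) -` {0<..})"
    using open_cylinder_set[OF Z] by (intro continuous_open_preimage) auto
  moreover have "x \<in> cylinder_set Z \<inter> (\<lambda>x. h (first_coords Z x) - last_coord Z x) -` {0<..}"
    using lt x by simp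
  moreover have "(cylinder_set Z \<inter> (\<lambda>x. h (first_coords Z x) - last_coord Z x) -` {0<..}) \<inter> \<Omega> = {}"
    using graph_domain_iff[OF g] by auto
  ultimately have "x \<notin> closure \<Omega>" by (meson disjoint_iff open_Int_closure_eq_empty IntI)
  then show False using x by (simp add: frontier_def)
qed

text \<open>
  Points just above the graph, reached along the axis, belong to the domain.
\<close>

lemma graph_on_frontier:
  assumes g: "graph_in_cylinder M Z h \<Omega>" and Z: "norm (direction Z) = 1" and \<Omega>: "open \<Omega>"
    and x: "x \<in> cylinder_set Z" "last_coord Z x = h (first_coords Z x)"
  shows "x \<in> frontier \<Omega>"
proof -
  have "x \<notin> \<Omega>" using graph_domain_iff[OF g x(1)] x(2) by simp
  moreover have "x \<in> closure \<Omega>"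
    unfolding closure_approachable
  proof (intro allI impI)
    fix e :: real assume e: "e > 0"
    obtain r where r: "r > 0" "ball x r \<subseteq> cylinder_set Z"
      using open_cylinder_set[OF Z] x(1) open_contains_ball by blast
    define s where "s = min e r / 2"
    have s: "0 < s" "s < e" "s < r" using e r by (auto simp: s_def)
    let ?y = "x + s *\<^sub>R direction Z"
    have d: "dist ?y x = s" using Z s by (simp add: dist_norm)
    then have "?y \<in> cylinder_set Z" using r s by (auto simp: dist_commute subset_iff)
    then have "?y \<in> \<Omega>" using s x(2) by (simp add: graph_domain_iff[OF g] coords_shift[OF Z])
    then show "\<exists>y\<in>\<Omega>. dist y x < e" using d s(2) by (intro bexI[of _ ?y]) simp_all
  qed
  ultimately show ?thesis using \<Omega> by (simp add: frontier_def interior_open)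
qed

section \<open>Hausdorff distance and distance of the graphs\<close>

lemma hausdorff_dist_infdist:
  fixes A B :: "'a::metric_space set"
  assumes "bounded A" "bounded B" "A \<noteq> {}" "B \<noteq> {}"
  shows "x \<in> A \<Longrightarrow> infdist x B \<le> hausdorff_dist A B" "y \<in> B \<Longrightarrow> infdist y A \<le> hausdorff_dist A B"
proof -
  have bdd: "bdd_above ((\<lambda>x. infdist x S) ` T)" if T: "bounded T" and S: "S \<noteq> {}" for S T :: "'a set"
  proof -
    obtain a where a: "a \<in> S" using S by blast
    obtain e where e: "\<And>x. x \<in> T \<Longrightarrow> dist a x \<le> e" using T bounded_any_center[of T a] by blast
    have "infdist x S \<le> e" if "x \<in> T" for x using infdist_le[OF a, of x] e[OF that] by (simp add: dist_commute)
    then show ?thesis by (intro bdd_aboveI2)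
  qed
  show "infdist x B \<le> hausdorff_dist A B" if "x \<in> A"
    unfolding hausdorff_dist_def using cSUP_upper[OF that bdd[OF assms(1,4)]] by simp
  show "infdist y A \<le> hausdorff_dist A B" if "y \<in> B"
    unfolding hausdorff_dist_def using cSUP_upper[OF that bdd[OF assms(2,3)]] by simp
qed

lemma infdist_less_obtain:
  assumes "A \<noteq> {}" "infdist x A < e"
  obtains y where "y \<in> A" "dist x y < e"
proof -
  have "(INF a\<in>A. dist x a) < e" using assms by (simp add: infdist_notempty)
  then show ?thesis using that assms(1) by (subst (asm) cINF_less_iff) (auto intro: bdd_belowI2[where m=0])
qed

text \<open>
  If \<open>h'\<close> were much larger than \<open>h\<close>, then the ball of radius \<open>e > d\<close> around the point at height \<open>e\<close>
  above the graph of \<open>h\<close> would lie below the graph of \<open>h'\<close>, hence outside \<open>\<Omega>'\<close>, although its centre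
  is in \<open>\<Omega>\<close>. For the ball to fit into the cylinder, the base point is first moved towards the axis by
  at most \<open>2 * e\<close>; this costs \<open>4 * M * e\<close>, and the slope over the ball costs \<open>M * e\<close>. Finally \<open>e\<close>
  tends to \<open>d\<close>.
\<close>

lemma graphs_close:
  assumes g: "graph_in_cylinder M Z h \<Omega>" and g': "graph_in_cylinder M Z h' \<Omega>'"
    and Z: "valid_cylinder Z" and M: "M \<ge> 0" and ne: "\<Omega>' \<noteq> {}"
    and near: "\<And>x. x \<in> \<Omega> \<Longrightarrow> infdist x \<Omega>' \<le> d" and d: "0 \<le> d" "2 * d < radius Z"
    and y: "y \<in> base_ball Z"
  shows "h' y \<le> h y + (2 + 5 * M) * d"
proof -
  have Zd: "norm (direction Z) = 1" and r: "radius Z > 0" using Z by (auto simp: valid_cylinder_def)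
  have strict: "h' y \<le> h y + (2 + 5 * M) * e" if e: "d < e" "2 * e < radius Z" for e
  proof -
    have e0: "e > 0" using e d by simp
    define q where "q = (1 - 2 * e / radius Z) *\<^sub>R y"
    have q01: "0 \<le> 1 - 2 * e / radius Z" using e r by (simp add: field_simps)
    have ny: "norm y < radius Z" "y \<bullet> direction Z = 0" using y by (auto simp: base_ball_def)
    have nq: "norm q \<le> radius Z - 2 * e"
    proof -
      have "norm q = (1 - 2 * e / radius Z) * norm y" using q01 by (simp add: q_def)
      also have "\<dots> \<le> (1 - 2 * e / radius Z) * radius Z" using q01 ny by (intro mult_left_mono) auto
      also have "\<dots> = radius Z - 2 * e" using r by (simp add: field_simps)
      finally show ?thesis .
    qed
    have qy: "norm (q - y) \<le> 2 * e"
    proof -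
      have "q - y = - (2 * e / radius Z) *\<^sub>R y" by (simp add: q_def algebra_simps)
      then have "norm (q - y) = 2 * e * (norm y / radius Z)" using e0 r by simp
      also have "\<dots> \<le> 2 * e * 1" using e0 ny r by (intro mult_left_mono) (auto simp: field_simps)
      finally show ?thesis by simp
    qed
    have qo: "q \<bullet> direction Z = 0" using ny by (simp add: q_def)
    have qB: "q \<in> base_ball Z" using nq e0 qo by (simp add: base_ball_def)
    have Lip: "\<bar>f a - f b\<bar> \<le> M * norm (a - b)" if "graph_in_cylinder M Z f W" "a \<in> base_ball Z" "b \<in> base_ball Z" for f a b W
      using that lipschitz_onD[of M "base_ball Z" f a b] by (auto simp: graph_in_cylinder_def dist_norm)
    have hq: "h q \<le> h y + 2 * M * e" "h' y \<le> h' q + 2 * M * e"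
      using Lip[OF g qB y] Lip[OF g' qB y] mult_left_mono[OF qy M] by (auto simp: abs_le_iff)
    have "h' q < h q + (2 + M) * e"
    proof (rule ccontr)
      assume "\<not> h' q < h q + (2 + M) * e"
      then have big: "h q + 2 * e + M * e \<le> h' q" by (simp add: algebra_simps)
      define x where "x = center Z + q + (h q + e) *\<^sub>R direction Z"
      have cx: "last_coord Z x = h q + e" "first_coords Z x = q"
        unfolding x_def using point_with_coords[OF Zd qo] by auto
      have hb: "\<bar>h q\<bar> < half_height Z" "\<bar>h' q\<bar> < half_height Z" using g g' qB by (auto simp: graph_in_cylinder_def)
      have Me: "0 \<le> M * e" using M e0 by simp
      have notin: "z \<notin> \<Omega>'" if z: "dist x z < e" for z
      proof -
        have l: "\<bar>last_coord Z z - (h q + e)\<bar> < e" and f: "norm (first_coords Z z - q) < e"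
          using last_coord_Lipschitz[OF Zd, of z x] first_coords_Lipschitz[OF Zd, of z x] z cx
          by (auto simp: dist_norm norm_minus_commute)
        have "norm (first_coords Z z) < radius Z"
          using f nq norm_triangle_ineq[of q "first_coords Z z - q"] e0 by simp
        moreover have "\<bar>last_coord Z z\<bar> < half_height Z" using l hb big Me by (simp add: abs_less_iff)
        ultimately have zc: "z \<in> cylinder_set Z" by (simp add: cylinder_set_iff[OF Zd])
        then have "first_coords Z z \<in> base_ball Z" by (simp add: cylinder_set_def)
        then have "\<bar>h' (first_coords Z z) - h' q\<bar> \<le> M * norm (first_coords Z z - q)" by (rule Lip[OF g' _ qB])
        also have "\<dots> \<le> M * e" using f M by (intro mult_left_mono) auto
        finally have "last_coord Z z < h' (first_coords Z z)" using l big by (simp add: abs_le_iff abs_less_iff)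
        then show ?thesis using graph_domain_iff[OF g' zc] by simp
      qed
      have "x \<in> cylinder_set Z" using nq e0 hb big Me cx by (simp add: cylinder_set_iff[OF Zd] abs_less_iff)
      then have "x \<in> \<Omega>" using e0 cx by (simp add: graph_domain_iff[OF g])
      then have "infdist x \<Omega>' < e" using near e by fastforce
      then obtain z where "z \<in> \<Omega>'" "dist x z < e" using infdist_less_obtain[OF ne] by blast
      then show False using notin by blast
    qed
    then show ?thesis using hq by (simp add: algebra_simps)
  qed
  show ?thesis
  proof (rule field_le_epsilon)
    fix \<eta> :: real assume \<eta>: "\<eta> > 0"
    define a where "a = min (\<eta> / (2 + 5 * M)) ((radius Z - 2 * d) / 4)"
    have a: "a > 0" "2 * (d + a) < radius Z" using \<eta> M d by (auto simp: a_def min_def field_simps)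
    have "(2 + 5 * M) * a \<le> (2 + 5 * M) * (\<eta> / (2 + 5 * M))" using M by (intro mult_left_mono) (auto simp: a_def)
    also have "\<dots> = \<eta>" using M by simp
    finally have "(2 + 5 * M) * a \<le> \<eta>" .
    then show "h' y \<le> h y + (2 + 5 * M) * d + \<eta>" using strict[of "d + a"] a by (simp add: algebra_simps)
  qed
qed

section \<open>A vector field transversal to the boundary\<close>

lemma test_function_bump:
  assumes "r > 0"
  shows "test_function UNIV (bump p r)"
proof (rule test_function_restrict_support)
  have "{x. bump p r x \<noteq> 0} \<subseteq> cball p r"
  proof
    fix x assume "x \<in> {x. bump p r x \<noteq> 0}"
    then have "0 < bump p r x" using bump_nonneg[of p r x] by simp
    then show "x \<in> cball p r" using assms by (simp add: bump_pos_iff dist_norm norm_minus_commute)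
  qed
  then show "closure {x. bump p r x \<noteq> 0} \<subseteq> cball p r" by (simp add: closure_minimal)
qed (auto simp: Ck_bump)

lemma bump_lower_bound:
  assumes "r > 0" "norm (x - p) \<le> 3/2 * r"
  shows "flat_exp 0 (7/4 * r\<^sup>2) \<le> bump p (2 * r) x"
proof -
  have "(norm (x - p))\<^sup>2 \<le> (3/2 * r)\<^sup>2" using assms by (intro power_mono) auto
  then have le: "7/4 * r\<^sup>2 \<le> (2 * r)\<^sup>2 - (norm (x - p))\<^sup>2" by (simp add: power_mult_distrib power_divide)
  have pos: "7/4 * r\<^sup>2 > 0" using assms by simp
  define a where "a = 7/4 * r\<^sup>2"
  define b where "b = (2 * r)\<^sup>2 - (norm (x - p))\<^sup>2"
  have ab: "0 < a" "a \<le> b" using pos le by (auto simp: a_def b_def)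
  then have "1 / b \<le> 1 / a" by (intro divide_left_mono) auto
  then have "flat_exp 0 a \<le> flat_exp 0 b" using ab by (simp add: flat_exp_def)
  then show ?thesis by (simp add: a_def b_def bump_def)
qed

text \<open>
  The displacements are undone one at a time. Undoing one of them means climbing along the axis of a
  cylinder that contains both end points, which does not leave the domain. The budget \<open>r\<close> keeps all
  intermediate points in the region in which the cylinders are known to be present.
\<close>

lemma backward_along_field:
  fixes Z :: "nat \<Rightarrow> 'a::euclidean_space cylinder" and \<kappa> :: "'a \<Rightarrow> nat"
    and c :: "'a \<Rightarrow> real" and t r :: real
  assumes g: "\<And>p. p \<in> P \<Longrightarrow> \<exists>M h. graph_in_cylinder M (Z (\<kappa> p)) h \<Omega>"
    and Z: "\<And>p. p \<in> P \<Longrightarrow> norm (direction (Z (\<kappa> p))) = 1"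
    and c: "\<And>p. p \<in> P \<Longrightarrow> 0 \<le> c p" "\<And>p. p \<in> P \<Longrightarrow> c p \<le> t"
    and inside: "\<And>p z. p \<in> P \<Longrightarrow> c p > 0 \<Longrightarrow> norm (z - x) \<le> r \<Longrightarrow> z \<in> cylinder_set (Z (\<kappa> p))"
    and P: "finite P"
  shows "norm (y - x) + card P * t \<le> r \<Longrightarrow> y - (\<Sum>p\<in>P. c p *\<^sub>R direction (Z (\<kappa> p))) \<in> \<Omega> \<Longrightarrow> y \<in> \<Omega>"
  using P g Z c inside
proof (induction P arbitrary: y rule: finite_induct)
  case empty
  then show ?case by simp
next
  case (insert p P)
  let ?d = "direction (Z (\<kappa> p))"
  define y' where "y' = y - c p *\<^sub>R ?d"
  have cp: "0 \<le> c p" "c p \<le> t" "norm ?d = 1" using insert.prems by auto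
  have t0: "t \<ge> 0" using cp by simp
  have n: "norm (y' - y) \<le> t" using cp by (simp add: y'_def)
  have "norm (y' - x) \<le> norm (y' - y) + norm (y - x)" using norm_triangle_ineq[of "y' - y" "y - x"] by simp
  then have n2: "norm (y' - x) + card P * t \<le> r" using n insert.prems(1) insert.hyps by (simp add: algebra_simps)
  have "y' \<in> \<Omega>"
  proof (rule insert.IH[OF n2])
    show "y' - (\<Sum>p\<in>P. c p *\<^sub>R direction (Z (\<kappa> p))) \<in> \<Omega>"
      using insert.prems(2) insert.hyps by (simp add: y'_def diff_diff_eq)
  qed (use insert.prems in auto)
  show ?case
  proof (cases "c p = 0")
    case True then show ?thesis using \<open>y' \<in> \<Omega>\<close> by (simp add: y'_def)
  next
    case False
    then have "c p > 0" using cp by simp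
    have "0 \<le> card P * t" using t0 by simp
    moreover have "norm (y - x) + (t + card P * t) \<le> r" using insert.prems(1) insert.hyps by (simp add: algebra_simps)
    ultimately have "norm (y - x) \<le> r" "norm (y' - x) \<le> r" using n2 t0 by linarith+
    then have "y \<in> cylinder_set (Z (\<kappa> p))" "y' \<in> cylinder_set (Z (\<kappa> p))"
      using insert.prems(7)[of p] \<open>c p > 0\<close> by auto
    moreover obtain M h where "graph_in_cylinder M (Z (\<kappa> p)) h \<Omega>" using insert.prems(3)[of p] by auto
    ultimately show ?thesis using graph_domain_upward[of M "Z (\<kappa> p)" h \<Omega> "c p" y] cp \<open>y' \<in> \<Omega>\<close>
      by (simp add: y'_def)
  qed
qed

lemma connected_ball_subset:
  fixes \<Omega> :: "'a::euclidean_space set"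
  assumes "ball x r \<inter> frontier \<Omega> = {}" "y \<in> \<Omega>" "dist x y < r"
  shows "x \<in> \<Omega>"
proof (rule ccontr)
  assume "x \<notin> \<Omega>"
  have "connected (ball x r)" by simp
  moreover have "x \<in> ball x r" using assms(3) zero_le_dist[of x y] by (simp del: zero_le_dist)
  then have "ball x r - \<Omega> \<noteq> {}" using \<open>x \<notin> \<Omega>\<close> by blast
  moreover have "ball x r \<inter> \<Omega> \<noteq> {}" using assms by auto
  ultimately show False using connected_Int_frontier[of "ball x r" \<Omega>] assms(1) by blast
qed

text \<open>
  The field is minus the sum of the axes, cut off by bumps around finitely many frontier points of
  \<open>\<Omega>\<^sub>1\<close>; near the frontier at least one of the coefficients is \<open>\<ge> c\<close>. Suppose that the displaced point
  lies in one of the domains. Undoing the displacements shows that \<open>x\<close> lies in this domain as well.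
  
  If \<open>x\<close> is near the frontier of \<open>\<Omega>\<^sub>1\<close>, then a displacement with coefficient \<open>\<ge> c\<close> can be undone last;
  so \<open>x\<close> lies more than \<open>c * t\<close> above a graph. As \<open>t\<close> is chosen such that \<open>c * t\<close> is the bound for the
  distance of the two graphs, \<open>x\<close> lies above the other graph too.
  
  If \<open>x\<close> is far from the frontier of \<open>\<Omega>\<^sub>1\<close>, it is also far from that of \<open>\<Omega>\<^sub>2\<close>, because frontier points
  of \<open>\<Omega>\<^sub>2\<close> are close to points on the graphs of \<open>\<Omega>\<^sub>1\<close>. A ball around \<open>x\<close> is then inside or outside of
  each domain, and the Hausdorff distance excludes that it is inside exactly one of them.
\<close>

theorem transversal_field:
  fixes Z :: "nat \<Rightarrow> 'a::euclidean_space cylinder" and \<Omega>\<^sub>1 :: "'a set"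
  assumes M: "M > 0" and Z: "\<forall>k\<in>{1..N}. valid_cylinder (Z k)"
    and \<Omega>1: "lipschitz_domain_with M N Z h\<^sub>1 \<Omega>\<^sub>1"
  shows "\<exists>(P::'a set) \<beta> e C d\<^sub>0. finite P \<and> (\<forall>p\<in>P. test_function UNIV (\<beta> p) \<and> norm (e p :: 'a) = 1) \<and>
     C \<ge> 0 \<and> d\<^sub>0 > 0 \<and>
     (\<forall>\<Omega>\<^sub>2\<in>lipschitz_class M N Z. \<forall>x. hausdorff_dist \<Omega>\<^sub>1 \<Omega>\<^sub>2 < d\<^sub>0 \<longrightarrow>
        (x + (C * hausdorff_dist \<Omega>\<^sub>1 \<Omega>\<^sub>2) *\<^sub>R (\<Sum>p\<in>P. \<beta> p x *\<^sub>R e p) \<in> \<Omega>\<^sub>1 \<longrightarrow> x \<in> \<Omega>\<^sub>2) \<and>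
        (x + (C * hausdorff_dist \<Omega>\<^sub>1 \<Omega>\<^sub>2) *\<^sub>R (\<Sum>p\<in>P. \<beta> p x *\<^sub>R e p) \<in> \<Omega>\<^sub>2 \<longrightarrow> x \<in> \<Omega>\<^sub>1))"
proof -
  have o1: "open \<Omega>\<^sub>1" "bounded \<Omega>\<^sub>1" "\<Omega>\<^sub>1 \<noteq> {}" and cov1: "frontier \<Omega>\<^sub>1 \<subseteq> (\<Union>k\<in>{1..N}. cylinder_set (Z k))"
    and g1: "\<And>k. k \<in> {1..N} \<Longrightarrow> graph_in_cylinder M (Z k) (h\<^sub>1 k) \<Omega>\<^sub>1"
    using \<Omega>1 by (auto simp: lipschitz_domain_with_def bounded_domain_def)
  have dir: "norm (direction (Z k)) = 1" and rad: "radius (Z k) > 0" if "k \<in> {1..N}" for k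
    using Z that by (auto simp: valid_cylinder_def)
  have comp: "compact (frontier \<Omega>\<^sub>1)" using o1 by (simp add: compact_frontier_bounded)
  have "\<exists>k r. k \<in> {1..N} \<and> r > 0 \<and> ball p (3 * r) \<subseteq> cylinder_set (Z k)" if "p \<in> frontier \<Omega>\<^sub>1" for p
  proof -
    obtain k where k: "k \<in> {1..N}" "p \<in> cylinder_set (Z k)" using cov1 \<open>p \<in> frontier \<Omega>\<^sub>1\<close> by blast
    obtain s where s: "s > 0" "ball p s \<subseteq> cylinder_set (Z k)"
      using open_cylinder_set[OF dir[OF k(1)]] k(2) open_contains_ball by blast
    then show ?thesis using k by (intro exI[of _ k] exI[of _ "s / 3"]) auto
  qed
  then obtain \<kappa> r where \<kappa>: "\<And>p. p \<in> frontier \<Omega>\<^sub>1 \<Longrightarrow> \<kappa> p \<in> {1..N}"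
    and r: "\<And>p. p \<in> frontier \<Omega>\<^sub>1 \<Longrightarrow> r p > 0"
    and rc: "\<And>p. p \<in> frontier \<Omega>\<^sub>1 \<Longrightarrow> ball p (3 * r p) \<subseteq> cylinder_set (Z (\<kappa> p))"
    by metis
  have "frontier \<Omega>\<^sub>1 \<subseteq> (\<Union>p\<in>frontier \<Omega>\<^sub>1. ball p (r p))" using r by auto
  then obtain P where P: "P \<subseteq> frontier \<Omega>\<^sub>1" "finite P" "frontier \<Omega>\<^sub>1 \<subseteq> (\<Union>p\<in>P. ball p (r p))"
    using compactE_image[OF comp, of "frontier \<Omega>\<^sub>1" "\<lambda>p. ball p (r p)"] by (metis open_ball)
  define \<beta> where "\<beta> = (\<lambda>p. bump p (2 * r p))"
  define e where "e = (\<lambda>p. - direction (Z (\<kappa> p)))"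
  \<comment> \<open>Within \<open>r0\<close> of a point of the support of a bump the corresponding cylinder is present, and within
    \<open>\<rho>\<close> of the frontier some bump is at least \<open>c\<close>. The bound \<open>C1 * d\<close> for the distance of the graphs
    requires \<open>d < R / 2\<close>.\<close>
  define r0 where "r0 = Min (insert 1 (r ` P))"
  have r0: "r0 > 0" "\<And>p. p \<in> P \<Longrightarrow> r0 \<le> r p" using P r by (auto simp: r0_def)
  define c where "c = Min (insert 1 ((\<lambda>p. flat_exp 0 (7/4 * (r p)\<^sup>2)) ` P))"
  have c: "c > 0" "\<And>p. p \<in> P \<Longrightarrow> c \<le> flat_exp 0 (7/4 * (r p)\<^sup>2)"
  proof -
    have "flat_exp 0 (7/4 * (r p)\<^sup>2) > 0" if "p \<in> P" for p
    proof -
      have "r p > 0" using r P(1) that by blast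
      then show ?thesis by (simp add: flat_exp_def)
    qed
    then show "c > 0" using P(2) by (auto simp: c_def)
    show "c \<le> flat_exp 0 (7/4 * (r p)\<^sup>2)" if "p \<in> P" for p
      unfolding c_def using P(2) that by (intro Min_le) auto
  qed
  define R where "R = Min (insert 1 (radius ` (Z ` {1..N})))"
  have R: "R > 0" "\<And>k. k \<in> {1..N} \<Longrightarrow> R \<le> radius (Z k)"
  proof -
    show "R > 0" using rad by (auto simp: R_def)
    show "R \<le> radius (Z k)" if "k \<in> {1..N}" for k
      unfolding R_def using that by (intro Min_le) auto
  qed
  define \<rho> where "\<rho> = r0 / 2"
  define C1 where "C1 = 2 + 5 * M"
  define C where "C = C1 / c"
  define d0 where "d0 = Min {R / 2, \<rho> / (1 + C1), r0 / (C * (1 + card P))}"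
  have C1: "C1 > 0" using M by (simp add: C1_def)
  have C: "C > 0" using C1 c by (simp add: C_def)
  have \<rho>: "\<rho> > 0" using r0 by (simp add: \<rho>_def)
  have d0: "d0 > 0" using R \<rho> C1 C r0 by (auto simp: d0_def)
  have near: "\<exists>p\<in>P. c \<le> \<beta> p x" if "q \<in> frontier \<Omega>\<^sub>1" "norm (x - q) \<le> \<rho>" for x q
  proof -
    have "q \<in> (\<Union>p\<in>P. ball p (r p))" using P(3) that(1) by blast
    then obtain p where p: "p \<in> P" "norm (q - p) < r p" by (auto simp: dist_norm norm_minus_commute)
    have "norm (x - p) \<le> norm (x - q) + norm (q - p)" using norm_triangle_ineq[of "x - q" "q - p"] by simp
    also have "\<dots> \<le> 3/2 * r p" using p that(2) r0(2)[OF p(1)] by (simp add: \<rho>_def)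
    finally have "c \<le> \<beta> p x" unfolding \<beta>_def
      using bump_lower_bound[of "r p" x p] r p(1) P(1) c(2)[OF p(1)] by fastforce
    then show ?thesis using p by blast
  qed
  have main: "(x + (C * d) *\<^sub>R (\<Sum>p\<in>P. \<beta> p x *\<^sub>R e p) \<in> \<Omega>\<^sub>1 \<longrightarrow> x \<in> \<Omega>\<^sub>2) \<and>
        (x + (C * d) *\<^sub>R (\<Sum>p\<in>P. \<beta> p x *\<^sub>R e p) \<in> \<Omega>\<^sub>2 \<longrightarrow> x \<in> \<Omega>\<^sub>1)"
    if \<Omega>2: "\<Omega>\<^sub>2 \<in> lipschitz_class M N Z" and dd: "d = hausdorff_dist \<Omega>\<^sub>1 \<Omega>\<^sub>2" "d < d0" for \<Omega>\<^sub>2 x d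
  proof -
    obtain h\<^sub>2 where "lipschitz_domain_with M N Z h\<^sub>2 \<Omega>\<^sub>2" using \<Omega>2 by (auto simp: lipschitz_class_def)
    then have o2: "open \<Omega>\<^sub>2" "bounded \<Omega>\<^sub>2" "\<Omega>\<^sub>2 \<noteq> {}" and cov2: "frontier \<Omega>\<^sub>2 \<subseteq> (\<Union>k\<in>{1..N}. cylinder_set (Z k))"
      and g2: "\<And>k. k \<in> {1..N} \<Longrightarrow> graph_in_cylinder M (Z k) (h\<^sub>2 k) \<Omega>\<^sub>2"
      by (auto simp: lipschitz_domain_with_def bounded_domain_def)
    have h12: "infdist x \<Omega>\<^sub>2 \<le> d" if "x \<in> \<Omega>\<^sub>1" for x using hausdorff_dist_infdist(1)[OF o1(2) o2(2) o1(3) o2(3) that] dd by simp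
    have h21: "infdist x \<Omega>\<^sub>1 \<le> d" if "x \<in> \<Omega>\<^sub>2" for x using hausdorff_dist_infdist(2)[OF o1(2) o2(2) o1(3) o2(3) that] dd by simp
    have d: "0 \<le> d" using h12 o1(3) infdist_nonneg order_trans by blast
    have ds: "2 * d < R" "(1 + C1) * d < \<rho>" "C * d * (1 + card P) < r0"
    proof -
      have b: "d < R / 2" "d < \<rho> / (1 + C1)" "d < r0 / (C * (1 + card P))" using dd(2) by (auto simp: d0_def)
      show "2 * d < R" using b by simp
      show "(1 + C1) * d < \<rho>" using b(2) C1 by (simp add: field_simps)
      have "0 < C * (1 + card P)" using C by simp
      then have "d * (C * (1 + card P)) < r0" using b(3) by (subst (asm) pos_less_divide_eq)
      then show "C * d * (1 + card P) < r0" by (simp only: mult_ac)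
    qed
    have close: "\<bar>h\<^sub>1 k y - h\<^sub>2 k y\<bar> \<le> C1 * d" if "k \<in> {1..N}" "y \<in> base_ball (Z k)" for k y
    proof -
      have v: "valid_cylinder (Z k)" "0 \<le> M" "2 * d < radius (Z k)" using Z M that ds R(2)[OF that(1)] by auto
      show ?thesis
        using graphs_close[OF g1[OF that(1)] g2[OF that(1)] v(1,2) o2(3) h12 d v(3) that(2)]
          graphs_close[OF g2[OF that(1)] g1[OF that(1)] v(1,2) o1(3) h21 d v(3) that(2)]
        by (simp add: C1_def abs_le_iff)
    qed
    define t where "t = C * d"
    have t: "0 \<le> t" "card P * t \<le> r0" 
    proof -
      show t0: "0 \<le> t" using C d by (simp add: t_def)
      have "t * (1 + card P) < r0" using ds(3) by (simp add: t_def)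
      then show "card P * t \<le> r0" using t0 by (simp add: algebra_simps)
    qed
    have move: "y \<in> \<Omega>" if "T \<subseteq> P" "norm (y - x) + card T * t \<le> r0"
      "y - (\<Sum>p\<in>T. (t * \<beta> p x) *\<^sub>R direction (Z (\<kappa> p))) \<in> \<Omega>"
      "\<And>k. k \<in> {1..N} \<Longrightarrow> \<exists>M h. graph_in_cylinder M (Z k) h \<Omega>" for T y \<Omega>
    proof (rule backward_along_field[where P=T and c="\<lambda>p. t * \<beta> p x" and r=r0 and x=x and t=t, OF _ _ _ _ _ _ that(2,3)])
      show "\<exists>M h. graph_in_cylinder M (Z (\<kappa> p)) h \<Omega>" if "p \<in> T" for p
        using \<open>\<And>k. k \<in> {1..N} \<Longrightarrow> \<exists>M h. graph_in_cylinder M (Z k) h \<Omega>\<close> \<kappa> P(1) \<open>T \<subseteq> P\<close> that by blast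
      show "norm (direction (Z (\<kappa> p))) = 1" if "p \<in> T" for p using dir \<kappa> P(1) \<open>T \<subseteq> P\<close> that by blast
      show "0 \<le> t * \<beta> p x" "t * \<beta> p x \<le> t" for p
        using t(1) bump_nonneg[of p _ x] bump_le_1[of p _ x] by (auto simp: \<beta>_def intro: mult_left_le)
      show "finite T" using P \<open>T \<subseteq> P\<close> finite_subset by blast
      fix p z assume p: "p \<in> T" "0 < t * \<beta> p x" "norm (z - x) \<le> r0"
      have pP: "p \<in> P" "p \<in> frontier \<Omega>\<^sub>1" using p P \<open>T \<subseteq> P\<close> by auto
      have "0 < \<beta> p x" using p(2) t(1) by (simp add: zero_less_mult_iff)
      then have "norm (x - p) < 2 * r p" using r[OF pP(2)] by (simp add: \<beta>_def bump_pos_iff)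
      then have "norm (z - p) < 3 * r p" using p(3) r0(2)[OF pP(1)] norm_triangle_ineq[of "z - x" "x - p"] by simp
      then show "z \<in> cylinder_set (Z (\<kappa> p))" using rc[OF pP(2)] by (auto simp: dist_norm norm_minus_commute)
    qed
    have field: "x + (C * d) *\<^sub>R (\<Sum>p\<in>P. \<beta> p x *\<^sub>R e p) = x - (\<Sum>p\<in>P. (t * \<beta> p x) *\<^sub>R direction (Z (\<kappa> p)))"
      by (simp add: t_def e_def scaleR_sum_right sum_negf)
    have deep: "x \<in> \<Omega>'" if p: "p \<in> P" "c \<le> \<beta> p x"
      and in\<Omega>: "x - (\<Sum>p\<in>P. (t * \<beta> p x) *\<^sub>R direction (Z (\<kappa> p))) \<in> \<Omega>"
      and gr: "\<And>k. k \<in> {1..N} \<Longrightarrow> graph_in_cylinder M (Z k) (h k) \<Omega>"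
      and gr': "\<And>k. k \<in> {1..N} \<Longrightarrow> graph_in_cylinder M (Z k) (h' k) \<Omega>'"
      and cl: "\<And>k y. k \<in> {1..N} \<Longrightarrow> y \<in> base_ball (Z k) \<Longrightarrow> h' k y \<le> h k y + C1 * d"
      for p \<Omega> \<Omega>' h h'
    proof -
      let ?Z = "Z (\<kappa> p)"
      define y where "y = x - (t * \<beta> p x) *\<^sub>R direction ?Z"
      have pf: "p \<in> frontier \<Omega>\<^sub>1" using p P by auto
      have k: "\<kappa> p \<in> {1..N}" using \<kappa> pf by blast
      have \<beta>01: "0 \<le> \<beta> p x" "\<beta> p x \<le> 1" by (auto simp: \<beta>_def bump_nonneg bump_le_1)
      have ny: "norm (y - x) \<le> t" using dir[OF k] t(1) \<beta>01 by (simp add: y_def mult_left_le)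
      have ny': "norm (y - x) + card (P - {p}) * t \<le> r0"
      proof -
        have "card P = Suc (card (P - {p}))" by (rule card.remove[OF P(2) p(1)])
        then have "t + card (P - {p}) * t \<le> r0" using t(2) by (simp add: algebra_simps)
        then show ?thesis using ny by linarith
      qed
      have "y \<in> \<Omega>"
      proof (rule move[of "P - {p}"])
        show "y - (\<Sum>p\<in>P - {p}. (t * \<beta> p x) *\<^sub>R direction (Z (\<kappa> p))) \<in> \<Omega>"
          using in\<Omega> sum.remove[OF P(2) p(1), of "\<lambda>p. (t * \<beta> p x) *\<^sub>R direction (Z (\<kappa> p))"]
          by (simp add: y_def diff_diff_eq)
      qed (use ny' gr in auto)
      have "0 < \<beta> p x" using p(2) c(1) by simp
      then have nx: "norm (x - p) < 2 * r p" using r[OF pf] by (simp add: \<beta>_def bump_pos_iff)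
      have "norm (y - x) \<le> r0" using ny' t(1) by (smt (verit) mult_nonneg_nonneg of_nat_0_le_iff)
      then have "norm (y - p) < 3 * r p" using nx r0(2)[OF p(1)] norm_triangle_ineq[of "y - x" "x - p"] by simp
      then have yc: "y \<in> cylinder_set ?Z" using rc[OF pf] by (auto simp: dist_norm norm_minus_commute)
      have xc: "x \<in> cylinder_set ?Z" using rc[OF pf] nx r[OF pf] by (auto simp: dist_norm norm_minus_commute subset_iff)
      have co: "last_coord ?Z y = last_coord ?Z x - t * \<beta> p x" "first_coords ?Z y = first_coords ?Z x"
        using coords_shift[OF dir[OF k], of x "- (t * \<beta> p x)"] by (auto simp: y_def)
      have "h (\<kappa> p) (first_coords ?Z x) < last_coord ?Z x - t * \<beta> p x"
        using \<open>y \<in> \<Omega>\<close> graph_domain_iff[OF gr[OF k] yc] co by simp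
      moreover have "C1 * d \<le> t * \<beta> p x"
      proof -
        have "C1 * d = t * c" using c by (simp add: t_def C_def)
        also have "\<dots> \<le> t * \<beta> p x" using p(2) t(1) by (rule mult_left_mono)
        finally show ?thesis .
      qed
      moreover have "h' (\<kappa> p) (first_coords ?Z x) \<le> h (\<kappa> p) (first_coords ?Z x) + C1 * d"
        using xc by (intro cl[OF k]) (simp add: cylinder_set_def)
      ultimately show ?thesis using graph_domain_iff[OF gr'[OF k] xc] by simp
    qed
    have stay: "x \<in> \<Omega>" if st: "x - (\<Sum>p\<in>P. (t * \<beta> p x) *\<^sub>R direction (Z (\<kappa> p))) \<in> \<Omega>"
      "\<And>k. k \<in> {1..N} \<Longrightarrow> \<exists>M h. graph_in_cylinder M (Z k) h \<Omega>" for \<Omega>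
      by (rule move[of P x \<Omega>]) (use st t in auto)
    show ?thesis unfolding field
    proof (cases "\<exists>q\<in>frontier \<Omega>\<^sub>1. norm (x - q) \<le> \<rho>")
      case True
      then obtain p where p: "p \<in> P" "c \<le> \<beta> p x" using near by blast
      have "h\<^sub>2 k y \<le> h\<^sub>1 k y + C1 * d" "h\<^sub>1 k y \<le> h\<^sub>2 k y + C1 * d" if "k \<in> {1..N}" "y \<in> base_ball (Z k)" for k y
        using close[OF that] by (auto simp: abs_le_iff)
      then show "(x - (\<Sum>p\<in>P. (t * \<beta> p x) *\<^sub>R direction (Z (\<kappa> p))) \<in> \<Omega>\<^sub>1 \<longrightarrow> x \<in> \<Omega>\<^sub>2) \<and>
        (x - (\<Sum>p\<in>P. (t * \<beta> p x) *\<^sub>R direction (Z (\<kappa> p))) \<in> \<Omega>\<^sub>2 \<longrightarrow> x \<in> \<Omega>\<^sub>1)"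
        using deep[OF p _ g1 g2] deep[OF p _ g2 g1] by blast
    next
      case False
      then have far: "\<rho> < norm (x - q)" if "q \<in> frontier \<Omega>\<^sub>1" for q using that by force
      have far2: "\<rho> - C1 * d \<le> norm (x - q)" if q: "q \<in> frontier \<Omega>\<^sub>2" for q
      proof -
        obtain k where k: "k \<in> {1..N}" "q \<in> cylinder_set (Z k)" using cov2 q by blast
        define y where "y = first_coords (Z k) q"
        have yB: "y \<in> base_ball (Z k)" using k by (simp add: cylinder_set_def y_def)
        have lq: "last_coord (Z k) q = h\<^sub>2 k y" unfolding y_def
          by (rule frontier_on_graph[OF g2[OF k(1)] dir[OF k(1)] o2(1) q k(2)])
        define q' where "q' = q + (h\<^sub>1 k y - h\<^sub>2 k y) *\<^sub>R direction (Z k)"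
        have cq: "last_coord (Z k) q' = h\<^sub>1 k y" "first_coords (Z k) q' = y"
          unfolding q'_def using coords_shift[OF dir[OF k(1)]] lq by (auto simp: y_def)
        have "\<bar>h\<^sub>1 k y\<bar> < half_height (Z k)" using g1[OF k(1)] yB by (simp add: graph_in_cylinder_def)
        then have "q' \<in> cylinder_set (Z k)" using cq yB by (simp add: cylinder_set_def)
        then have "q' \<in> frontier \<Omega>\<^sub>1" using cq by (intro graph_on_frontier[OF g1[OF k(1)] dir[OF k(1)] o1(1)]) auto
        then have "\<rho> < norm (x - q')" by (rule far)
        moreover have "norm (q - q') \<le> C1 * d" using close[OF k(1) yB] dir[OF k(1)] by (simp add: q'_def)
        ultimately show ?thesis using norm_triangle_ineq[of "x - q" "q - q'"] by simp
      qed
      have "x \<in> \<Omega>\<^sub>2" if "x \<in> \<Omega>\<^sub>1"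
      proof -
        have "d < \<rho> - C1 * d" using ds(2) by (simp add: algebra_simps)
        then have "infdist x \<Omega>\<^sub>2 < \<rho> - C1 * d" using h12[OF that] by simp
        then obtain y where "y \<in> \<Omega>\<^sub>2" "dist x y < \<rho> - C1 * d" using infdist_less_obtain[OF o2(3)] by blast
        then show ?thesis using far2 by (intro connected_ball_subset[of x "\<rho> - C1 * d" \<Omega>\<^sub>2 y]) (force simp: dist_norm)+
      qed
      moreover have "x \<in> \<Omega>\<^sub>1" if "x \<in> \<Omega>\<^sub>2"
      proof -
        have "0 \<le> C1 * d" using C1 d by simp
        then have "infdist x \<Omega>\<^sub>1 < \<rho>" using h21[OF that] ds(2) by (simp add: algebra_simps)
        then obtain y where "y \<in> \<Omega>\<^sub>1" "dist x y < \<rho>" using infdist_less_obtain[OF o1(3)] by blast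
        then show ?thesis using far by (intro connected_ball_subset[of x \<rho> \<Omega>\<^sub>1 y]) (force simp: dist_norm)+
      qed
      moreover have gr1: "\<exists>M h. graph_in_cylinder M (Z k) h \<Omega>\<^sub>1" if "k \<in> {1..N}" for k using g1[OF that] by blast
      moreover have gr2: "\<exists>M h. graph_in_cylinder M (Z k) h \<Omega>\<^sub>2" if "k \<in> {1..N}" for k using g2[OF that] by blast
      ultimately show "(x - (\<Sum>p\<in>P. (t * \<beta> p x) *\<^sub>R direction (Z (\<kappa> p))) \<in> \<Omega>\<^sub>1 \<longrightarrow> x \<in> \<Omega>\<^sub>2) \<and>
        (x - (\<Sum>p\<in>P. (t * \<beta> p x) *\<^sub>R direction (Z (\<kappa> p))) \<in> \<Omega>\<^sub>2 \<longrightarrow> x \<in> \<Omega>\<^sub>1)"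
        using stay[of \<Omega>\<^sub>1] stay[of \<Omega>\<^sub>2] gr1 gr2 by blast
    qed
  qed
  have "\<forall>p\<in>P. test_function UNIV (\<beta> p) \<and> norm (e p) = 1"
    using P(1) r dir \<kappa> by (auto simp: \<beta>_def e_def intro!: test_function_bump)
  moreover have "C \<ge> 0" using C by simp
  moreover note P(2) d0 main[OF _ refl]
  ultimately show ?thesis
    by (intro exI[of _ P] exI[of _ \<beta>] exI[of _ e] exI[of _ C] exI[of _ d0] conjI ballI allI impI) blast+
qed

section \<open>Change of variables for nearly isometric maps\<close>

text \<open>
  The set lies in the cube whose lower corner consists of the infima of the coordinates. Diameters
  are measured in the maximum norm because cubes are its balls.
\<close>

lemma emeasure_sup_diameter_le:
  fixes S :: "'a::euclidean_space set"
  assumes S: "S \<in> sets borel" and D: "D \<ge> 0"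
    and diam: "\<And>x y b. x \<in> S \<Longrightarrow> y \<in> S \<Longrightarrow> b \<in> Basis \<Longrightarrow> \<bar>(x - y) \<bullet> b\<bar> \<le> D"
  shows "emeasure lborel S \<le> ennreal (D ^ DIM('a))"
proof (cases "S = {}")
  case False
  define l where "l = (\<Sum>b\<in>Basis. (INF x\<in>S. x \<bullet> b) *\<^sub>R b)"
  have lb: "l \<bullet> b = (INF x\<in>S. x \<bullet> b)" if "b \<in> Basis" for b using that by (simp add: l_def)
  define u where "u = l + (\<Sum>b\<in>Basis. D *\<^sub>R b)"
  have ub: "u \<bullet> b = l \<bullet> b + D" if "b \<in> Basis" for b
    using that inner_sum_left_Basis[of b "\<lambda>_. D"] by (simp add: u_def inner_add_left)
  obtain a where a: "a \<in> S" using False by blast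
  have "S \<subseteq> cbox l u"
  proof
    fix x assume x: "x \<in> S"
    show "x \<in> cbox l u" unfolding mem_box
    proof (intro ballI conjI)
      fix b :: 'a assume b: "b \<in> Basis"
      have "bdd_below ((\<lambda>x. x \<bullet> b) ` S)"
        using diam[OF a _ b] by (intro bdd_belowI2[of _ "a \<bullet> b - D"]) (force simp: inner_diff_left abs_le_iff)
      then show "l \<bullet> b \<le> x \<bullet> b" unfolding lb[OF b] using x by (rule cINF_lower)
      have "x \<bullet> b - D \<le> l \<bullet> b" unfolding lb[OF b] using False
      proof (rule cINF_greatest)
        show "x \<bullet> b - D \<le> y \<bullet> b" if "y \<in> S" for y using diam[OF x that b] by (simp add: inner_diff_left abs_le_iff)
      qed
      then show "x \<bullet> b \<le> u \<bullet> b" by (simp add: ub[OF b])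
    qed
  qed
  then have "emeasure lborel S \<le> emeasure lborel (cbox l u)" by (intro emeasure_mono) auto
  also have "\<dots> = ennreal (D ^ DIM('a))"
    using D by (simp add: emeasure_lborel_cbox ub inner_diff_left)
  finally show ?thesis .
qed simp

text \<open>
  One half of a change of variables. On grid cells of small side \<open>h\<close> the function is nearly constant,
  and the preimage of a cell under \<open>g\<close> has diameter at most \<open>K * h\<close> in the maximum norm, hence measure
  at most $K^n h^n$, which is $K^n$ times the measure of the cell.
\<close>

lemma expanding_map_integral_le:
  fixes F :: "'a::euclidean_space \<Rightarrow> real" and g :: "'a \<Rightarrow> 'a"
  assumes F: "continuous_on UNIV F" "\<And>x. 0 \<le> F x" "\<And>x. norm x > R \<Longrightarrow> F x = 0"
    and g: "g \<in> borel_measurable borel" and K: "K > 0"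
    and expand: "\<And>x y s b. (\<And>b. b \<in> Basis \<Longrightarrow> \<bar>(g x - g y) \<bullet> b\<bar> \<le> s) \<Longrightarrow> b \<in> Basis \<Longrightarrow> \<bar>(x - y) \<bullet> b\<bar> \<le> K * s"
  shows "(\<integral>\<^sup>+x. ennreal (F (g x)) \<partial>lborel) \<le> ennreal (K ^ DIM('a) * (\<integral>x. F x \<partial>lborel))"
proof -
  let ?n = "DIM('a)"
  note g[measurable]
  have Fm[measurable]: "F \<in> borel_measurable borel" by (rule borel_measurable_continuous_onI[OF F(1)])
  have Fint: "integrable lborel F"
    by (rule integrable_continuous_compact_support[of F "cball 0 R"]) (use F in auto)
  define V where "V = measure lborel (cball (0::'a) (R + ?n))"
  have V: "integrable lborel (indicat_real (cball (0::'a) (R + ?n)))"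
    using integrable_indicator_cball[of 1 "R + ?n"] by simp
  have uc: "\<exists>\<delta>>0. \<forall>x y. dist x y < \<delta> \<longrightarrow> \<bar>F x - F y\<bar> < \<epsilon>" if "\<epsilon> > 0" for \<epsilon>
  proof -
    have "uniformly_continuous_on (cball 0 (R + 1)) F"
      by (intro compact_uniformly_continuous continuous_on_subset[OF F(1)]) auto
    then have "\<exists>\<delta>>0. \<forall>x\<in>cball 0 (R + 1). \<forall>y\<in>cball 0 (R + 1). dist y x < \<delta> \<longrightarrow> dist (F y) (F x) < \<epsilon>"
      unfolding uniformly_continuous_on_def using that by simp
    then obtain \<delta> where \<delta>: "\<delta> > 0" "\<And>x y. x \<in> cball 0 (R + 1) \<Longrightarrow> y \<in> cball 0 (R + 1) \<Longrightarrow> dist y x < \<delta> \<Longrightarrow> dist (F y) (F x) < \<epsilon>"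
      by blast
    have "\<bar>F x - F y\<bar> < \<epsilon>" if d: "dist x y < min \<delta> 1" for x y
    proof (cases "norm x \<le> R + 1 \<and> norm y \<le> R + 1")
      case True then show ?thesis using \<delta>(2)[of y x] d by (simp add: dist_real_def)
    next
      case False
      have "norm x \<le> norm y + dist x y" "norm y \<le> norm x + dist x y"
        using norm_triangle_sub[of x y] norm_triangle_sub[of y x] by (auto simp: dist_norm norm_minus_commute)
      then have "norm x > R" "norm y > R" using False d by auto
      then show ?thesis using F(3) \<open>\<epsilon> > 0\<close> by simp
    qed
    then show ?thesis using \<delta>(1) by (intro exI[of _ "min \<delta> 1"]) auto
  qed
  have step: "(\<integral>\<^sup>+x. ennreal (F (g x)) \<partial>lborel) \<le> ennreal (K ^ ?n * ((\<integral>x. F x \<partial>lborel) + 2 * \<epsilon> * V))" if \<epsilon>: "\<epsilon> > 0" for \<epsilon>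
  proof -
    obtain \<delta> where \<delta>: "\<delta> > 0" "\<And>x y. dist x y < \<delta> \<Longrightarrow> \<bar>F x - F y\<bar> < \<epsilon>" using uc[OF \<epsilon>] by blast
    define h where "h = min 1 (\<delta> / (2 * ?n))"
    have h: "h > 0" "h \<le> 1" "?n * h < \<delta>"
    proof -
      show "h > 0" "h \<le> 1" using \<delta>(1) by (auto simp: h_def)
      have "?n * h \<le> ?n * (\<delta> / (2 * ?n))" by (intro mult_left_mono) (auto simp: h_def)
      also have "\<dots> < \<delta>" using \<delta>(1) by simp
      finally show "?n * h < \<delta>" .
    qed
    define Q where "Q = (\<lambda>k. {x::'a. cell_index h x = k})"
    define I where "I = cell_index h ` cball (0::'a) R"
    have finI: "finite I" unfolding I_def by (rule finite_cells) simp
    have Q: "Q k \<in> sets borel" "emeasure lborel (Q k) = ennreal (h ^ ?n)" if "k \<in> I" for k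
    proof -
      have "b \<notin> Basis \<Longrightarrow> k b = 0" for b using that by (auto simp: I_def cell_index_def)
      then show "Q k \<in> sets borel" "emeasure lborel (Q k) = ennreal (h ^ ?n)"
        unfolding Q_def using cell_measure[OF h(1)] by blast+
    qed
    have Qd: "\<bar>(x - y) \<bullet> b\<bar> \<le> h" if "x \<in> Q k" "y \<in> Q k" "b \<in> Basis" for x y k b
      using cell_index_diff[OF h(1) _ that(3)] that by (simp add: Q_def)
    have Qn: "norm (x - y) \<le> ?n * h" if "x \<in> Q k" "y \<in> Q k" for x y k
    proof -
      have "norm (x - y) \<le> (\<Sum>b\<in>Basis. \<bar>(x - y) \<bullet> b\<bar>)" by (rule norm_le_l1)
      also have "\<dots> \<le> (\<Sum>b\<in>(Basis::'a set). h)" using Qd[OF that] by (intro sum_mono) auto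
      finally show ?thesis by simp
    qed
    have "\<forall>k\<in>I. \<exists>a\<in>cball 0 R. a \<in> Q k" by (auto simp: I_def Q_def)
    then obtain a where a: "\<And>k. k \<in> I \<Longrightarrow> a k \<in> cball 0 R" "\<And>k. k \<in> I \<Longrightarrow> a k \<in> Q k" by metis
    define m where "m = (\<lambda>k. F (a k) + \<epsilon>)"
    have m0: "m k \<ge> 0" for k using F(2) \<epsilon> by (simp add: m_def add_nonneg_pos less_imp_le)
    have osc: "\<bar>F x - F (a k)\<bar> < \<epsilon>" if "k \<in> I" "x \<in> Q k" for x k
      using \<delta>(2)[of x "a k"] Qn[OF that(2) a(2)[OF that(1)]] h(3) by (simp add: dist_norm)
    have pre: "g -` Q k \<in> sets borel" if "k \<in> I" for k using measurable_sets[OF g Q(1)[OF that]] by simp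
    have pm: "emeasure lborel (g -` Q k) \<le> ennreal ((K * h) ^ ?n)" if "k \<in> I" for k
    proof (rule emeasure_sup_diameter_le[OF pre[OF that]])
      show "K * h \<ge> 0" using K h by simp
      show "\<bar>(x - y) \<bullet> b\<bar> \<le> K * h" if "x \<in> g -` Q k" "y \<in> g -` Q k" "b \<in> Basis" for x y b
        using that Qd by (intro expand) auto
    qed
    have "(\<integral>\<^sup>+x. ennreal (F (g x)) \<partial>lborel) \<le> (\<integral>\<^sup>+x. (\<Sum>k\<in>I. ennreal (m k) * indicator (g -` Q k) x) \<partial>lborel)"
    proof (rule nn_integral_mono)
      fix x
      show "ennreal (F (g x)) \<le> (\<Sum>k\<in>I. ennreal (m k) * indicator (g -` Q k) x)"
      proof (cases "g x \<in> cball 0 R")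
        case False then show ?thesis using F(3)[of "g x"] by simp
      next
        case True
        let ?k = "cell_index h (g x)"
        have k: "?k \<in> I" using True by (simp add: I_def)
        have "F (g x) \<le> m ?k" using osc[OF k, of "g x"] by (simp add: Q_def m_def)
        then have "ennreal (F (g x)) \<le> ennreal (m ?k) * indicator (g -` Q ?k) x"
          by (simp add: Q_def ennreal_leI)
        also have "\<dots> \<le> (\<Sum>k\<in>I. ennreal (m k) * indicator (g -` Q k) x)"
          using finI k by (intro member_le_sum[where f="\<lambda>k. ennreal (m k) * indicator (g -` Q k) x"]) auto
        finally show ?thesis .
      qed
    qed
    also have "\<dots> = (\<Sum>k\<in>I. ennreal (m k) * emeasure lborel (g -` Q k))"
      using pre by (subst nn_integral_sum) (auto simp: nn_integral_cmult_indicator)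
    also have "\<dots> \<le> (\<Sum>k\<in>I. ennreal (m k) * ennreal ((K * h) ^ ?n))"
      using pm by (intro sum_mono mult_left_mono) auto
    also have "\<dots> = (\<Sum>k\<in>I. ennreal (K ^ ?n) * (ennreal (m k) * emeasure lborel (Q k)))"
    proof (intro sum.cong refl)
      fix k assume "k \<in> I"
      have "ennreal ((K * h) ^ ?n) = ennreal (K ^ ?n) * ennreal (h ^ ?n)"
        using K h by (simp add: power_mult_distrib ennreal_mult)
      then show "ennreal (m k) * ennreal ((K * h) ^ ?n) = ennreal (K ^ ?n) * (ennreal (m k) * emeasure lborel (Q k))"
        by (simp add: Q(2)[OF \<open>k \<in> I\<close>] mult_ac)
    qed
    also have "\<dots> = ennreal (K ^ ?n) * (\<integral>\<^sup>+x. (\<Sum>k\<in>I. ennreal (m k) * indicator (Q k) x) \<partial>lborel)"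
      using Q(1) by (subst nn_integral_sum) (auto simp: nn_integral_cmult_indicator sum_distrib_left)
    also have "\<dots> \<le> ennreal (K ^ ?n) * (\<integral>\<^sup>+x. ennreal (F x + 2 * \<epsilon> * indicator (cball 0 (R + ?n)) x) \<partial>lborel)"
    proof (intro mult_left_mono nn_integral_mono)
      fix x
      show "(\<Sum>k\<in>I. ennreal (m k) * indicator (Q k) x) \<le> ennreal (F x + 2 * \<epsilon> * indicator (cball 0 (R + ?n)) x)"
      proof (cases "cell_index h x \<in> I")
        case False
        then have "(\<Sum>k\<in>I. ennreal (m k) * indicator (Q k) x) = 0" by (intro sum.neutral) (auto simp: Q_def indicator_def)
        then show ?thesis by simp
      next
        case True
        let ?k = "cell_index h x"
        have xQ: "x \<in> Q ?k" by (simp add: Q_def)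
        have "(\<Sum>k\<in>I. ennreal (m k) * indicator (Q k) x) = (\<Sum>k\<in>I. if k = ?k then ennreal (m k) else 0)"
          by (intro sum.cong) (auto simp: Q_def)
        also have "\<dots> = ennreal (m ?k)" using finI True by simp
        also have "m ?k \<le> F x + 2 * \<epsilon> * indicator (cball 0 (R + ?n)) x"
        proof -
          have "norm x \<le> norm (x - a ?k) + norm (a ?k)" using norm_triangle_ineq[of "x - a ?k" "a ?k"] by simp
          moreover have "norm (x - a ?k) \<le> ?n * h" by (rule Qn[OF xQ a(2)[OF True]])
          moreover have "?n * h \<le> ?n" using h by (simp add: mult_left_le)
          ultimately have "x \<in> cball 0 (R + ?n)" using a(1)[OF True] unfolding mem_cball_0 by linarith
          then show ?thesis using osc[OF True xQ] by (simp add: m_def)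
        qed
        finally show ?thesis by (simp add: ennreal_leI)
      qed
    qed simp
    also have "(\<integral>\<^sup>+x. ennreal (F x + 2 * \<epsilon> * indicator (cball 0 (R + ?n)) x) \<partial>lborel)
        = ennreal (\<integral>x. F x + 2 * \<epsilon> * indicator (cball 0 (R + ?n)) x \<partial>lborel)"
      using Fint V F(2) \<epsilon> by (intro nn_integral_eq_integral) auto
    also have "(\<integral>x. F x + 2 * \<epsilon> * indicator (cball 0 (R + ?n)) x \<partial>lborel) = (\<integral>x. F x \<partial>lborel) + 2 * \<epsilon> * V"
      using Fint V by (simp add: V_def)
    also have "ennreal (K ^ ?n) * ennreal ((\<integral>x. F x \<partial>lborel) + 2 * \<epsilon> * V) = ennreal (K ^ ?n * ((\<integral>x. F x \<partial>lborel) + 2 * \<epsilon> * V))"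
      using K F(2) \<epsilon> by (subst ennreal_mult[symmetric]) (auto simp: V_def)
    finally show ?thesis .
  qed
  show ?thesis
  proof (rule ennreal_le_epsilon)
    fix \<eta> :: real assume \<eta>: "\<eta> > 0"
    define \<epsilon> where "\<epsilon> = \<eta> / (2 * K ^ ?n * (V + 1))"
    have V0: "V \<ge> 0" by (simp add: V_def)
    have \<epsilon>: "\<epsilon> > 0" using \<eta> K V0 by (simp add: \<epsilon>_def)
    have "K ^ ?n * (2 * \<epsilon> * V) \<le> K ^ ?n * (2 * \<epsilon> * (V + 1))" using K \<epsilon> by (intro mult_left_mono) auto
    also have "\<dots> = \<eta>" using K V0 by (simp add: \<epsilon>_def)
    finally have "K ^ ?n * ((\<integral>x. F x \<partial>lborel) + 2 * \<epsilon> * V) \<le> K ^ ?n * (\<integral>x. F x \<partial>lborel) + \<eta>"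
      by (simp add: algebra_simps)
    then have "ennreal (K ^ ?n * ((\<integral>x. F x \<partial>lborel) + 2 * \<epsilon> * V)) \<le> ennreal (K ^ ?n * (\<integral>x. F x \<partial>lborel) + \<eta>)"
      by (rule ennreal_leI)
    also have "\<dots> = ennreal (K ^ ?n * (\<integral>x. F x \<partial>lborel)) + ennreal \<eta>"
      using K F(2) \<eta> by (intro ennreal_plus) auto
    finally show "(\<integral>\<^sup>+x. ennreal (F (g x)) \<partial>lborel) \<le> ennreal (K ^ ?n * (\<integral>x. F x \<partial>lborel)) + ennreal \<eta>"
      using step[OF \<epsilon>] by (rule order_trans[rotated])
  qed
qed

section \<open>Transplantation of test functions\<close>

text \<open>
  Bernoulli's inequality linearises the powers that come from volumes.
\<close>

lemma power_perturbation:
  fixes s :: real and n :: nat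
  assumes s: "0 \<le> s" "real n * s \<le> 1/2" "n \<ge> 1"
  shows "(1 + s)\<^sup>2 * (1 / (1 - s)) ^ n \<le> 1 + (2 * real n + 6) * s"
    and "1 - (2 * real n + 6) * s \<le> (1 / (1 + s)) ^ n"
proof -
  have "1 * s \<le> real n * s" using s by (intro mult_right_mono) auto
  then have s1: "s \<le> 1/2" using s by linarith
  have bern: "1 - real n * s \<le> (1 - s) ^ n" using Bernoulli_inequality[of "-s" n] s1 by simp
  have "(1 + s)\<^sup>2 = 1 + 2 * s + s * s" by (simp add: power2_eq_square algebra_simps)
  also have "\<dots> \<le> 1 + 3 * s" using mult_left_mono[OF s1 s(1)] s(1) by simp
  finally have sq: "(1 + s)\<^sup>2 \<le> 1 + 3 * s" .
  have "(1 / (1 - s)) ^ n = 1 / (1 - s) ^ n" by (simp add: power_divide)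
  also have "\<dots> \<le> 1 / (1 - real n * s)" using bern s by (intro divide_left_mono) auto
  also have "\<dots> \<le> 1 + 2 * (real n * s)"
  proof -
    have "real n * s * (1 - 2 * (real n * s)) \<ge> 0" using s by (intro mult_nonneg_nonneg) auto
    then have "1 \<le> (1 + 2 * (real n * s)) * (1 - real n * s)" by (simp add: algebra_simps)
    then show ?thesis using s by (simp add: divide_le_eq)
  qed
  finally have inv: "(1 / (1 - s)) ^ n \<le> 1 + 2 * (real n * s)" .
  have "(1 + s)\<^sup>2 * (1 / (1 - s)) ^ n \<le> (1 + 3 * s) * (1 + 2 * (real n * s))"
    using sq inv s s1 by (intro mult_mono) auto
  also have "\<dots> = 1 + 3 * s + 2 * real n * s + 6 * s * (real n * s)" by (simp add: algebra_simps)
  also have "\<dots> \<le> 1 + 3 * s + 2 * real n * s + 6 * s * (1/2)" using s by (intro add_left_mono mult_left_mono) auto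
  also have "\<dots> = 1 + (2 * real n + 6) * s" by (simp add: algebra_simps)
  finally show "(1 + s)\<^sup>2 * (1 / (1 - s)) ^ n \<le> 1 + (2 * real n + 6) * s" .
  have "1 - (2 * real n + 6) * s \<le> 1 - real n * s" using s by (simp add: algebra_simps)
  also have "\<dots> \<le> (1 - s) ^ n" by (rule bern)
  also have "\<dots> \<le> (1 / (1 + s)) ^ n"
  proof (rule power_mono)
    have "(1 - s) * (1 + s) \<le> 1" by (simp add: algebra_simps)
    then show "1 - s \<le> 1 / (1 + s)" using s by (simp add: pos_le_divide_eq)
  qed (use s1 in auto)
  finally show "1 - (2 * real n + 6) * s \<le> (1 / (1 + s)) ^ n" .
qed

lemma sup_norm_perturbation:
  fixes W :: "'a::euclidean_space \<Rightarrow> 'a" and L s :: real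
  assumes W: "\<And>x y. norm (W x - W y) \<le> L * norm (x - y)" and L: "L \<ge> 0"
    and near: "\<And>b. b \<in> Basis \<Longrightarrow> \<bar>(x - y) \<bullet> b\<bar> \<le> s" and b: "b \<in> Basis"
  shows "\<bar>(W x - W y) \<bullet> b\<bar> \<le> (DIM('a) * L) * s"
proof -
  have "norm (x - y) \<le> (\<Sum>b\<in>Basis. \<bar>(x - y) \<bullet> b\<bar>)" by (rule norm_le_l1)
  also have "\<dots> \<le> (\<Sum>b\<in>(Basis::'a set). s)" using near by (intro sum_mono)
  finally have n: "norm (x - y) \<le> DIM('a) * s" by simp
  have "\<bar>(W x - W y) \<bullet> b\<bar> \<le> norm (W x - W y)" by (rule Basis_le_norm[OF b])
  also have "\<dots> \<le> L * norm (x - y)" by (rule W)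
  also have "\<dots> \<le> L * (DIM('a) * s)" using n L by (rule mult_left_mono)
  finally show ?thesis by (simp add: mult_ac)
qed

lemma near_identity_expanding:
  fixes W :: "'a::euclidean_space \<Rightarrow> 'a" and L s :: real
  assumes W: "\<And>x y. norm (W x - W y) \<le> L * norm (x - y)" and L: "L \<ge> 0" "DIM('a) * L < 1"
    and near: "\<And>b. b \<in> Basis \<Longrightarrow> \<bar>((x + W x) - (y + W y)) \<bullet> b\<bar> \<le> s" and b: "b \<in> Basis"
  shows "\<bar>(x - y) \<bullet> b\<bar> \<le> 1 / (1 - DIM('a) * L) * s"
proof -
  define m where "m = Max ((\<lambda>b. \<bar>(x - y) \<bullet> b\<bar>) ` Basis)"
  have m: "\<bar>(x - y) \<bullet> b\<bar> \<le> m" if "b \<in> Basis" for b unfolding m_def using that by (intro Max_ge) auto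
  have "m \<in> (\<lambda>b. \<bar>(x - y) \<bullet> b\<bar>) ` Basis" unfolding m_def by (intro Max_in) auto
  then obtain c where c: "c \<in> Basis" "m = \<bar>(x - y) \<bullet> c\<bar>" by auto
  have "m \<le> s + DIM('a) * L * m"
  proof -
    have "(x - y) \<bullet> c = ((x + W x) - (y + W y)) \<bullet> c - (W x - W y) \<bullet> c" by (simp add: algebra_simps)
    then show ?thesis using near[OF c(1)] sup_norm_perturbation[OF W L(1) m c(1)] unfolding c(2) by linarith
  qed
  then have "(1 - DIM('a) * L) * m \<le> s" by (simp add: algebra_simps)
  then have "m \<le> s / (1 - DIM('a) * L)" using L by (subst pos_le_divide_eq) (auto simp: mult.commute)
  then show ?thesis using m[OF b] by simp
qed

text \<open>
  The equation \<open>x + W x = y\<close> is a fixed-point problem for the contraction \<open>\<lambda>x. y - W x\<close>.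
\<close>

lemma near_identity_bij:
  fixes W :: "'a::euclidean_space \<Rightarrow> 'a" and L s :: real
  assumes W: "\<And>x y. norm (W x - W y) \<le> L * norm (x - y)" and L: "0 \<le> L" "L < 1"
  shows "bij (\<lambda>x. x + W x)"
proof (rule bijI)
  show "inj (\<lambda>x. x + W x)"
  proof (rule injI)
    fix x y assume "x + W x = y + W y"
    then have "x - y = - (W x - W y)" by (simp add: algebra_simps)
    then have "norm (x - y) \<le> L * norm (x - y)" using W[of x y] by (metis norm_minus_cancel)
    then have "(1 - L) * norm (x - y) \<le> 0" by (simp add: algebra_simps)
    then show "x = y" using L by (simp add: mult_le_0_iff)
  qed
  show "surj (\<lambda>x. x + W x)"
  proof (unfold surj_def, rule allI)
    fix y
    have "\<exists>!x. y - W x = x"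
      by (rule banach_fix_type[OF L]) (use W in \<open>auto simp: dist_norm norm_minus_commute\<close>)
    then obtain x where "y - W x = x" by blast
    then show "\<exists>x. y = x + W x" by (metis diff_add_cancel)
  qed
qed

locale smooth_field =
  fixes P :: "'i set" and \<beta> :: "'i \<Rightarrow> 'a::euclidean_space \<Rightarrow> real" and e :: "'i \<Rightarrow> 'a"
  assumes finP: "finite P"
    and test: "\<And>p. p \<in> P \<Longrightarrow> test_function UNIV (\<beta> p)"
    and unit: "\<And>p. p \<in> P \<Longrightarrow> norm (e p) = 1"
begin

definition field :: "'a \<Rightarrow> 'a" where
  "field x = (\<Sum>p\<in>P. \<beta> p x *\<^sub>R e p)"

lemma field_bounds:
  "\<exists>L\<ge>0. (\<forall>x. norm (field x) \<le> L) \<and> (\<forall>x y. norm (field x - field y) \<le> L * norm (x - y)) \<and>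
     (\<forall>x v. norm (\<Sum>p\<in>P. frechet_derivative (\<beta> p) (at x) v *\<^sub>R e p) \<le> L * norm v)"
proof -
  have "\<forall>p\<in>P. \<exists>G. \<forall>x. norm (grad (\<beta> p) x) \<le> G" using test_function_bounded_grad[OF test] by blast
  then obtain G where G: "\<And>p x. p \<in> P \<Longrightarrow> norm (grad (\<beta> p) x) \<le> G p" by metis
  have "\<exists>B. \<forall>x. \<bar>\<beta> p x\<bar> \<le> B" if "p \<in> P" for p
  proof -
    let ?K = "closure {x. \<beta> p x \<noteq> 0}"
    have "bounded (\<beta> p ` ?K)"
      using test[OF that] by (intro compact_imp_bounded compact_continuous_image test_function_continuous[OF test[OF that]])
        (auto simp: test_function_def)
    then obtain B where "\<And>x. x \<in> ?K \<Longrightarrow> \<bar>\<beta> p x\<bar> \<le> B" by (auto simp: bounded_iff)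
    moreover have "\<beta> p x = 0" if "x \<notin> ?K" for x using that closure_subset[of "{x. \<beta> p x \<noteq> 0}"] by auto
    ultimately have "\<bar>\<beta> p x\<bar> \<le> max B 0" for x by (metis abs_zero le_max_iff_disj order_refl)
    then show ?thesis by blast
  qed
  then obtain B where B: "\<And>p x. p \<in> P \<Longrightarrow> \<bar>\<beta> p x\<bar> \<le> B p" by metis
  have GB0: "G p \<ge> 0" "B p \<ge> 0" if "p \<in> P" for p using G[OF that] B[OF that] norm_ge_zero abs_ge_zero order_trans by blast+
  define L where "L = (\<Sum>p\<in>P. G p + B p)"
  have "L \<ge> 0" unfolding L_def using GB0 by (intro sum_nonneg add_nonneg_nonneg) auto
  moreover have "norm (field x) \<le> L" for x
    unfolding field_def L_def
  proof (rule sum_norm_le)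
    fix p assume "p \<in> P"
    then show "norm (\<beta> p x *\<^sub>R e p) \<le> G p + B p" using unit B[of p x] GB0[of p] by simp
  qed
  moreover have "norm (field x - field y) \<le> L * norm (x - y)" for x y
  proof -
    have "field x - field y = (\<Sum>p\<in>P. (\<beta> p x - \<beta> p y) *\<^sub>R e p)"
      by (simp add: field_def scaleR_diff_left sum_subtractf)
    also have "norm \<dots> \<le> (\<Sum>p\<in>P. (G p + B p) * norm (x - y))"
    proof (rule sum_norm_le)
      fix p assume p: "p \<in> P"
      have "\<bar>\<beta> p x - \<beta> p y\<bar> \<le> G p * norm (x - y)" by (rule test_function_Lipschitz[OF test[OF p] G[OF p]])
      also have "\<dots> \<le> (G p + B p) * norm (x - y)" using GB0[OF p] by (intro mult_right_mono) auto
      finally show "norm ((\<beta> p x - \<beta> p y) *\<^sub>R e p) \<le> (G p + B p) * norm (x - y)" using unit[OF p] by simp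
    qed
    also have "\<dots> = L * norm (x - y)" by (simp add: L_def sum_distrib_right)
    finally show ?thesis .
  qed
  moreover have "norm (\<Sum>p\<in>P. frechet_derivative (\<beta> p) (at x) v *\<^sub>R e p) \<le> L * norm v" for x v
  proof -
    have "norm (\<Sum>p\<in>P. frechet_derivative (\<beta> p) (at x) v *\<^sub>R e p) \<le> (\<Sum>p\<in>P. (G p + B p) * norm v)"
    proof (rule sum_norm_le)
      fix p assume p: "p \<in> P"
      have "\<bar>frechet_derivative (\<beta> p) (at x) v\<bar> = \<bar>grad (\<beta> p) x \<bullet> v\<bar>"
        using grad_inner[OF test_function_differentiable[OF test[OF p]]] by simp
      also have "\<dots> \<le> norm (grad (\<beta> p) x) * norm v" by (rule Cauchy_Schwarz_ineq2)
      also have "\<dots> \<le> (G p + B p) * norm v" using G[OF p, of x] GB0[OF p] by (intro mult_right_mono) auto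
      finally show "norm (frechet_derivative (\<beta> p) (at x) v *\<^sub>R e p) \<le> (G p + B p) * norm v" using unit[OF p] by simp
    qed
    also have "\<dots> = L * norm v" by (simp add: L_def sum_distrib_right)
    finally show ?thesis .
  qed
  ultimately show ?thesis by blast
qed

lemma field_smooth: "Ck k (\<lambda>x. (x + t *\<^sub>R field x) \<bullet> i)"
proof -
  have "Ck k (\<lambda>x. x \<bullet> i + (\<Sum>p\<in>P. \<beta> p x * (t * (e p \<bullet> i))))"
    using test by (intro Ck_add Ck_inner_const Ck_sum Ck_mult Ck_const) (auto simp: test_function_def simp del: Ck.simps)
  moreover have "x \<bullet> i + (\<Sum>p\<in>P. \<beta> p x * (t * (e p \<bullet> i))) = (x + t *\<^sub>R field x) \<bullet> i" for x
    by (simp add: field_def inner_add_left inner_sum_left sum_distrib_left mult_ac)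
  ultimately show ?thesis by simp
qed

lemma field_derivative:
  "((\<lambda>x. x + t *\<^sub>R field x) has_derivative (\<lambda>v. v + t *\<^sub>R (\<Sum>p\<in>P. frechet_derivative (\<beta> p) (at x) v *\<^sub>R e p))) (at x)"
  unfolding field_def
  by (intro derivative_intros has_derivative_frechet test_function_differentiable[OF test])

text \<open>
  Both integral estimates are instances of \<open>expanding_map_integral_le\<close>: the one for the energy for
  \<open>\<Psi> = id + t * field\<close>, after the chain rule has bounded the new gradient, and the one for the square
  integral for the inverse of \<open>\<Psi>\<close>. In the maximum norm \<open>t * field\<close> has Lipschitz constant at most
  $s = n\,t\,(L + 1)$.
\<close>

theorem transplantation_estimates:
  "\<exists>L>0. \<forall>t \<phi> \<Omega>\<^sub>1. 0 \<le> t \<longrightarrow> t * L \<le> 1 \<longrightarrow> test_function \<Omega>\<^sub>1 \<phi> \<longrightarrow>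
     (\<forall>\<Omega>\<^sub>2. (\<forall>x. x + t *\<^sub>R field x \<in> \<Omega>\<^sub>1 \<longrightarrow> x \<in> \<Omega>\<^sub>2) \<longrightarrow> test_function \<Omega>\<^sub>2 (\<lambda>x. \<phi> (x + t *\<^sub>R field x))) \<and>
     dirichlet_integral (\<lambda>x. \<phi> (x + t *\<^sub>R field x)) \<le> (1 + L * t) * dirichlet_integral \<phi> \<and>
     (1 - L * t) * square_integral \<phi> \<le> square_integral (\<lambda>x. \<phi> (x + t *\<^sub>R field x))"
proof -
  let ?n = "DIM('a)"
  obtain L where L: "L \<ge> 0" "\<And>x. norm (field x) \<le> L" "\<And>x y. norm (field x - field y) \<le> L * norm (x - y)"
    "\<And>x v. norm (\<Sum>p\<in>P. frechet_derivative (\<beta> p) (at x) v *\<^sub>R e p) \<le> L * norm v"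
    using field_bounds by blast
  define L' where "L' = (2 * real ?n + 6) * (?n * (L + 1))"
  have n1: "?n \<ge> 1" by simp
  have "L' > 0" using L(1) by (simp add: L'_def)
  moreover have "(\<forall>\<Omega>\<^sub>2. (\<forall>x. x + t *\<^sub>R field x \<in> \<Omega>\<^sub>1 \<longrightarrow> x \<in> \<Omega>\<^sub>2) \<longrightarrow> test_function \<Omega>\<^sub>2 (\<lambda>x. \<phi> (x + t *\<^sub>R field x))) \<and>
     dirichlet_integral (\<lambda>x. \<phi> (x + t *\<^sub>R field x)) \<le> (1 + L' * t) * dirichlet_integral \<phi> \<and>
     (1 - L' * t) * square_integral \<phi> \<le> square_integral (\<lambda>x. \<phi> (x + t *\<^sub>R field x))"
    if t: "0 \<le> t" "t * L' \<le> 1" and \<phi>: "test_function \<Omega>\<^sub>1 \<phi>" for t \<phi> \<Omega>\<^sub>1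
  proof -
    define W where "W = (\<lambda>x. t *\<^sub>R field x)"
    define \<Psi> where "\<Psi> = (\<lambda>x. x + W x)"
    define l where "l = t * (L + 1)"
    define s where "s = ?n * l"
    have l: "0 \<le> l" "t * L \<le> l" using t(1) L(1) by (auto simp: l_def algebra_simps)
    have s: "0 \<le> s" "?n * s \<le> 1/2" "s \<le> 1/2" "l \<le> s"
    proof -
      show s0: "0 \<le> s" using l by (simp add: s_def)
      have e: "t * L' = (2 * real ?n + 6) * s" by (simp add: L'_def s_def l_def)
      then have "(2 * real ?n + 6) * s \<le> 1" using t(2) by simp
      then show a: "?n * s \<le> 1/2" using s0 by (simp add: algebra_simps)
      have "1 * s \<le> ?n * s" using n1 s0 by (intro mult_right_mono) auto
      then show "s \<le> 1/2" using a by simp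
      have "1 * l \<le> ?n * l" using n1 l by (intro mult_right_mono) auto
      then show "l \<le> s" by (simp add: s_def)
    qed
    have Wl: "norm (W x - W y) \<le> l * norm (x - y)" for x y
    proof -
      have "norm (W x - W y) = t * norm (field x - field y)" using t(1) by (simp add: W_def flip: scaleR_diff_right)
      also have "\<dots> \<le> t * (L * norm (x - y))" using L(3) t(1) by (intro mult_left_mono) auto
      also have "\<dots> \<le> l * norm (x - y)" using l(2) mult_right_mono[OF l(2), of "norm (x - y)"] by (simp add: mult.assoc)
      finally show ?thesis .
    qed
    have sm: "\<And>k i. Ck k (\<lambda>x. \<Psi> x \<bullet> i)" unfolding \<Psi>_def W_def by (rule field_smooth)
    have near: "norm (\<Psi> x - x) \<le> t * L" for x
      using L(2)[of x] t(1) by (simp add: \<Psi>_def W_def mult_left_mono)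
    have tf: "test_function \<Omega>\<^sub>2 (\<lambda>x. \<phi> (\<Psi> x))" if "\<And>x. \<Psi> x \<in> \<Omega>\<^sub>1 \<Longrightarrow> x \<in> \<Omega>\<^sub>2" for \<Omega>\<^sub>2
      by (rule test_function_compose[OF \<phi> sm near that])
    have tfU: "test_function UNIV (\<lambda>x. \<phi> (\<Psi> x))" by (rule tf) simp
    have \<Psi>cont: "continuous_on UNIV \<Psi>" using sm[of 0] by (subst continuous_on_componentwise) auto
    then have \<Psi>m: "\<Psi> \<in> borel_measurable borel" by (rule borel_measurable_continuous_onI)
    have s_lt: "?n * l < 1" using s by (simp add: s_def)
    have bij: "bij \<Psi>" unfolding \<Psi>_def by (rule near_identity_bij[OF Wl l(1)]) (use s in linarith)
    define h where "h = inv \<Psi>"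
    have h: "\<Psi> (h y) = y" "h (\<Psi> x) = x" for x y
      using bij by (auto simp: h_def bij_is_surj surj_f_inv_f bij_is_inj inv_f_f)
    have expand: "\<bar>(x - y) \<bullet> b\<bar> \<le> 1 / (1 - s) * r"
      if "\<And>b. b \<in> Basis \<Longrightarrow> \<bar>(\<Psi> x - \<Psi> y) \<bullet> b\<bar> \<le> r" "b \<in> Basis" for x y r b
      using near_identity_expanding[OF Wl l(1) s_lt, of x y r b] that by (simp add: \<Psi>_def s_def)
    have contract: "\<bar>(x - y) \<bullet> b\<bar> \<le> (1 + s) * r"
      if nr: "\<And>b. b \<in> Basis \<Longrightarrow> \<bar>(h x - h y) \<bullet> b\<bar> \<le> r" and b: "b \<in> Basis" for x y r b
    proof -
      have "\<bar>(W (h x) - W (h y)) \<bullet> b\<bar> \<le> (?n * l) * r" by (rule sup_norm_perturbation[OF Wl l(1) nr b])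
      moreover have "x - y = (h x - h y) + (W (h x) - W (h y))"
        using h(1)[of x] h(1)[of y] by (simp add: \<Psi>_def algebra_simps)
      then have "(x - y) \<bullet> b = (h x - h y) \<bullet> b + (W (h x) - W (h y)) \<bullet> b" by (simp add: inner_add_left)
      ultimately show ?thesis using nr[OF b] by (simp add: s_def algebra_simps)
    qed
    have hl: "norm (h x - h y) \<le> 2 * norm (x - y)" for x y
    proof -
      have "h x - h y = (x - y) - (W (h x) - W (h y))"
        using h(1)[of x] h(1)[of y] by (simp add: \<Psi>_def algebra_simps)
      then have "norm (h x - h y) \<le> norm (x - y) + norm (W (h x) - W (h y))"
        by (metis norm_triangle_ineq4)
      also have "\<dots> \<le> norm (x - y) + l * norm (h x - h y)" using Wl by simp
      also have "l * norm (h x - h y) \<le> 1/2 * norm (h x - h y)" using s by (intro mult_right_mono) auto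
      finally show ?thesis by simp
    qed
    have "2-lipschitz_on UNIV h" using hl by (auto simp: lipschitz_on_def dist_norm)
    then have hm: "h \<in> borel_measurable borel"
      by (intro borel_measurable_continuous_onI lipschitz_on_continuous_on)
    have vanish: "\<exists>R. \<forall>x. norm x > R \<longrightarrow> \<eta> x = 0 \<and> grad \<eta> x = 0" if "test_function UNIV \<eta>" for \<eta> :: "'a \<Rightarrow> real"
    proof -
      have "bounded (closure {x. \<eta> x \<noteq> 0})" using that by (auto simp: test_function_def intro: compact_imp_bounded)
      then obtain R where R: "\<And>x. x \<in> closure {x. \<eta> x \<noteq> 0} \<Longrightarrow> norm x \<le> R" by (auto simp: bounded_iff)
      have "\<eta> x = 0 \<and> grad \<eta> x = 0" if "norm x > R" for x
      proof -
        have x: "x \<notin> closure {x. \<eta> x \<noteq> 0}" using R[of x] that by auto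
        then show ?thesis using closure_subset[of "{x. \<eta> x \<noteq> 0}"] by (auto simp: grad_outside_support)
      qed
      then show ?thesis by blast
    qed
    have \<phi>U: "test_function UNIV \<phi>" using \<phi> by (rule test_function_mono) simp
    \<comment> \<open>The lower bound for the mass is an upper bound for the inverse map: \<open>\<phi>\<close> is \<open>\<phi> \<circ> \<Psi>\<close> composed with \<open>h\<close>.\<close>
    obtain R where R: "\<And>x. norm x > R \<Longrightarrow> \<phi> (\<Psi> x) = 0" using vanish[OF tfU] by blast
    have "(\<integral>\<^sup>+x. ennreal ((\<phi> (\<Psi> (h x)))\<^sup>2) \<partial>lborel) \<le> ennreal ((1 + s) ^ ?n * square_integral (\<lambda>x. \<phi> (\<Psi> x)))"
    proof (rule expanding_map_integral_le[where F="\<lambda>x. (\<phi> (\<Psi> x))\<^sup>2" and g=h and R=R])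
      show "continuous_on UNIV (\<lambda>x. (\<phi> (\<Psi> x))\<^sup>2)" by (intro continuous_on_power test_function_continuous[OF tfU])
    qed (use R hm s contract in auto)
    also have "(\<integral>\<^sup>+x. ennreal ((\<phi> (\<Psi> (h x)))\<^sup>2) \<partial>lborel) = ennreal (square_integral \<phi>)"
      unfolding h using test_function_power2_integrable[OF \<phi>] by (intro nn_integral_eq_integral) auto
    finally have "square_integral \<phi> \<le> (1 + s) ^ ?n * square_integral (\<lambda>x. \<phi> (\<Psi> x))"
      using s by (subst (asm) ennreal_le_iff) auto
    then have mass: "(1 / (1 + s)) ^ ?n * square_integral \<phi> \<le> square_integral (\<lambda>x. \<phi> (\<Psi> x))"
      using s by (simp add: power_divide divide_le_eq mult.commute)
    have e1: "(2 * real ?n + 6) * s = L' * t" by (simp add: L'_def s_def l_def)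
    have "(1 - L' * t) * square_integral \<phi> \<le> (1 / (1 + s)) ^ ?n * square_integral \<phi>"
      using power_perturbation(2)[OF s(1,2) n1] unfolding e1 by (intro mult_right_mono) auto
    then have m: "(1 - L' * t) * square_integral \<phi> \<le> square_integral (\<lambda>x. \<phi> (\<Psi> x))" using mass by linarith
    \<comment> \<open>Testing the derivative of \<open>\<phi> \<circ> \<Psi>\<close> with its own gradient avoids the adjoint of the derivative of \<open>\<Psi>\<close>.\<close>
    have gr: "norm (grad (\<lambda>x. \<phi> (\<Psi> x)) x) \<le> (1 + s) * norm (grad \<phi> (\<Psi> x))" for x
    proof -
      let ?v = "grad (\<lambda>x. \<phi> (\<Psi> x)) x"
      let ?D = "\<lambda>v. v + t *\<^sub>R (\<Sum>p\<in>P. frechet_derivative (\<beta> p) (at x) v *\<^sub>R e p)"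
      have "((\<lambda>x. \<phi> (\<Psi> x)) has_derivative (\<lambda>v. frechet_derivative \<phi> (at (\<Psi> x)) (?D v))) (at x)"
        unfolding \<Psi>_def W_def
        by (rule has_derivative_compose[OF field_derivative has_derivative_frechet[OF test_function_differentiable[OF \<phi>]]])
      from frechet_derivative_eqI[OF this, of ?v]
      have "?v \<bullet> ?v = frechet_derivative \<phi> (at (\<Psi> x)) (?D ?v)"
        unfolding grad_inner[OF test_function_differentiable[OF tfU]] .
      also have "\<dots> = grad \<phi> (\<Psi> x) \<bullet> ?D ?v" by (rule grad_inner[OF test_function_differentiable[OF \<phi>]])
      also have "\<dots> \<le> norm (grad \<phi> (\<Psi> x)) * norm (?D ?v)" by (rule norm_cauchy_schwarz)
      also have "norm (?D ?v) \<le> (1 + s) * norm ?v"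
      proof -
        have "norm (?D ?v) \<le> norm ?v + t * norm (\<Sum>p\<in>P. frechet_derivative (\<beta> p) (at x) ?v *\<^sub>R e p)"
          using norm_triangle_ineq[of ?v "t *\<^sub>R (\<Sum>p\<in>P. frechet_derivative (\<beta> p) (at x) ?v *\<^sub>R e p)"] t(1) by simp
        also have "\<dots> \<le> norm ?v + t * (L * norm ?v)" using L(4) t(1) by (intro add_left_mono mult_left_mono) auto
        also have "t * (L * norm ?v) \<le> s * norm ?v"
          using mult_right_mono[of "t * L" s "norm ?v"] l s by (simp add: mult.assoc)
        finally show ?thesis by (simp add: algebra_simps)
      qed
      finally have "?v \<bullet> ?v \<le> norm (grad \<phi> (\<Psi> x)) * ((1 + s) * norm ?v)"
        by (simp add: mult_left_mono)
      then have "norm ?v * norm ?v \<le> ((1 + s) * norm (grad \<phi> (\<Psi> x))) * norm ?v"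
        by (simp add: mult_ac flip: power2_norm_eq_inner power2_eq_square)
      then show ?thesis using s by (cases "norm ?v = 0") (auto simp: mult_le_cancel_right)
    qed
    obtain R' where R': "\<And>x. norm x > R' \<Longrightarrow> grad \<phi> x = 0" using vanish[OF \<phi>U] by blast
    have cg: "continuous_on UNIV (\<lambda>x. (norm (grad \<phi> x))\<^sup>2)"
      by (intro continuous_intros test_function_continuous_grad[OF \<phi>])
    have nn: "(\<integral>\<^sup>+x. ennreal ((norm (grad \<phi> (\<Psi> x)))\<^sup>2) \<partial>lborel)
      \<le> ennreal ((1 / (1 - s)) ^ ?n * dirichlet_integral \<phi>)"
      by (rule expanding_map_integral_le[where F="\<lambda>x. (norm (grad \<phi> x))\<^sup>2" and g=\<Psi> and R=R', OF cg])
         (use R' \<Psi>m s expand in auto)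
    have "ennreal (dirichlet_integral (\<lambda>x. \<phi> (\<Psi> x))) = (\<integral>\<^sup>+x. ennreal ((norm (grad (\<lambda>x. \<phi> (\<Psi> x)) x))\<^sup>2) \<partial>lborel)"
      using test_function_norm_grad_integrable[OF tfU] by (intro nn_integral_eq_integral[symmetric]) auto
    also have "\<dots> \<le> (\<integral>\<^sup>+x. ennreal ((1 + s)\<^sup>2) * ennreal ((norm (grad \<phi> (\<Psi> x)))\<^sup>2) \<partial>lborel)"
    proof (rule nn_integral_mono)
      fix x
      have "(norm (grad (\<lambda>x. \<phi> (\<Psi> x)) x))\<^sup>2 \<le> ((1 + s) * norm (grad \<phi> (\<Psi> x)))\<^sup>2" by (intro power_mono gr) simp
      then show "ennreal ((norm (grad (\<lambda>x. \<phi> (\<Psi> x)) x))\<^sup>2) \<le> ennreal ((1 + s)\<^sup>2) * ennreal ((norm (grad \<phi> (\<Psi> x)))\<^sup>2)"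
        by (simp add: power_mult_distrib ennreal_leI flip: ennreal_mult)
    qed
    also have "\<dots> = ennreal ((1 + s)\<^sup>2) * (\<integral>\<^sup>+x. ennreal ((norm (grad \<phi> (\<Psi> x)))\<^sup>2) \<partial>lborel)"
    proof (rule nn_integral_cmult)
      have "continuous_on UNIV (\<lambda>x. (norm (grad \<phi> (\<Psi> x)))\<^sup>2)" by (rule continuous_on_compose2[OF cg \<Psi>cont]) simp
      then show "(\<lambda>x. ennreal ((norm (grad \<phi> (\<Psi> x)))\<^sup>2)) \<in> borel_measurable lborel"
        by (intro measurable_compose[OF _ measurable_ennreal]) (simp add: borel_measurable_continuous_onI)
    qed
    also have "\<dots> \<le> ennreal ((1 + s)\<^sup>2) * ennreal ((1 / (1 - s)) ^ ?n * dirichlet_integral \<phi>)"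
      by (intro mult_left_mono nn) simp
    also have "\<dots> = ennreal ((1 + s)\<^sup>2 * ((1 / (1 - s)) ^ ?n * dirichlet_integral \<phi>))"
      using s by (intro ennreal_mult[symmetric]) auto
    finally have "dirichlet_integral (\<lambda>x. \<phi> (\<Psi> x)) \<le> ((1 + s)\<^sup>2 * (1 / (1 - s)) ^ ?n) * dirichlet_integral \<phi>"
      using s by (subst (asm) ennreal_le_iff) (auto simp: mult.assoc)
    also have "\<dots> \<le> (1 + L' * t) * dirichlet_integral \<phi>"
      using power_perturbation(1)[OF s(1,2) n1] unfolding e1 by (intro mult_right_mono) auto
    finally show ?thesis using m tf unfolding \<Psi>_def W_def by blast
  qed
  ultimately show ?thesis by blast
qed

end

section \<open>Semidefinite forms\<close>

text \<open>
  Gaussian elimination. All dimension counts below rest on this fact about coefficients, since the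
  function spaces in question carry their linear algebra only modulo null functions.
\<close>

lemma homogeneous_system_nontrivial:
  fixes a :: "'i \<Rightarrow> 'j \<Rightarrow> real"
  assumes "finite J" "finite I" "card J < card I"
  shows "\<exists>c. (\<exists>i\<in>I. c i \<noteq> 0) \<and> (\<forall>j\<in>J. (\<Sum>i\<in>I. c i * a i j) = 0)"
  using assms
proof (induction J arbitrary: I a rule: finite_induct)
  case empty
  then obtain i where "i \<in> I" by (metis card.empty less_irrefl equals0I)
  then show ?case by (intro exI[of _ "\<lambda>_. 1"]) auto
next
  case (insert j J)
  show ?case
  proof (cases "\<forall>i\<in>I. a i j = 0")
    case True
    have "card J < card I" using insert by auto
    then obtain c where c: "\<exists>i\<in>I. c i \<noteq> 0" "\<forall>j\<in>J. (\<Sum>i\<in>I. c i * a i j) = 0"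
      using insert.IH insert.prems by blast
    then show ?thesis using True by (intro exI[of _ c]) auto
  next
    case False
    then obtain p where p: "p \<in> I" "a p j \<noteq> 0" by auto
    define a' where "a' = (\<lambda>i k. a i k - a i j / a p j * a p k)"
    have "card J < card (I - {p})" using insert p by auto
    then obtain c where c: "\<exists>i\<in>I-{p}. c i \<noteq> 0" "\<forall>k\<in>J. (\<Sum>i\<in>I-{p}. c i * a' i k) = 0"
      using insert.IH[of "I-{p}" a'] insert.prems by auto
    define s where "s = - (\<Sum>i\<in>I-{p}. c i * a i j) / a p j"
    define c' where "c' = c(p := s)"
    have split: "(\<Sum>i\<in>I. c' i * a i k) = s * a p k + (\<Sum>i\<in>I-{p}. c i * a i k)" for k
      by (subst sum.remove[OF insert.prems(1) p(1)]) (auto simp: c'_def intro!: sum.cong)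
    have j: "(\<Sum>i\<in>I. c' i * a i j) = 0" unfolding split s_def using p by simp
    have "(\<Sum>i\<in>I. c' i * a i k) = 0" if "k \<in> J" for k
    proof -
      have "0 = (\<Sum>i\<in>I-{p}. c i * a' i k)" using c that by simp
      also have "\<dots> = (\<Sum>i\<in>I-{p}. c i * a i k) - (\<Sum>i\<in>I-{p}. c i * a i j) / a p j * a p k"
        by (simp add: a'_def algebra_simps sum_subtractf sum_distrib_left sum_divide_distrib)
      finally show ?thesis unfolding split s_def by simp
    qed
    moreover have "\<exists>i\<in>I. c' i \<noteq> 0" using c(1) by (auto simp: c'_def)
    ultimately show ?thesis using j by (intro exI[of _ c']) auto
  qed
qed

text \<open>
  Sobolev functions will be represented by functions rather than by classes modulo null sets. Hence
  forms are only semidefinite, and they are bilinear only on the subspace on which products are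
  integrable.
\<close>

locale psd_form =
  fixes S :: "'v::real_vector set" and F :: "'v \<Rightarrow> 'v \<Rightarrow> real"
  assumes subspace_S: "subspace S"
    and add_left: "\<And>p q r. p \<in> S \<Longrightarrow> q \<in> S \<Longrightarrow> r \<in> S \<Longrightarrow> F (p + q) r = F p r + F q r"
    and scale_left: "\<And>c p q. p \<in> S \<Longrightarrow> q \<in> S \<Longrightarrow> F (c *\<^sub>R p) q = c * F p q"
    and sym: "\<And>p q. p \<in> S \<Longrightarrow> q \<in> S \<Longrightarrow> F p q = F q p"
    and nonneg: "\<And>p. p \<in> S \<Longrightarrow> 0 \<le> F p p"
begin

lemmas S_closed [simp, intro] =
  subspace_add[OF subspace_S] subspace_diff[OF subspace_S] subspace_scale[OF subspace_S]
  subspace_0[OF subspace_S]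

lemma S_sum [simp, intro]: "(\<And>i. i \<in> I \<Longrightarrow> f i \<in> S) \<Longrightarrow> (\<Sum>i\<in>I. f i) \<in> S"
  by (rule subspace_sum[OF subspace_S])

lemma add_right: "p \<in> S \<Longrightarrow> q \<in> S \<Longrightarrow> r \<in> S \<Longrightarrow> F r (p + q) = F r p + F r q"
  using add_left[of p q r] sym by simp

lemma scale_right: "p \<in> S \<Longrightarrow> q \<in> S \<Longrightarrow> F q (c *\<^sub>R p) = c * F q p"
  using scale_left[of p q c] sym by simp

lemma diff_left: "p \<in> S \<Longrightarrow> q \<in> S \<Longrightarrow> r \<in> S \<Longrightarrow> F (p - q) r = F p r - F q r"
  using add_left[of p "(-1) *\<^sub>R q" r] scale_left[of q r "-1"] S_closed(3)[of q "-1"] by simp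

lemma diff_right: "p \<in> S \<Longrightarrow> q \<in> S \<Longrightarrow> r \<in> S \<Longrightarrow> F r (p - q) = F r p - F r q"
  using diff_left[of p q r] sym by simp

lemma zero_left: "q \<in> S \<Longrightarrow> F 0 q = 0"
  using scale_left[of 0 q 0] by simp

lemma sum_left:
  assumes "finite I" "\<And>i. i \<in> I \<Longrightarrow> f i \<in> S" "q \<in> S"
  shows "F (\<Sum>i\<in>I. c i *\<^sub>R f i) q = (\<Sum>i\<in>I. c i * F (f i) q)"
  using assms by (induction I rule: finite_induct) (auto simp: zero_left add_left scale_left)

lemma sum_right:
  assumes "finite I" "\<And>i. i \<in> I \<Longrightarrow> f i \<in> S" "q \<in> S"
  shows "F q (\<Sum>i\<in>I. c i *\<^sub>R f i) = (\<Sum>i\<in>I. c i * F q (f i))"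
proof -
  have "F q (\<Sum>i\<in>I. c i *\<^sub>R f i) = F (\<Sum>i\<in>I. c i *\<^sub>R f i) q"
    using assms by (intro sym) auto
  also have "\<dots> = (\<Sum>i\<in>I. c i * F (f i) q)"
    using assms by (rule sum_left)
  finally show ?thesis using assms sym by (auto intro!: sum.cong)
qed

lemma expand_add: "p \<in> S \<Longrightarrow> q \<in> S \<Longrightarrow> F (p + q) (p + q) = F p p + 2 * F p q + F q q"
  using sym[of p q] by (simp add: add_left add_right)

lemma expand_diff: "p \<in> S \<Longrightarrow> q \<in> S \<Longrightarrow> F (p - q) (p - q) = F p p - 2 * F p q + F q q"
  using sym[of p q] by (simp add: diff_left diff_right)

lemma Cauchy_Schwarz: "p \<in> S \<Longrightarrow> q \<in> S \<Longrightarrow> (F p q)\<^sup>2 \<le> F p p * F q q"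
proof -
  assume S: "p \<in> S" "q \<in> S"
  have *: "0 \<le> F p p + 2 * (t * F p q) + t\<^sup>2 * F q q" for t
    using nonneg[of "p + t *\<^sub>R q"] S
    by (simp add: expand_add scale_right scale_left power2_eq_square algebra_simps)
  show ?thesis
  proof (cases "F q q = 0")
    case True
    have "F p q = 0"
    proof (rule ccontr)
      assume ne: "F p q \<noteq> 0"
      show False using *[of "- (F p p + 1) / (2 * F p q)"] ne True nonneg[OF S(1)]
        by (simp add: field_simps)
    qed
    then show ?thesis using True by simp
  next
    case False
    then have pos: "F q q > 0" using nonneg[OF S(2)] by simp
    have "0 \<le> F p p - (F p q)\<^sup>2 / F q q"
      using *[of "- F p q / F q q"] pos by (simp add: field_simps power2_eq_square)
    then show ?thesis using pos by (simp add: field_simps)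
  qed
qed

lemma null_orthogonal: "p \<in> S \<Longrightarrow> q \<in> S \<Longrightarrow> F p p = 0 \<Longrightarrow> F p q = 0"
  using Cauchy_Schwarz[of p q] by simp

lemma diff_le: "p \<in> S \<Longrightarrow> q \<in> S \<Longrightarrow> F (p - q) (p - q) \<le> 2 * F p p + 2 * F q q"
  using nonneg[of "p + q"] by (simp add: expand_diff expand_add)

lemma add_le: "p \<in> S \<Longrightarrow> q \<in> S \<Longrightarrow> F (p + q) (p + q) \<le> 2 * F p p + 2 * F q q"
  using nonneg[of "p - q"] by (simp add: expand_diff expand_add)

lemma form_tendsto_0:
  assumes "\<And>n. X n \<in> S" "\<And>n. Y n \<in> S"
    and "(\<lambda>n. F (X n) (X n)) \<longlonglongrightarrow> 0" "(\<lambda>n. F (Y n) (Y n)) \<longlonglongrightarrow> L"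
  shows "(\<lambda>n. F (X n) (Y n)) \<longlonglongrightarrow> 0"
proof -
  have "(\<lambda>n. F (X n) (X n) * F (Y n) (Y n)) \<longlonglongrightarrow> 0 * L"
    by (intro tendsto_mult assms)
  then have "(\<lambda>n. F (X n) (X n) * F (Y n) (Y n)) \<longlonglongrightarrow> 0" by simp
  then have "(\<lambda>n. (F (X n) (Y n))\<^sup>2) \<longlonglongrightarrow> 0"
    by (rule Lim_null_comparison[rotated]) (use assms(1,2) Cauchy_Schwarz in \<open>auto intro!: always_eventually\<close>)
  from tendsto_real_sqrt[OF this] show ?thesis by (simp add: tendsto_rabs_zero_iff)
qed

lemma form_tendsto:
  assumes X: "\<And>n. X n \<in> S" "x \<in> S" "(\<lambda>n. F (X n - x) (X n - x)) \<longlonglongrightarrow> 0"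
    and Y: "\<And>n. Y n \<in> S" "y \<in> S" "(\<lambda>n. F (Y n - y) (Y n - y)) \<longlonglongrightarrow> 0"
  shows "(\<lambda>n. F (X n) (Y n)) \<longlonglongrightarrow> F x y"
proof -
  have "(\<lambda>n. F (X n - x) (Y n - y)) \<longlonglongrightarrow> 0"
    using X(1,2) Y(1,2) by (intro form_tendsto_0[where X="\<lambda>n. X n - x" and Y="\<lambda>n. Y n - y", OF _ _ X(3) Y(3)] S_closed)
  moreover have "(\<lambda>n. F (X n - x) y) \<longlonglongrightarrow> 0"
    using X(1,2) Y(2) by (intro form_tendsto_0[where X="\<lambda>n. X n - x" and Y="\<lambda>n. y", OF _ _ X(3) tendsto_const] S_closed)
  moreover have "(\<lambda>n. F (Y n - y) x) \<longlonglongrightarrow> 0"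
    using X(2) Y(1,2) by (intro form_tendsto_0[where X="\<lambda>n. Y n - y" and Y="\<lambda>n. x", OF _ _ Y(3) tendsto_const] S_closed)
  ultimately have "(\<lambda>n. F (X n - x) (Y n - y) + F (X n - x) y + F (Y n - y) x + F x y) \<longlonglongrightarrow> 0 + 0 + 0 + F x y"
    by (intro tendsto_add tendsto_const)
  moreover have "F (X n - x) (Y n - y) + F (X n - x) y + F (Y n - y) x + F x y = F (X n) (Y n)" for n
    using X(1)[of n] X(2) Y(1)[of n] Y(2) sym[of x "Y n"] sym[of y x] by (simp add: diff_left diff_right)
  ultimately show ?thesis by simp
qed

end

lemma bounded_sequences_common_subsequence:
  fixes a :: "nat \<Rightarrow> nat \<Rightarrow> real"
  assumes "\<And>i. i < k \<Longrightarrow> \<exists>K. \<forall>n. \<bar>a i n\<bar> \<le> K"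
  shows "\<exists>r. strict_mono (r :: nat \<Rightarrow> nat) \<and> (\<forall>i<k. convergent (\<lambda>n. a i (r n)))"
  using assms
proof (induction k)
  case 0
  show ?case by (intro exI[of _ id]) (auto simp: strict_mono_def)
next
  case (Suc k)
  have "\<exists>r. strict_mono (r :: nat \<Rightarrow> nat) \<and> (\<forall>i<k. convergent (\<lambda>n. a i (r n)))"
    by (rule Suc.IH) (rule Suc.prems, simp)
  then obtain r where r: "strict_mono r" "\<forall>i<k. convergent (\<lambda>n. a i (r n))" by blast
  obtain K where K: "\<forall>n. \<bar>a k n\<bar> \<le> K" using Suc.prems[of k] by blast
  have "bounded (range (\<lambda>n. a k (r n)))" by (rule boundedI[of _ K]) (use K in auto)
  then obtain l s where s: "strict_mono s" "((\<lambda>n. a k (r n)) \<circ> s) \<longlonglongrightarrow> l"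
    using bounded_imp_convergent_subsequence[of "\<lambda>n. a k (r n)"] by blast
  have "convergent (\<lambda>n. a i (r (s n)))" if "i < Suc k" for i
  proof (cases "i = k")
    case True
    from s(2) show ?thesis unfolding convergent_def True o_def by blast
  next
    case False
    then have "convergent (\<lambda>n. a i (r n))" using r that by auto
    from convergent_subseq_convergent[OF this s(1)] show ?thesis unfolding o_def .
  qed
  moreover have "strict_mono (\<lambda>n. r (s n))" using strict_mono_o[OF r(1) s(1)] unfolding o_def .
  ultimately show ?case by blast
qed

section \<open>Pairs of forms and their eigenvectors\<close>

text \<open>
  The model is \<open>A\<close> the Dirichlet form and \<open>B\<close> the inner product of $L^2$ on \<open>S\<close> the space $H_0^1$.
  Compactness of the embedding enters as \<open>finite_defect\<close>: up to finitely many bounded functionals,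
  \<open>B\<close> is small relative to \<open>A\<close>.
\<close>

locale form_pair = A: psd_form S A + B: psd_form S B
  for S :: "'v::real_vector set" and A B :: "'v \<Rightarrow> 'v \<Rightarrow> real" +
  assumes B_null: "\<And>p. p \<in> S \<Longrightarrow> B p p = 0 \<Longrightarrow> A p p = 0"
    and finite_defect: "\<And>\<epsilon>. \<epsilon> > 0 \<Longrightarrow> \<exists>(k::nat) l K.
        (\<forall>i<k. (\<forall>p\<in>S. \<forall>q\<in>S. l i (p + q) = l i p + l i q) \<and>
               (\<forall>c. \<forall>p\<in>S. l i (c *\<^sub>R p) = c * l i p) \<and>
               (\<forall>p\<in>S. (l i p)\<^sup>2 \<le> K * (A p p + B p p))) \<and>
        (\<forall>p\<in>S. B p p \<le> \<epsilon> * A p p + (\<Sum>i<k. (l i p)\<^sup>2))"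
    and complete: "\<And>X. (\<And>n. X n \<in> S) \<Longrightarrow>
        (\<And>e. e > 0 \<Longrightarrow> \<exists>N. \<forall>m\<ge>N. \<forall>n\<ge>N. A (X m - X n) (X m - X n) + B (X m - X n) (X m - X n) < e) \<Longrightarrow>
        \<exists>p\<in>S. (\<lambda>n. A (X n - p) (X n - p) + B (X n - p) (X n - p)) \<longlonglongrightarrow> 0"
begin

definition eigen :: "real \<Rightarrow> 'v set" where
  "eigen \<mu> = {p\<in>S. \<forall>q\<in>S. A p q = \<mu> * B p q}"

definition eigensystem :: "'i set \<Rightarrow> ('i \<Rightarrow> 'v) \<Rightarrow> ('i \<Rightarrow> real) \<Rightarrow> bool" where
  "eigensystem I e \<nu> \<longleftrightarrow> finite I \<and> (\<forall>i\<in>I. e i \<in> eigen (\<nu> i)) \<and>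
     (\<forall>i\<in>I. \<forall>j\<in>I. B (e i) (e j) = of_bool (i = j))"

text \<open>
  The last condition says that no further eigenvalues below \<open>\<kappa>\<close> can be found by minimising the
  Rayleigh quotient. The cardinality of \<open>I\<close> is then the number of eigenvalues below \<open>\<kappa>\<close>,
  counted with multiplicity.
\<close>

definition complete_below :: "real \<Rightarrow> 'i set \<Rightarrow> ('i \<Rightarrow> 'v) \<Rightarrow> ('i \<Rightarrow> real) \<Rightarrow> bool" where
  "complete_below \<kappa> I e \<nu> \<longleftrightarrow> eigensystem I e \<nu> \<and> (\<forall>i\<in>I. \<nu> i < \<kappa>) \<and>
     (\<forall>p\<in>S. (\<forall>i\<in>I. B p (e i) = 0) \<longrightarrow> \<kappa> * B p p \<le> A p p)"

text \<open>
  The strict inequality contains linear independence, also modulo null vectors.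
\<close>

definition negative_family :: "real \<Rightarrow> 'i set \<Rightarrow> ('i \<Rightarrow> 'v) \<Rightarrow> bool" where
  "negative_family \<kappa> I f \<longleftrightarrow> finite I \<and> (\<forall>i\<in>I. f i \<in> S) \<and>
     (\<forall>c. (\<exists>i\<in>I. c i \<noteq> 0) \<longrightarrow>
        A (\<Sum>i\<in>I. c i *\<^sub>R f i) (\<Sum>i\<in>I. c i *\<^sub>R f i)
          < \<kappa> * B (\<Sum>i\<in>I. c i *\<^sub>R f i) (\<Sum>i\<in>I. c i *\<^sub>R f i))"

lemma eigen_in_S: "p \<in> eigen \<mu> \<Longrightarrow> p \<in> S"
  by (simp add: eigen_def)

lemma subspace_eigen: "subspace (eigen \<mu>)"
  by (rule subspaceI)
     (auto simp: eigen_def A.zero_left B.zero_left A.add_left B.add_left A.scale_left B.scale_left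
       algebra_simps)

lemma eigen_orthogonal:
  assumes "p \<in> eigen \<mu>" "q \<in> eigen \<nu>" "\<mu> \<noteq> \<nu>"
  shows "B p q = 0"
proof -
  have "A p q = \<mu> * B p q" "A q p = \<nu> * B q p" "p \<in> S" "q \<in> S" using assms by (auto simp: eigen_def)
  then have "\<mu> * B p q = \<nu> * B p q" using A.sym B.sym by metis
  then show ?thesis using assms(3) by simp
qed

lemma eigensystem_subset: "eigensystem I e \<nu> \<Longrightarrow> I' \<subseteq> I \<Longrightarrow> eigensystem I' e \<nu>"
  by (auto simp: eigensystem_def subset_iff intro: finite_subset)

lemma eigensystem_in_S: "eigensystem I e \<nu> \<Longrightarrow> i \<in> I \<Longrightarrow> e i \<in> S"
  by (auto simp: eigensystem_def eigen_def)

lemma eigensystem_finite: "eigensystem I e \<nu> \<Longrightarrow> finite I"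
  by (simp add: eigensystem_def)

lemma eigensystem_sum_B:
  assumes "eigensystem I e \<nu>"
  shows "B (\<Sum>i\<in>I. c i *\<^sub>R e i) (\<Sum>i\<in>I. c i *\<^sub>R e i) = (\<Sum>i\<in>I. (c i)\<^sup>2)"
proof -
  note f = eigensystem_finite[OF assms(1)] eigensystem_in_S[OF assms(1)]
  have "B (\<Sum>i\<in>I. c i *\<^sub>R e i) (\<Sum>i\<in>I. c i *\<^sub>R e i) = (\<Sum>i\<in>I. c i * (\<Sum>j\<in>I. c j * B (e i) (e j)))"
    using f by (subst B.sum_left) (auto intro!: sum.cong simp: B.sum_right)
  also have "\<dots> = (\<Sum>i\<in>I. c i * (\<Sum>j\<in>I. if i = j then c j else 0))"
    using assms by (intro sum.cong refl arg_cong2[where f="(*)"]) (auto simp: eigensystem_def)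
  also have "\<dots> = (\<Sum>i\<in>I. (c i)\<^sup>2)"
    using f by (simp add: sum.delta power2_eq_square)
  finally show ?thesis .
qed

lemma eigensystem_sum_A_left:
  assumes "eigensystem I e \<nu>" "q \<in> S"
  shows "A (\<Sum>i\<in>I. c i *\<^sub>R e i) q = (\<Sum>i\<in>I. c i * \<nu> i * B (e i) q)"
proof -
  note f = eigensystem_finite[OF assms(1)] eigensystem_in_S[OF assms(1)]
  then show ?thesis using assms by (auto simp: A.sum_left eigensystem_def eigen_def intro!: sum.cong)
qed

lemma eigensystem_B_basis:
  assumes "eigensystem I e \<nu>" "j \<in> I"
  shows "B (e j) (\<Sum>i\<in>I. c i *\<^sub>R e i) = c j" "B (\<Sum>i\<in>I. c i *\<^sub>R e i) (e j) = c j"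
proof -
  note f = eigensystem_finite[OF assms(1)] eigensystem_in_S[OF assms(1)]
  have "B (e j) (\<Sum>i\<in>I. c i *\<^sub>R e i) = (\<Sum>i\<in>I. if j = i then c i else 0)"
    using assms f by (subst B.sum_right) (auto simp: eigensystem_def intro!: sum.cong)
  also have "\<dots> = c j" using f assms by simp
  finally show 1: "B (e j) (\<Sum>i\<in>I. c i *\<^sub>R e i) = c j" .
  have "(\<Sum>i\<in>I. c i *\<^sub>R e i) \<in> S" using f by auto
  then show "B (\<Sum>i\<in>I. c i *\<^sub>R e i) (e j) = c j"
    using 1 B.sym f(2)[OF assms(2)] by simp
qed

lemma eigensystem_sum_A:
  assumes "eigensystem I e \<nu>"
  shows "A (\<Sum>i\<in>I. c i *\<^sub>R e i) (\<Sum>i\<in>I. c i *\<^sub>R e i) = (\<Sum>i\<in>I. \<nu> i * (c i)\<^sup>2)"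
proof -
  note f = eigensystem_finite[OF assms(1)] eigensystem_in_S[OF assms(1)]
  show ?thesis using f
    by (subst eigensystem_sum_A_left[OF assms])
       (auto simp: eigensystem_B_basis[OF assms] power2_eq_square algebra_simps intro!: sum.cong)
qed

lemma eigensystem_residual:
  assumes "eigensystem I e \<nu>" "p \<in> S" "j \<in> I"
  shows "B (p - (\<Sum>i\<in>I. B p (e i) *\<^sub>R e i)) (e j) = 0"
proof -
  note f = eigensystem_finite[OF assms(1)] eigensystem_in_S[OF assms(1)]
  have "(\<Sum>i\<in>I. B p (e i) *\<^sub>R e i) \<in> S" using f by auto
  then show ?thesis using f assms by (simp add: B.diff_left eigensystem_B_basis(2)[OF assms(1,3)])
qed

lemma eigensystem_negative_family:
  assumes "eigensystem I e \<nu>" "\<forall>i\<in>I. \<nu> i < \<kappa>"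
  shows "negative_family \<kappa> I e"
proof -
  note f = eigensystem_finite[OF assms(1)] eigensystem_in_S[OF assms(1)]
  have "(\<Sum>i\<in>I. \<nu> i * (c i)\<^sup>2) < \<kappa> * (\<Sum>i\<in>I. (c i)\<^sup>2)" if "j \<in> I" "c j \<noteq> 0" for c :: "_ \<Rightarrow> real" and j
    unfolding sum_distrib_left
    by (rule sum_strict_mono_ex1) (use assms that f in \<open>auto intro!: mult_right_mono bexI[of _ j] simp: less_imp_le\<close>)
  then show ?thesis
    unfolding negative_family_def eigensystem_sum_A[OF assms(1)] eigensystem_sum_B[OF assms(1)]
    using f by blast
qed

text \<open>
  If there are more vectors than functionals in \<open>finite_defect\<close>, then a nontrivial combination is
  annihilated by all of them. For it \<open>(\<bar>\<kappa>\<bar> + 1) * B p p \<le> A p p\<close>, which contradicts negativity.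
\<close>

lemma negative_family_bounded:
  "\<exists>k. \<forall>I f. negative_family \<kappa> (I :: 'i set) f \<longrightarrow> card I \<le> k"
proof -
  have "1 / (\<bar>\<kappa>\<bar> + 1) > 0" by simp
  from finite_defect[OF this] obtain k l K where
    l: "\<forall>i<k. (\<forall>p\<in>S. \<forall>q\<in>S. l i (p + q) = l i p + l i q) \<and> (\<forall>c. \<forall>p\<in>S. l i (c *\<^sub>R p) = c * l i p)
       \<and> (\<forall>p\<in>S. (l i p)\<^sup>2 \<le> K * (A p p + B p p))"
    and est: "\<forall>p\<in>S. B p p \<le> 1 / (\<bar>\<kappa>\<bar> + 1) * A p p + (\<Sum>i<(k::nat). (l i p)\<^sup>2)" by blast
  have "card I \<le> k" if neg: "negative_family \<kappa> I f" for I :: "'i set" and f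
  proof (rule ccontr)
    assume "\<not> card I \<le> k"
    then obtain c where c: "\<exists>i\<in>I. c i \<noteq> 0" "\<forall>j\<in>{..<k}. (\<Sum>i\<in>I. c i * l j (f i)) = 0"
      using homogeneous_system_nontrivial[of "{..<k}" I "\<lambda>i j. l j (f i)"] neg
      by (auto simp: negative_family_def)
    have f: "finite I" "\<And>i. i \<in> I \<Longrightarrow> f i \<in> S" using neg by (auto simp: negative_family_def)
    define p where "p = (\<Sum>i\<in>I. c i *\<^sub>R f i)"
    have pS: "p \<in> S" using f by (auto simp: p_def)
    have "l j p = (\<Sum>i\<in>I. c i * l j (f i))" if "j < k" for j
      unfolding p_def using f
    proof (induction I rule: finite_induct)
      case empty
      have "l j (0 *\<^sub>R 0) = 0 * l j 0" using l that by (metis A.S_closed(4))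
      then show ?case by simp
    next
      case (insert i I)
      have "l j (c i *\<^sub>R f i + (\<Sum>i\<in>I. c i *\<^sub>R f i)) = l j (c i *\<^sub>R f i) + l j (\<Sum>i\<in>I. c i *\<^sub>R f i)"
        using l that insert.prems by (metis (no_types, lifting) A.S_closed(3) A.S_sum insertCI)
      then show ?case using insert l that by simp
    qed
    then have "l j p = 0" if "j < k" for j using c that by simp
    then have "B p p \<le> 1 / (\<bar>\<kappa>\<bar> + 1) * A p p" using est pS by auto
    then have 1: "(\<bar>\<kappa>\<bar> + 1) * B p p \<le> A p p" by (simp add: field_simps)
    have 2: "A p p < \<kappa> * B p p" using neg c(1) unfolding p_def by (auto simp: negative_family_def)
    have "\<kappa> * B p p \<le> \<bar>\<kappa>\<bar> * B p p" using B.nonneg[OF pS] by (intro mult_right_mono) auto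
    then show False using 1 2 B.nonneg[OF pS] by (simp add: algebra_simps)
  qed
  then show ?thesis by blast
qed

section \<open>Existence and variational characterisation of eigenvalues\<close>

text \<open>
  Let \<open>\<mu>\<close> be the infimum of the Rayleigh quotient on \<open>W\<close>. The form \<open>Q = A - \<mu> * B\<close> is semidefinite on
  \<open>W\<close> and tends to zero along a minimising sequence, hence also on its differences. In \<open>finite_defect\<close>
  take \<open>\<epsilon> * \<mu> \<le> 1/2\<close> and pass to a subsequence along which the finitely many functionals converge. Then
  \<open>B\<close> is bounded on differences by \<open>Q\<close> and the functionals, and so is \<open>A = \<mu> * B + Q\<close>. Thus the
  subsequence is a Cauchy sequence, its limit is a minimiser, and the Cauchy--Schwarz inequality for
  \<open>Q\<close> turns minimality into the eigenvalue equation tested on \<open>W\<close>.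
\<close>

lemma rayleigh_minimiser:
  fixes e :: "'i \<Rightarrow> 'v"
  assumes e: "\<And>i. i \<in> I \<Longrightarrow> e i \<in> S"
  defines "W \<equiv> {p\<in>S. \<forall>i\<in>I. B p (e i) = 0}"
  assumes ex: "p\<^sub>0 \<in> W" "A p\<^sub>0 p\<^sub>0 < \<kappa> * B p\<^sub>0 p\<^sub>0"
  shows "\<exists>p\<in>W. \<exists>\<mu><\<kappa>. B p p = 1 \<and> (\<forall>q\<in>W. A p q = \<mu> * B p q)"
proof -
  have WS: "W \<subseteq> S" by (auto simp: W_def)
  have subW: "subspace W"
    by (rule subspaceI) (use e in \<open>auto simp: W_def B.zero_left B.add_left B.scale_left\<close>)
  have normalise: "\<exists>r\<in>W. B r r = 1 \<and> A r r = A p p / B p p" if "p \<in> W" "B p p > 0" for p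
  proof -
    define r where "r = (1 / sqrt (B p p)) *\<^sub>R p"
    have pS: "p \<in> S" using that WS by auto
    have "r \<in> W" using that subW by (simp add: r_def subspace_scale)
    moreover have "B r r = 1" "A r r = A p p / B p p"
      using that(2) pS by (auto simp: r_def B.scale_left B.scale_right A.scale_left A.scale_right)
    ultimately show ?thesis by blast
  qed
  have p0S: "p\<^sub>0 \<in> S" using ex WS by auto
  have B0: "B p\<^sub>0 p\<^sub>0 > 0"
    using ex(2) B.nonneg[OF p0S] B_null[OF p0S] A.nonneg[OF p0S] by (cases "B p\<^sub>0 p\<^sub>0 = 0") auto
  define R where "R = {A p p | p. p \<in> W \<and> B p p = 1}"
  define \<mu> where "\<mu> = Inf R"
  obtain r0 where r0: "r0 \<in> W" "B r0 r0 = 1" "A r0 r0 = A p\<^sub>0 p\<^sub>0 / B p\<^sub>0 p\<^sub>0" using normalise[OF ex(1) B0] by blast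
  have bdd: "bdd_below R" using WS A.nonneg by (auto simp: R_def intro!: bdd_belowI[of _ 0])
  have neR: "R \<noteq> {}" using r0 by (auto simp: R_def)
  have "A p\<^sub>0 p\<^sub>0 / B p\<^sub>0 p\<^sub>0 < \<kappa>" using ex(2) B0 by (simp add: field_simps)
  moreover have "\<mu> \<le> A r0 r0" unfolding \<mu>_def by (intro cInf_lower bdd) (use r0 in \<open>force simp: R_def\<close>)
  ultimately have \<mu>\<kappa>: "\<mu> < \<kappa>" using r0 by simp
  have \<mu>0: "0 \<le> \<mu>" unfolding \<mu>_def using neR WS A.nonneg by (intro cInf_greatest) (auto simp: R_def)
  define Q where "Q = (\<lambda>p q. A p q - \<mu> * B p q)"
  have Qnn: "0 \<le> Q p p" if "p \<in> W" for p
  proof (cases "B p p = 0")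
    case True then show ?thesis using B_null that WS by (auto simp: Q_def)
  next
    case False
    then have "B p p > 0" using B.nonneg[of p] that WS by force
    with normalise[OF that] obtain r where "r \<in> W" "B r r = 1" "A r r = A p p / B p p" by blast
    then have "A p p / B p p \<in> R" unfolding R_def by (intro CollectI exI[of _ r]) simp
    then have "\<mu> \<le> A p p / B p p" unfolding \<mu>_def by (intro cInf_lower bdd)
    then show ?thesis using \<open>B p p > 0\<close> by (simp add: Q_def field_simps)
  qed
  interpret Q: psd_form W Q
  proof
    show "subspace W" by (rule subW)
    show "Q (p + q) r = Q p r + Q q r" if "p \<in> W" "q \<in> W" "r \<in> W" for p q r
      using that WS by (simp add: Q_def A.add_left B.add_left subset_iff algebra_simps)
    show "Q (c *\<^sub>R p) q = c * Q p q" if "p \<in> W" "q \<in> W" for c p q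
      using that WS by (simp add: Q_def A.scale_left B.scale_left subset_iff right_diff_distrib)
    show "Q p q = Q q p" if "p \<in> W" "q \<in> W" for p q
      using that WS A.sym[of p q] B.sym[of p q] by (simp add: Q_def subset_iff)
    show "0 \<le> Q p p" if "p \<in> W" for p by (rule Qnn[OF that])
  qed
  have "\<exists>p. p \<in> W \<and> B p p = 1 \<and> A p p < \<mu> + 1 / real (Suc n)" for n
  proof -
    have "\<mu> < \<mu> + 1 / real (Suc n)" by simp
    then obtain y where "y \<in> R" "y < \<mu> + 1 / real (Suc n)" unfolding \<mu>_def using cInf_lessD[OF neR] by blast
    then show ?thesis by (auto simp: R_def)
  qed
  then obtain X where X: "\<And>n. X n \<in> W" "\<And>n. B (X n) (X n) = 1"
    "\<And>n. A (X n) (X n) < \<mu> + 1 / real (Suc n)" by metis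
  have XS: "X n \<in> S" for n using X WS by auto
  have QX: "Q (X n) (X n) < 1 / real (Suc n)" for n using X(2,3)[of n] by (simp add: Q_def)
  define \<epsilon> where "\<epsilon> = 1 / (2 * (\<mu> + 1))"
  have \<epsilon>: "\<epsilon> > 0" "\<epsilon> * \<mu> \<le> 1/2" "\<epsilon> \<le> 1/2" using \<mu>0 by (auto simp: \<epsilon>_def field_simps)
  from finite_defect[OF \<epsilon>(1)] obtain k l K where
    l: "\<forall>i<k. (\<forall>p\<in>S. \<forall>q\<in>S. l i (p + q) = l i p + l i q) \<and> (\<forall>c. \<forall>p\<in>S. l i (c *\<^sub>R p) = c * l i p)
       \<and> (\<forall>p\<in>S. (l i p)\<^sup>2 \<le> K * (A p p + B p p))"
    and est: "\<forall>p\<in>S. B p p \<le> \<epsilon> * A p p + (\<Sum>i<(k::nat). (l i p)\<^sup>2)" by blast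
  have ldiff: "l i (p - q) = l i p - l i q" if "i < k" "p \<in> S" "q \<in> S" for i p q
  proof -
    have "l i (p + (-1) *\<^sub>R q) = l i p + (-1) * l i q" using l that by (metis A.S_closed(3))
    then show ?thesis by simp
  qed
  have "\<exists>K. \<forall>n. \<bar>l i (X n)\<bar> \<le> K" if "i < k" for i
  proof (intro exI allI)
    fix n
    have "(l i (X n))\<^sup>2 \<le> K * (A (X n) (X n) + B (X n) (X n))" using l that XS by auto
    also have "\<dots> \<le> \<bar>K\<bar> * (\<mu> + 2)"
    proof (intro mult_mono)
      have "1 / real (Suc n) \<le> 1" by simp
      then show "A (X n) (X n) + B (X n) (X n) \<le> \<mu> + 2" using X(2,3)[of n] by linarith
    qed (use A.nonneg[OF XS] B.nonneg[OF XS] in auto)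
    finally have "sqrt ((l i (X n))\<^sup>2) \<le> sqrt (\<bar>K\<bar> * (\<mu> + 2))" by (rule real_sqrt_le_mono)
    then show "\<bar>l i (X n)\<bar> \<le> sqrt (\<bar>K\<bar> * (\<mu> + 2))" by simp
  qed
  from bounded_sequences_common_subsequence[of k "\<lambda>i n. l i (X n)", OF this]
  obtain r where r: "strict_mono r" "\<forall>i<k. convergent (\<lambda>n. l i (X (r n)))" by blast
  define Y where "Y = (\<lambda>n. X (r n))"
  have YW: "Y n \<in> W" and YS: "Y n \<in> S" and BY: "B (Y n) (Y n) = 1" for n using X XS by (auto simp: Y_def)
  have QY: "Q (Y n) (Y n) \<le> 1 / real (Suc n)" for n
  proof -
    have "Q (Y n) (Y n) < 1 / real (Suc (r n))" unfolding Y_def by (rule QX)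
    also have "\<dots> \<le> 1 / real (Suc n)" using seq_suble[OF r(1), of n] by (simp add: frac_le)
    finally show ?thesis by simp
  qed
  define D where "D = (\<lambda>m n. \<Sum>i<k. (l i (Y m) - l i (Y n))\<^sup>2)"
  have D0: "\<exists>N. \<forall>m\<ge>N. \<forall>n\<ge>N. D m n < e" if "e > 0" for e
  proof -
    have "\<exists>N. \<forall>m\<ge>N. \<forall>n\<ge>N. (l i (Y m) - l i (Y n))\<^sup>2 < e / (k + 1)" if "i < k" for i
    proof -
      have "Cauchy (\<lambda>n. l i (Y n))" using r(2) that by (auto simp: Y_def intro: convergent_Cauchy)
      then obtain N where N: "\<forall>m\<ge>N. \<forall>n\<ge>N. norm (l i (Y m) - l i (Y n)) < sqrt (e / (k + 1))"
        using \<open>e > 0\<close> unfolding Cauchy_iff by (metis divide_pos_pos of_nat_0_less_iff add_pos_nonneg zero_le zero_less_one real_sqrt_gt_0_iff add.commute of_nat_0_le_iff)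
      have "(l i (Y m) - l i (Y n))\<^sup>2 < e / (k + 1)" if "m \<ge> N" "n \<ge> N" for m n
      proof -
        have "\<bar>l i (Y m) - l i (Y n)\<bar>\<^sup>2 < (sqrt (e / (k + 1)))\<^sup>2"
          using N that by (intro power_strict_mono) auto
        then show ?thesis using \<open>e > 0\<close> by simp
      qed
      then show ?thesis by blast
    qed
    then obtain N where N: "\<And>i m n. i < k \<Longrightarrow> m \<ge> N i \<Longrightarrow> n \<ge> N i \<Longrightarrow> (l i (Y m) - l i (Y n))\<^sup>2 < e / (k + 1)"
      by metis
    have "D m n < e" if "m \<ge> (\<Sum>i<k. N i)" "n \<ge> (\<Sum>i<k. N i)" for m n
    proof -
      have "D m n \<le> (\<Sum>i<k. e / (k + 1))" unfolding D_def
      proof (intro sum_mono)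
        fix i assume i: "i \<in> {..<k}"
        have "N i \<le> (\<Sum>i<k. N i)" by (rule member_le_sum) (use i in auto)
        then show "(l i (Y m) - l i (Y n))\<^sup>2 \<le> e / (k + 1)"
          using N[of i m n] i that by (simp add: less_imp_le)
      qed
      also have "\<dots> < e" using \<open>e > 0\<close> by (simp add: field_simps)
      finally show ?thesis .
    qed
    then show ?thesis by blast
  qed
  have AB: "A (Y m - Y n) (Y m - Y n) + B (Y m - Y n) (Y m - Y n) \<le> (2 * \<mu> + 4) * (Q (Y m - Y n) (Y m - Y n) + D m n)" for m n
  proof -
    let ?q = "Y m - Y n"
    have q: "?q \<in> W" "?q \<in> S" using YW YS by auto
    have "(\<Sum>i<k. (l i ?q)\<^sup>2) = D m n" unfolding D_def using YS by (auto simp: ldiff)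
    then have "B ?q ?q \<le> \<epsilon> * A ?q ?q + D m n" using est q by metis
    also have "\<epsilon> * A ?q ?q = (\<epsilon> * \<mu>) * B ?q ?q + \<epsilon> * Q ?q ?q" by (simp add: Q_def algebra_simps)
    also have "(\<epsilon> * \<mu>) * B ?q ?q \<le> 1/2 * B ?q ?q" using \<epsilon> B.nonneg[OF q(2)] by (intro mult_right_mono) auto
    finally have "B ?q ?q \<le> 2 * (\<epsilon> * Q ?q ?q) + 2 * D m n" by simp
    moreover have "\<epsilon> * Q ?q ?q \<le> 1/2 * Q ?q ?q" using \<epsilon> Qnn[OF q(1)] by (intro mult_right_mono) auto
    ultimately have b: "B ?q ?q \<le> 2 * (Q ?q ?q + D m n)" using Qnn[OF q(1)] by argo
    have "A ?q ?q + B ?q ?q = (\<mu> + 1) * B ?q ?q + Q ?q ?q" by (simp add: Q_def algebra_simps)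
    also have "\<dots> \<le> (\<mu> + 1) * (2 * (Q ?q ?q + D m n)) + Q ?q ?q" using b \<mu>0 by (intro add_right_mono mult_left_mono) auto
    also have "\<dots> \<le> (2 * \<mu> + 4) * (Q ?q ?q + D m n)"
    proof -
      have "D m n \<ge> 0" by (simp add: D_def sum_nonneg)
      then show ?thesis using Qnn[OF q(1)] by (simp add: algebra_simps)
    qed
    finally show ?thesis .
  qed
  have "\<exists>N. \<forall>m\<ge>N. \<forall>n\<ge>N. A (Y m - Y n) (Y m - Y n) + B (Y m - Y n) (Y m - Y n) < d" if "d > 0" for d
  proof -
    define d' where "d' = d / (2 * (2 * \<mu> + 4))"
    have d': "d' > 0" using that \<mu>0 by (simp add: d'_def)
    obtain N where N: "\<forall>m\<ge>N. \<forall>n\<ge>N. D m n < d'" using D0[OF d'] by blast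
    obtain N' :: nat where N': "4 / d' < real N'" using reals_Archimedean2 by blast
    have "A (Y m - Y n) (Y m - Y n) + B (Y m - Y n) (Y m - Y n) < d" if mn: "m \<ge> max N N'" "n \<ge> max N N'" for m n
    proof -
      have small: "Q (Y j) (Y j) < d' / 4" if "j \<ge> N'" for j
      proof -
        have "1 / real (Suc j) < d' / 4" using N' that d' by (simp add: field_simps)
          (smt (verit) N' of_nat_le_iff that d' divide_less_eq mult.commute)
        then show ?thesis using QY[of j] by linarith
      qed
      have "Q (Y m - Y n) (Y m - Y n) < d'"
        using Q.diff_le[OF YW YW, of m n] small[of m] small[of n] mn by simp
      then have "Q (Y m - Y n) (Y m - Y n) + D m n < 2 * d'" using N mn by (metis max.bounded_iff add_strict_mono mult_2)
      then have "(2 * \<mu> + 4) * (Q (Y m - Y n) (Y m - Y n) + D m n) < (2 * \<mu> + 4) * (2 * d')"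
        using \<mu>0 by (intro mult_strict_left_mono) auto
      also have "\<dots> = d" using \<mu>0 by (simp add: d'_def field_simps)
      finally show ?thesis using AB[of m n] by linarith
    qed
    then show ?thesis by blast
  qed
  from complete[of Y, OF YS this] obtain p where p: "p \<in> S"
    "(\<lambda>n. A (Y n - p) (Y n - p) + B (Y n - p) (Y n - p)) \<longlonglongrightarrow> 0" by auto
  have cA: "(\<lambda>n. A (Y n - p) (Y n - p)) \<longlonglongrightarrow> 0" and cB: "(\<lambda>n. B (Y n - p) (Y n - p)) \<longlonglongrightarrow> 0"
    by (rule tendsto_sandwich[OF _ _ tendsto_const p(2)]; use A.nonneg B.nonneg YS p(1) in auto)+
  have "(\<lambda>n. B (Y n) (e i)) \<longlonglongrightarrow> B p (e i)" if "i \<in> I" for i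
    using B.form_tendsto[OF YS p(1) cB, of "\<lambda>_. e i" "e i"] e[OF that] by (simp add: B.zero_left)
  moreover have "B (Y n) (e i) = 0" if "i \<in> I" for i n using YW[of n] that by (simp add: W_def)
  ultimately have "B p (e i) = 0" if "i \<in> I" for i using that LIMSEQ_unique[OF _ tendsto_const, of 0 "B p (e i)"] by simp
  then have pW: "p \<in> W" using p by (simp add: W_def)
  have Bp: "B p p = 1" using B.form_tendsto[OF YS p(1) cB YS p(1) cB] BY by (simp add: LIMSEQ_const_iff)
  have "(\<lambda>n. Q (Y n) (Y n)) \<longlonglongrightarrow> Q p p"
    unfolding Q_def by (intro tendsto_intros A.form_tendsto B.form_tendsto YS p(1) cA cB)
  moreover have "(\<lambda>n. Q (Y n) (Y n)) \<longlonglongrightarrow> 0"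
  proof (rule tendsto_sandwich[OF _ _ tendsto_const])
    show "(\<lambda>n. 1 / real (Suc n)) \<longlonglongrightarrow> 0" using LIMSEQ_Suc[OF lim_1_over_n] by simp
  qed (use Qnn[OF YW] QY in auto)
  ultimately have "Q p p = 0" by (rule LIMSEQ_unique)
  then have "Q p q = 0" if "q \<in> W" for q using Q.null_orthogonal pW that by blast
  then have "\<forall>q\<in>W. A p q = \<mu> * B p q" by (simp add: Q_def)
  then show ?thesis using pW \<mu>\<kappa> Bp by blast
qed

text \<open>
  By \<open>negative_family_bounded\<close> there is an orthonormal system of eigenvectors of maximal size. It is
  complete, since otherwise the minimiser on its orthogonal complement would enlarge it.
\<close>

theorem complete_below_exists:
  "\<exists>(I::nat set) e \<nu>. complete_below \<kappa> I e \<nu>"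
proof -
  define P where "P = (\<lambda>n. \<exists>(I::nat set) e \<nu>. eigensystem I e \<nu> \<and> (\<forall>i\<in>I. \<nu> i < \<kappa>) \<and> card I = n)"
  obtain k where k: "\<And>(I::nat set) f. negative_family \<kappa> I f \<Longrightarrow> card I \<le> k"
    using negative_family_bounded by blast
  have "P 0" unfolding P_def by (rule exI[of _ "{}"]) (auto simp: eigensystem_def)
  moreover have "\<forall>n. P n \<longrightarrow> n \<le> k" unfolding P_def using k eigensystem_negative_family by blast
  moreover define n where "n = Max {n. P n}"
  moreover have "finite {n. P n}" using calculation(2) by (auto intro: finite_subset[of _ "{..k}"])
  ultimately have n: "P n" "\<And>m. P m \<Longrightarrow> m \<le> n"
    using Max_in[of "{n. P n}"] Max_ge[of "{n. P n}"] by auto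
  then obtain I :: "nat set" and e \<nu> where I: "eigensystem I e \<nu>" "\<forall>i\<in>I. \<nu> i < \<kappa>" "card I = n" by (auto simp: P_def)
  note f = eigensystem_finite[OF I(1)] eigensystem_in_S[OF I(1)]
  have "\<kappa> * B p p \<le> A p p" if p: "p \<in> S" "\<forall>i\<in>I. B p (e i) = 0" for p
  proof (rule ccontr)
    assume "\<not> \<kappa> * B p p \<le> A p p"
    then obtain q \<mu> where q: "q \<in> S" "\<forall>i\<in>I. B q (e i) = 0" "\<mu> < \<kappa>" "B q q = 1"
      "\<And>r. r \<in> S \<Longrightarrow> \<forall>i\<in>I. B r (e i) = 0 \<Longrightarrow> A q r = \<mu> * B q r"
      using rayleigh_minimiser[of I e p \<kappa>] f(2) p by auto
    have qe: "q \<in> eigen \<mu>"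
    proof -
      have "A q r = \<mu> * B q r" if r: "r \<in> S" for r
      proof -
        define s where "s = (\<Sum>i\<in>I. B r (e i) *\<^sub>R e i)"
        have sS: "s \<in> S" using f by (auto simp: s_def)
        have "A q (r - s) = \<mu> * B q (r - s)"
          using q(5)[of "r - s"] r sS eigensystem_residual[OF I(1) r] by (simp add: s_def)
        moreover have "A s q = 0" unfolding s_def using q(1,2) f B.sym
          by (subst eigensystem_sum_A_left[OF I(1)]) (auto intro!: sum.neutral)
        moreover have "B s q = 0" unfolding s_def using q(1,2) f B.sym
          by (subst B.sum_left) (auto intro!: sum.neutral)
        ultimately show ?thesis using q(1) r sS A.sym[of q s] B.sym[of q s]
          by (simp add: A.diff_right B.diff_right)
      qed
      then show ?thesis using q(1) by (simp add: eigen_def)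
    qed
    obtain j where j: "j \<notin> I" using f(1) ex_new_if_finite infinite_UNIV_nat by blast
    have "eigensystem (insert j I) (e(j := q)) (\<nu>(j := \<mu>))"
      using I(1) j qe q f(2) B.sym by (auto simp: eigensystem_def)
    moreover have "\<forall>i\<in>insert j I. (\<nu>(j := \<mu>)) i < \<kappa>" using I q by auto
    moreover have "card (insert j I) = Suc n" using I j f by simp
    ultimately have "P (Suc n)" unfolding P_def by blast
    then show False using n(2) by fastforce
  qed
  then show ?thesis unfolding complete_below_def using I by blast
qed

text \<open>
  A larger family would have a nontrivial combination orthogonal to the system, on which completeness
  and negativity contradict each other.
\<close>

theorem negative_family_card_le:
  assumes "complete_below \<kappa> I e \<nu>" "negative_family \<kappa> I' f"
  shows "card I' \<le> card I"
proof (rule ccontr)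
  have sys: "eigensystem I e \<nu>" using assms(1) by (simp add: complete_below_def)
  note I = eigensystem_finite[OF sys] eigensystem_in_S[OF sys]
  have f: "finite I'" "\<And>i. i \<in> I' \<Longrightarrow> f i \<in> S" using assms by (auto simp: negative_family_def)
  assume "\<not> card I' \<le> card I"
  then obtain c where c: "\<exists>i\<in>I'. c i \<noteq> 0" "\<forall>j\<in>I. (\<Sum>i\<in>I'. c i * B (f i) (e j)) = 0"
    using homogeneous_system_nontrivial[of I I' "\<lambda>i j. B (f i) (e j)"] I f by auto
  define p where "p = (\<Sum>i\<in>I'. c i *\<^sub>R f i)"
  have "p \<in> S" using f by (auto simp: p_def)
  moreover have "\<forall>j\<in>I. B p (e j) = 0" using c f I by (auto simp: p_def B.sum_left)
  ultimately have "\<kappa> * B p p \<le> A p p" using assms by (auto simp: complete_below_def)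
  moreover have "A p p < \<kappa> * B p p" using assms(2) c(1) by (auto simp: negative_family_def p_def)
  ultimately show False by simp
qed

text \<open>
  A vector orthogonal to the eigenvectors below \<open>a\<close> is the sum of a combination of eigenvectors with
  eigenvalues in the interval from \<open>a\<close> to \<open>b\<close> and of a vector orthogonal to the whole system; the
  inequality holds for both parts, and they are orthogonal for both forms.
\<close>

lemma complete_below_restrict:
  assumes "complete_below b I e \<nu>" "a \<le> b"
  shows "complete_below a {i\<in>I. \<nu> i < a} e \<nu>"
proof -
  let ?I = "{i\<in>I. \<nu> i < a}"
  let ?J = "{i\<in>I. a \<le> \<nu> i}"
  have sys: "eigensystem I e \<nu>" "\<And>i. i \<in> I \<Longrightarrow> \<nu> i < b" using assms(1) by (auto simp: complete_below_def)
  note I = sys(1) eigensystem_finite[OF sys(1)] eigensystem_in_S[OF sys(1)] sys(2)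
  have J: "eigensystem ?J e \<nu>" by (rule eigensystem_subset[OF I(1)]) auto
  have "a * B p p \<le> A p p" if p: "p \<in> S" "\<forall>i\<in>?I. B p (e i) = 0" for p
  proof -
    define s where "s = (\<Sum>i\<in>?J. B p (e i) *\<^sub>R e i)"
    define q where "q = p - s"
    have sS: "s \<in> S" using I by (auto simp: s_def)
    have qS: "q \<in> S" using sS p by (auto simp: q_def)
    have "B q (e i) = 0" if "i \<in> I" for i
    proof (cases "\<nu> i < a")
      case True
      have "B (e j) (e i) = 0" if "j \<in> ?J" for j using I(1) that \<open>i \<in> I\<close> True by (auto simp: eigensystem_def)
      then have "B s (e i) = 0" unfolding s_def using I \<open>i \<in> I\<close> by (subst B.sum_left) (auto intro!: sum.neutral)
      then show ?thesis using p True \<open>i \<in> I\<close> sS I by (auto simp: q_def B.diff_left)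
    next
      case False
      then show ?thesis using eigensystem_residual[OF J p(1), of i] \<open>i \<in> I\<close> by (auto simp: q_def s_def)
    qed
    then have q: "b * B q q \<le> A q q" "\<And>i. i \<in> I \<Longrightarrow> B (e i) q = 0"
      using assms qS I(3) B.sym by (auto simp: complete_below_def)
    have "B s q = 0" unfolding s_def using q(2) I qS by (subst B.sum_left) (auto intro!: sum.neutral)
    have "A s q = 0" unfolding s_def using q(2) qS by (subst eigensystem_sum_A_left[OF J]) (auto intro!: sum.neutral)
    have p_eq: "p = s + q" by (simp add: q_def)
    have "A p p = A s s + A q q" "B p p = B s s + B q q"
      using \<open>B s q = 0\<close> \<open>A s q = 0\<close> sS qS by (simp_all add: p_eq A.expand_add B.expand_add)
    moreover have "a * B s s \<le> A s s"
      unfolding s_def eigensystem_sum_A[OF J] eigensystem_sum_B[OF J] sum_distrib_left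
      by (intro sum_mono mult_right_mono) auto
    moreover have "a * B q q \<le> b * B q q" using assms(2) B.nonneg[OF qS] by (rule mult_right_mono)
    ultimately show ?thesis using q(1) by (simp add: algebra_simps)
  qed
  moreover have "eigensystem ?I e \<nu>" by (rule eigensystem_subset[OF I(1)]) auto
  ultimately show ?thesis by (auto simp: complete_below_def)
qed

text \<open>
  The residual \<open>r\<close> is an eigenvector for \<open>\<mu> < b\<close> that is orthogonal to the whole system.
\<close>

lemma eigenspace_basis:
  assumes "complete_below b I e \<nu>" "\<mu> < b" "p \<in> eigen \<mu>"
  defines "r \<equiv> p - (\<Sum>i\<in>{i\<in>I. \<nu> i = \<mu>}. B p (e i) *\<^sub>R e i)"
  shows "B r r = 0"
proof -
  let ?J = "{i\<in>I. \<nu> i = \<mu>}"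
  have I: "eigensystem I e \<nu>" "finite I" "\<And>i. i \<in> I \<Longrightarrow> e i \<in> eigen (\<nu> i)" using assms
    by (auto simp: complete_below_def eigensystem_def)
  have J: "eigensystem ?J e \<nu>" by (rule eigensystem_subset[OF I(1)]) auto
  have r: "r \<in> eigen \<mu>" unfolding r_def
    by (intro subspace_diff subspace_sum subspace_scale subspace_eigen assms) (use I in auto)
  have "B r (e i) = 0" if "i \<in> I" for i
  proof (cases "\<nu> i = \<mu>")
    case True
    then show ?thesis unfolding r_def using eigensystem_residual[OF J] eigen_in_S assms(3) that by auto
  next
    case False
    then show ?thesis using eigen_orthogonal[OF r I(3)[OF that]] by auto
  qed
  then have "b * B r r \<le> A r r" using assms(1) eigen_in_S[OF r] by (auto simp: complete_below_def)
  moreover have "A r r = \<mu> * B r r" using r by (auto simp: eigen_def)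
  ultimately have "(b - \<mu>) * B r r \<le> 0" by (simp add: algebra_simps)
  then show ?thesis using assms(2) B.nonneg[OF eigen_in_S[OF r]] by (simp add: mult_le_0_iff)
qed

text \<open>
  The matrix of \<open>A - \<kappa> * B\<close> in the eigenvectors is diagonal with entries at most \<open>- \<eta>\<close>. The matrices
  of approximating families converge to it, and a perturbation of each entry by less than
  \<open>\<eta> / (card I + 1)\<close> keeps it negative definite.
\<close>

lemma negative_family_approximation:
  assumes sys: "eigensystem I e \<nu>" "\<forall>i\<in>I. \<nu> i < \<kappa>"
    and D: "D \<subseteq> S"
      "\<And>p. p \<in> S \<Longrightarrow> \<exists>X. (\<forall>n. X n \<in> D) \<and> (\<lambda>n. A (X n - p) (X n - p) + B (X n - p) (X n - p)) \<longlonglongrightarrow> 0"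
  shows "\<exists>f. (\<forall>i\<in>I. f i \<in> D) \<and> negative_family \<kappa> I f"
proof (cases "I = {}")
  case True then show ?thesis by (auto simp: negative_family_def)
next
  case False
  note f = eigensystem_finite[OF sys(1)] eigensystem_in_S[OF sys(1)]
  have "\<forall>i\<in>I. \<exists>X. (\<forall>n. X n \<in> D) \<and> (\<lambda>n. A (X n - e i) (X n - e i) + B (X n - e i) (X n - e i)) \<longlonglongrightarrow> 0"
    using D(2) f(2) by blast
  from bchoice[OF this] obtain X where X': "\<forall>i\<in>I. (\<forall>n. X i n \<in> D) \<and>
    (\<lambda>n. A (X i n - e i) (X i n - e i) + B (X i n - e i) (X i n - e i)) \<longlonglongrightarrow> 0" ..
  then have X: "\<And>i n. i \<in> I \<Longrightarrow> X i n \<in> D"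
    "\<And>i. i \<in> I \<Longrightarrow> (\<lambda>n. A (X i n - e i) (X i n - e i) + B (X i n - e i) (X i n - e i)) \<longlonglongrightarrow> 0" by blast+
  have XS: "X i n \<in> S" if "i \<in> I" for i n using X(1) D that by auto
  have cA: "(\<lambda>n. A (X i n - e i) (X i n - e i)) \<longlonglongrightarrow> 0" and cB: "(\<lambda>n. B (X i n - e i) (X i n - e i)) \<longlonglongrightarrow> 0"
    if "i \<in> I" for i
    by (rule tendsto_sandwich[OF _ _ tendsto_const X(2)[OF that]]; use A.nonneg B.nonneg XS f that in auto)+
  define \<eta> where "\<eta> = Min ((\<lambda>i. \<kappa> - \<nu> i) ` I)"
  have \<eta>: "\<eta> > 0" "\<And>i. i \<in> I \<Longrightarrow> \<eta> \<le> \<kappa> - \<nu> i" using sys(2) f False by (auto simp: \<eta>_def)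
  define \<theta> where "\<theta> = \<eta> / (card I + 1)"
  have \<theta>: "\<theta> > 0" using \<eta> by (simp add: \<theta>_def)
  define G where "G = (\<lambda>n i j. A (X i n) (X j n) - \<kappa> * B (X i n) (X j n))"
  define G0 where "G0 = (\<lambda>i j. A (e i) (e j) - \<kappa> * B (e i) (e j))"
  have G0: "G0 i j = (\<nu> i - \<kappa>) * of_bool (i = j)" if "i \<in> I" "j \<in> I" for i j
    using sys(1) that f by (auto simp: G0_def eigensystem_def eigen_def)
  have "(\<lambda>n. G n i j) \<longlonglongrightarrow> G0 i j" if "i \<in> I" "j \<in> I" for i j
    unfolding G_def G0_def using that by (intro tendsto_intros A.form_tendsto B.form_tendsto XS f cA cB) 
  then have "eventually (\<lambda>n. dist (G n i j) (G0 i j) < \<theta>) sequentially" if "i \<in> I" "j \<in> I" for i j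
    using that \<theta> by (auto simp: tendsto_iff)
  then have "eventually (\<lambda>n. \<forall>i\<in>I. \<forall>j\<in>I. dist (G n i j) (G0 i j) < \<theta>) sequentially"
    using f(1) by (auto simp: eventually_ball_finite_distrib)
  then obtain n where n: "\<And>i j. i \<in> I \<Longrightarrow> j \<in> I \<Longrightarrow> \<bar>G n i j - G0 i j\<bar> < \<theta>"
    by (auto simp: eventually_sequentially dist_real_def)
  have "A (\<Sum>i\<in>I. c i *\<^sub>R X i n) (\<Sum>i\<in>I. c i *\<^sub>R X i n)
          < \<kappa> * B (\<Sum>i\<in>I. c i *\<^sub>R X i n) (\<Sum>i\<in>I. c i *\<^sub>R X i n)" if nz: "\<exists>i\<in>I. c i \<noteq> 0" for c
  proof -
    define s where "s = (\<Sum>i\<in>I. (c i)\<^sup>2)"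
    have s: "s > 0"
    proof -
      obtain j where j: "j \<in> I" "c j \<noteq> 0" using nz by auto
      have "(c j)\<^sup>2 \<le> s" unfolding s_def using f j by (intro member_le_sum) auto
      then show ?thesis using j by (metis less_le_trans zero_less_power2)
    qed
    have "A (\<Sum>i\<in>I. c i *\<^sub>R X i n) (\<Sum>i\<in>I. c i *\<^sub>R X i n) - \<kappa> * B (\<Sum>i\<in>I. c i *\<^sub>R X i n) (\<Sum>i\<in>I. c i *\<^sub>R X i n)
        = (\<Sum>i\<in>I. \<Sum>j\<in>I. c i * c j * G n i j)"
    proof -
      have "A (\<Sum>i\<in>I. c i *\<^sub>R X i n) (\<Sum>i\<in>I. c i *\<^sub>R X i n) = (\<Sum>i\<in>I. c i * (\<Sum>j\<in>I. c j * A (X i n) (X j n)))"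
        using f XS by (subst A.sum_left) (auto simp: A.sum_right intro!: sum.cong)
      moreover have "B (\<Sum>i\<in>I. c i *\<^sub>R X i n) (\<Sum>i\<in>I. c i *\<^sub>R X i n) = (\<Sum>i\<in>I. c i * (\<Sum>j\<in>I. c j * B (X i n) (X j n)))"
        using f XS by (subst B.sum_left) (auto simp: B.sum_right intro!: sum.cong)
      ultimately show ?thesis
        by (simp add: G_def sum_distrib_left flip: sum_subtractf) (simp add: algebra_simps)
    qed
    also have "\<dots> \<le> (\<Sum>i\<in>I. \<Sum>j\<in>I. c i * c j * G0 i j + \<bar>c i\<bar> * \<bar>c j\<bar> * \<theta>)"
    proof (intro sum_mono)
      fix i j assume ij: "i \<in> I" "j \<in> I"
      have "c i * c j * (G n i j - G0 i j) \<le> \<bar>c i * c j * (G n i j - G0 i j)\<bar>" by simp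
      also have "\<dots> \<le> \<bar>c i\<bar> * \<bar>c j\<bar> * \<theta>" unfolding abs_mult using n[OF ij] by (intro mult_left_mono) auto
      finally show "c i * c j * G n i j \<le> c i * c j * G0 i j + \<bar>c i\<bar> * \<bar>c j\<bar> * \<theta>" by (simp add: algebra_simps)
    qed
    also have "\<dots> = (\<Sum>i\<in>I. \<Sum>j\<in>I. c i * c j * G0 i j) + \<theta> * (\<Sum>i\<in>I. \<bar>c i\<bar>)\<^sup>2"
      by (simp add: sum.distrib power2_eq_square sum_product sum_distrib_left algebra_simps)
    also have "(\<Sum>i\<in>I. \<Sum>j\<in>I. c i * c j * G0 i j) = (\<Sum>i\<in>I. (\<nu> i - \<kappa>) * (c i)\<^sup>2)"
    proof (intro sum.cong refl)
      fix i assume i: "i \<in> I"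
      have "(\<Sum>j\<in>I. c i * c j * G0 i j) = (\<Sum>j\<in>I. if i = j then c i * c j * (\<nu> i - \<kappa>) else 0)"
        using i by (intro sum.cong) (auto simp: G0)
      also have "\<dots> = (\<nu> i - \<kappa>) * (c i)\<^sup>2" using i f by (simp add: power2_eq_square)
      finally show "(\<Sum>j\<in>I. c i * c j * G0 i j) = (\<nu> i - \<kappa>) * (c i)\<^sup>2" .
    qed
    also have "(\<Sum>i\<in>I. (\<nu> i - \<kappa>) * (c i)\<^sup>2) \<le> (\<Sum>i\<in>I. - \<eta> * (c i)\<^sup>2)"
      using \<eta>(2) by (intro sum_mono mult_right_mono) force+
    also have "(\<Sum>i\<in>I. - \<eta> * (c i)\<^sup>2) = - \<eta> * s" by (simp add: s_def sum_distrib_left)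
    also have "\<theta> * (\<Sum>i\<in>I. \<bar>c i\<bar>)\<^sup>2 \<le> \<theta> * (card I * s)"
      using Cauchy_Schwarz_ineq_sum[of "\<lambda>_. 1" "\<lambda>i. \<bar>c i\<bar>" I] \<theta> by (simp add: s_def)
    also have "- \<eta> * s + \<theta> * (card I * s) < 0"
    proof -
      have "\<theta> * card I < \<eta>" using \<eta>(1) by (simp add: \<theta>_def field_simps)
      then have "\<theta> * card I * s < \<eta> * s" using s by (intro mult_strict_right_mono)
      then show ?thesis by (simp add: algebra_simps)
    qed
    finally show ?thesis by simp
  qed
  then have "negative_family \<kappa> I (\<lambda>i. X i n)" unfolding negative_family_def using f(1) XS by blast
  then show ?thesis using X(1) by (intro exI[of _ "\<lambda>i. X i n"]) simp
qed

end

text \<open>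
  The images under \<open>T\<close> of a negative family in \<open>D\<close> form a negative family for the second pair.
\<close>

theorem transplantation_count:
  fixes S1 :: "'v::real_vector set" and S2 :: "'w::real_vector set"
  assumes fp: "form_pair S1 A1 B1" "form_pair S2 A2 B2"
    and D: "D \<subseteq> S1"
      "\<And>p. p \<in> S1 \<Longrightarrow> \<exists>X. (\<forall>n. X n \<in> D) \<and> (\<lambda>n. A1 (X n - p) (X n - p) + B1 (X n - p) (X n - p)) \<longlonglongrightarrow> 0"
      "subspace D"
    and T: "\<And>p. p \<in> D \<Longrightarrow> T p \<in> S2"
      "\<And>p q. p \<in> D \<Longrightarrow> q \<in> D \<Longrightarrow> T (p + q) = T p + T q" "\<And>c p. p \<in> D \<Longrightarrow> T (c *\<^sub>R p) = c *\<^sub>R T p"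
    and est: "\<And>p. p \<in> D \<Longrightarrow> A2 (T p) (T p) \<le> (1 + \<delta>) * A1 p p" "\<And>p. p \<in> D \<Longrightarrow> (1 - \<delta>) * B1 p p \<le> B2 (T p) (T p)"
      "0 \<le> \<delta>" "\<delta> < 1"
    and sys: "form_pair.complete_below S1 A1 B1 \<kappa>1 I1 e1 \<nu>1" "form_pair.complete_below S2 A2 B2 \<kappa>2 I2 e2 \<nu>2"
    and le: "(1 + \<delta>) * \<kappa>1 \<le> (1 - \<delta>) * \<kappa>2"
  shows "card I1 \<le> card I2"
proof -
  interpret f1: form_pair S1 A1 B1 by fact
  interpret f2: form_pair S2 A2 B2 by fact
  have "f1.eigensystem I1 e1 \<nu>1" "\<forall>i\<in>I1. \<nu>1 i < \<kappa>1" using sys by (auto simp: f1.complete_below_def)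
  from f1.negative_family_approximation[OF this D(1,2)] obtain f where
    f: "\<forall>i\<in>I1. f i \<in> D" "f1.negative_family \<kappa>1 I1 f" by blast
  have fin: "finite I1" using f by (auto simp: f1.negative_family_def)
  have Tsum: "T (\<Sum>i\<in>I. c i *\<^sub>R f i) = (\<Sum>i\<in>I. c i *\<^sub>R T (f i))" if "I \<subseteq> I1" for c I
    using finite_subset[OF that fin] that
  proof (induction I rule: finite_induct)
    case empty
    show ?case using T(3)[of 0 0] subspace_0[OF D(3)] by simp
  next
    case (insert i I)
    have "(\<Sum>i\<in>I. c i *\<^sub>R f i) \<in> D" "c i *\<^sub>R f i \<in> D"
      using f insert by (auto intro!: subspace_sum subspace_scale D)
    then show ?case using insert T f by simp
  qed
  have "f2.negative_family \<kappa>2 I1 (\<lambda>i. T (f i))"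
    unfolding f2.negative_family_def
  proof (intro conjI allI impI ballI)
    fix c assume c: "\<exists>i\<in>I1. c i \<noteq> (0::real)"
    define p where "p = (\<Sum>i\<in>I1. c i *\<^sub>R f i)"
    have pD: "p \<in> D" unfolding p_def using f by (auto intro!: subspace_sum subspace_scale D)
    have pS: "p \<in> S1" using pD D by auto
    have neg: "A1 p p < \<kappa>1 * B1 p p" using f(2) c by (auto simp: p_def f1.negative_family_def)
    have Bp: "B1 p p > 0" and \<kappa>1: "\<kappa>1 > 0"
    proof -
      have "0 < \<kappa>1 * B1 p p" using neg f1.A.nonneg[OF pS] by linarith
      then show "B1 p p > 0" "\<kappa>1 > 0" using f1.B.nonneg[OF pS] by (auto simp: zero_less_mult_iff)
    qed
    have \<kappa>2: "\<kappa>2 > 0"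
    proof -
      have "0 < (1 + \<delta>) * \<kappa>1" using \<kappa>1 est by simp
      then have "0 < (1 - \<delta>) * \<kappa>2" using le by linarith
      then show ?thesis using est by (simp add: zero_less_mult_iff)
    qed
    have "A2 (T p) (T p) \<le> (1 + \<delta>) * A1 p p" using est pD by blast
    also have "\<dots> < (1 + \<delta>) * (\<kappa>1 * B1 p p)" using neg est by (intro mult_strict_left_mono) auto
    also have "\<dots> \<le> ((1 - \<delta>) * \<kappa>2) * B1 p p" using le Bp mult_right_mono[OF le, of "B1 p p"] by (simp add: algebra_simps)
    also have "\<dots> = \<kappa>2 * ((1 - \<delta>) * B1 p p)" by simp
    also have "\<dots> \<le> \<kappa>2 * B2 (T p) (T p)" using est pD \<kappa>2 by (intro mult_left_mono) auto
    finally show "A2 (\<Sum>i\<in>I1. c i *\<^sub>R T (f i)) (\<Sum>i\<in>I1. c i *\<^sub>R T (f i))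
      < \<kappa>2 * B2 (\<Sum>i\<in>I1. c i *\<^sub>R T (f i)) (\<Sum>i\<in>I1. c i *\<^sub>R T (f i))"
      unfolding p_def Tsum[OF subset_refl] .
  qed (use fin T f in auto)
  then show ?thesis using f2.negative_family_card_le[OF sys(2)] by blast
qed

section \<open>Square-integrable functions\<close>

definition square_integrable :: "'a measure \<Rightarrow> ('a \<Rightarrow> 'b::euclidean_space) \<Rightarrow> bool" where
  "square_integrable M f \<longleftrightarrow> f \<in> borel_measurable M \<and> integrable M (\<lambda>x. (norm (f x))\<^sup>2)"

lemma L2_iff: "L2 \<Omega> f \<longleftrightarrow> square_integrable (lebesgue_on \<Omega>) f"
  by (simp add: L2_def square_integrable_def)

lemma square_integrable_inner:
  assumes "square_integrable M f" "square_integrable M g"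
  shows "integrable M (\<lambda>x. f x \<bullet> g x)"
proof (rule Bochner_Integration.integrable_bound)
  show "integrable M (\<lambda>x. (norm (f x))\<^sup>2 + (norm (g x))\<^sup>2)"
    using assms by (simp add: square_integrable_def)
  show "(\<lambda>x. f x \<bullet> g x) \<in> borel_measurable M" using assms by (auto simp: square_integrable_def)
  have "\<bar>f x \<bullet> g x\<bar> \<le> (norm (f x))\<^sup>2 + (norm (g x))\<^sup>2" for x
  proof -
    have "\<bar>f x \<bullet> g x\<bar> \<le> norm (f x) * norm (g x)" by (rule Cauchy_Schwarz_ineq2)
    moreover have "2 * (norm (f x) * norm (g x)) \<le> (norm (f x))\<^sup>2 + (norm (g x))\<^sup>2"
      using sum_squares_bound[of "norm (f x)" "norm (g x)"] by simp
    moreover have "0 \<le> norm (f x) * norm (g x)" by simp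
    ultimately show ?thesis by linarith
  qed
  then show "AE x in M. norm (f x \<bullet> g x) \<le> norm ((norm (f x))\<^sup>2 + (norm (g x))\<^sup>2)" by simp
qed

lemma square_integrable_add:
  assumes "square_integrable M f" "square_integrable M g"
  shows "square_integrable M (\<lambda>x. f x + g x)"
proof -
  have "integrable M (\<lambda>x. (norm (f x))\<^sup>2 + 2 * (f x \<bullet> g x) + (norm (g x))\<^sup>2)"
    using assms square_integrable_inner[OF assms] by (simp add: square_integrable_def)
  moreover have "(norm (f x + g x))\<^sup>2 = (norm (f x))\<^sup>2 + 2 * (f x \<bullet> g x) + (norm (g x))\<^sup>2" for x
    by (simp add: power2_norm_eq_inner inner_add inner_commute algebra_simps)
  ultimately show ?thesis using assms by (auto simp: square_integrable_def)
qed

lemma square_integrable_scale: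
  assumes "square_integrable M f"
  shows "square_integrable M (\<lambda>x. c *\<^sub>R f x)"
  using assms by (auto simp: square_integrable_def power_mult_distrib)

lemma square_integrable_zero: "square_integrable M (\<lambda>x. 0)"
  by (simp add: square_integrable_def)

lemma square_integrable_diff:
  assumes "square_integrable M f" "square_integrable M g"
  shows "square_integrable M (\<lambda>x. f x - g x)"
  using square_integrable_add[OF assms(1) square_integrable_scale[OF assms(2), of "-1"]] by simp

lemma summable_differences_convergent:
  fixes s :: "nat \<Rightarrow> 'b::banach"
  assumes "summable (\<lambda>k. s (Suc k) - s k)"
  shows "convergent s"
proof -
  have "(\<lambda>n. \<Sum>k<n. s (Suc k) - s k) \<longlonglongrightarrow> (\<Sum>k. s (Suc k) - s k)"
    using assms by (rule summable_LIMSEQ)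
  then have "(\<lambda>n. s n - s 0) \<longlonglongrightarrow> (\<Sum>k. s (Suc k) - s k)" by (simp add: sum_lessThan_telescope)
  from tendsto_add[OF this tendsto_const[of "s 0"]] show ?thesis by (auto simp: convergent_def)
qed

text \<open>
  Choose a subsequence whose consecutive squared distances are less than $8^{-k}$. The sum of the
  functions $2^k |f_{k+1} - f_k|^2$ is then integrable, hence finite almost everywhere, and there the
  increments are $O(2^{-k/2})$. Fatou's lemma shows that the pointwise limit is the limit in $L^2$.
\<close>

theorem L2_complete:
  fixes f :: "nat \<Rightarrow> 'a \<Rightarrow> 'b::euclidean_space"
  assumes sq: "\<And>n. square_integrable M (f n)"
    and cauchy: "\<And>e. e > 0 \<Longrightarrow> \<exists>N. \<forall>m\<ge>N. \<forall>n\<ge>N. (\<integral>x. (norm (f m x - f n x))\<^sup>2 \<partial>M) < e"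
  shows "\<exists>g. square_integrable M g \<and> (\<lambda>n. \<integral>x. (norm (f n x - g x))\<^sup>2 \<partial>M) \<longlonglongrightarrow> 0"
proof -
  have [measurable]: "f n \<in> borel_measurable M" for n using sq by (simp add: square_integrable_def)
  have int: "integrable M (\<lambda>x. (norm (f m x - f n x))\<^sup>2)" for m n
    using square_integrable_diff[OF sq sq] by (simp add: square_integrable_def)
  have nn: "(\<integral>\<^sup>+x. ennreal ((norm (f m x - f n x))\<^sup>2) \<partial>M) = ennreal (\<integral>x. (norm (f m x - f n x))\<^sup>2 \<partial>M)" for m n
    by (rule nn_integral_eq_integral[OF int]) simp
  have "\<exists>N. \<forall>m\<ge>N. \<forall>n\<ge>N. (\<integral>x. (norm (f m x - f n x))\<^sup>2 \<partial>M) < (1/8)^k" for k :: nat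
    by (rule cauchy) simp
  then obtain N where N: "\<And>k m n. m \<ge> N k \<Longrightarrow> n \<ge> N k \<Longrightarrow> (\<integral>x. (norm (f m x - f n x))\<^sup>2 \<partial>M) < (1/8)^k"
    by metis
  define r where "r = (\<lambda>k. \<Sum>i\<le>k. N i)"
  have r: "r k \<ge> N j" if "j \<le> k" for j k
    unfolding r_def by (rule member_le_sum) (use that in auto)
  define d where "d = (\<lambda>k x. (norm (f (r (Suc k)) x - f (r k) x))\<^sup>2)"
  have [measurable]: "d k \<in> borel_measurable M" for k unfolding d_def by measurable
  have "(\<integral>\<^sup>+x. (\<Sum>k. ennreal (2^k * d k x)) \<partial>M) = (\<Sum>k. \<integral>\<^sup>+x. ennreal (2^k * d k x) \<partial>M)"
    by (rule nn_integral_suminf) simp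
  also have "\<dots> \<le> (\<Sum>k. ennreal ((1/4)^k))"
  proof (rule suminf_le)
    fix k
    have "(\<integral>\<^sup>+x. ennreal (2^k * d k x) \<partial>M) = ennreal (2^k) * (\<integral>\<^sup>+x. ennreal (d k x) \<partial>M)"
      by (subst nn_integral_cmult[symmetric]) (auto simp: ennreal_mult d_def)
    also have "\<dots> = ennreal (2^k) * ennreal (\<integral>x. d k x \<partial>M)" by (simp add: d_def nn)
    also have "\<dots> \<le> ennreal (2^k) * ennreal ((1/8)^k)"
      using N[OF r r, of k "Suc k" k] by (intro mult_left_mono ennreal_leI) (auto simp: d_def)
    also have "\<dots> = ennreal ((1/4)^k)" by (simp add: ennreal_mult[symmetric] power_mult_distrib[symmetric])
    finally show "(\<integral>\<^sup>+x. ennreal (2^k * d k x) \<partial>M) \<le> ennreal ((1/4)^k)" .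
  qed auto
  also have "\<dots> = ennreal (\<Sum>k. (1/4)^k)"
    by (rule suminf_ennreal2) (auto intro: summable_geometric)
  finally have "(\<integral>\<^sup>+x. (\<Sum>k. ennreal (2^k * d k x)) \<partial>M) \<noteq> \<infinity>" by (auto simp: top_unique)
  then have "AE x in M. (\<Sum>k. ennreal (2^k * d k x)) \<noteq> \<infinity>"
    by (intro nn_integral_PInf_AE) auto
  then have conv: "AE x in M. convergent (\<lambda>k. f (r k) x)"
  proof (eventually_elim)
    fix x assume fin: "(\<Sum>k. ennreal (2^k * d k x)) \<noteq> \<infinity>"
    define C where "C = enn2real (\<Sum>k. ennreal (2^k * d k x))"
    have C: "(\<Sum>k. ennreal (2^k * d k x)) = ennreal C" "C \<ge> 0" using fin by (auto simp: C_def less_top)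
    have bound: "norm (f (r (Suc k)) x - f (r k) x) \<le> sqrt C * (sqrt (1/2))^k" for k
    proof -
      have "(\<Sum>k\<in>{k}. ennreal (2^k * d k x)) \<le> (\<Sum>k. ennreal (2^k * d k x))"
        by (rule sum_le_suminf) auto
      then have "2^k * d k x \<le> C" using C by (simp add: ennreal_le_iff)
      then have "d k x \<le> C * (1/2)^k" by (simp add: field_simps)
      then have "sqrt (d k x) \<le> sqrt (C * (1/2)^k)" by (rule real_sqrt_le_mono)
      then show ?thesis by (simp add: d_def real_sqrt_mult real_sqrt_power)
    qed
    have "summable (\<lambda>k. sqrt C * (sqrt (1/2))^k)"
      by (intro summable_mult summable_geometric) (simp add: real_sqrt_lt_1_iff)
    then have "summable (\<lambda>k. f (r (Suc k)) x - f (r k) x)"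
      by (rule summable_comparison_test'[where N=0]) (rule bound)
    then show "convergent (\<lambda>k. f (r k) x)" by (rule summable_differences_convergent)
  qed
  define g where "g = (\<lambda>x. lim (\<lambda>k. f (r k) x))"
  have [measurable]: "g \<in> borel_measurable M" unfolding g_def by (rule borel_measurable_lim_metric) simp
  have est: "(\<integral>\<^sup>+x. ennreal ((norm (f m x - g x))\<^sup>2) \<partial>M) \<le> ennreal ((1/8)^k)" if m: "m \<ge> N k" for m k
  proof -
    have "(\<integral>\<^sup>+x. ennreal ((norm (f m x - g x))\<^sup>2) \<partial>M)
        = (\<integral>\<^sup>+x. liminf (\<lambda>j. ennreal ((norm (f m x - f (r j) x))\<^sup>2)) \<partial>M)"
    proof (rule nn_integral_cong_AE)
      show "AE x in M. ennreal ((norm (f m x - g x))\<^sup>2) = liminf (\<lambda>j. ennreal ((norm (f m x - f (r j) x))\<^sup>2))"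
        using conv
      proof eventually_elim
        fix x assume "convergent (\<lambda>k. f (r k) x)"
        then have "(\<lambda>k. f (r k) x) \<longlonglongrightarrow> g x" by (simp add: g_def convergent_LIMSEQ_iff)
        then have "(\<lambda>j. ennreal ((norm (f m x - f (r j) x))\<^sup>2)) \<longlonglongrightarrow> ennreal ((norm (f m x - g x))\<^sup>2)"
          by (intro tendsto_ennrealI tendsto_intros)
        then show "ennreal ((norm (f m x - g x))\<^sup>2) = liminf (\<lambda>j. ennreal ((norm (f m x - f (r j) x))\<^sup>2))"
          by (intro lim_imp_Liminf[symmetric]) simp_all
      qed
    qed
    also have "\<dots> \<le> liminf (\<lambda>j. \<integral>\<^sup>+x. ennreal ((norm (f m x - f (r j) x))\<^sup>2) \<partial>M)"
      by (rule nn_integral_liminf) simp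
    also have "\<dots> \<le> ennreal ((1/8)^k)"
    proof (rule Liminf_le)
      show "\<forall>\<^sub>F j in sequentially. (\<integral>\<^sup>+x. ennreal ((norm (f m x - f (r j) x))\<^sup>2) \<partial>M) \<le> ennreal ((1/8)^k)"
        unfolding nn using N[OF m r] by (intro eventually_sequentiallyI[of k] ennreal_leI) (auto intro: less_imp_le)
    qed simp
    finally show ?thesis .
  qed
  have sqd: "square_integrable M (\<lambda>x. f m x - g x)" if m: "m \<ge> N k" for m k
    unfolding square_integrable_def
  proof
    show "integrable M (\<lambda>x. (norm (f m x - g x))\<^sup>2)"
      using est[OF m] by (intro integrableI_nonneg) (auto intro: le_less_trans simp: ennreal_less_top)
  qed simp
  have "square_integrable M (\<lambda>x. f (N 0) x - (f (N 0) x - g x))"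
    by (rule square_integrable_diff[OF sq sqd[of 0]]) simp
  then have sqg: "square_integrable M g" by simp
  have small: "(\<integral>x. (norm (f m x - g x))\<^sup>2 \<partial>M) \<le> (1/8)^k" if m: "m \<ge> N k" for m k
  proof -
    have "ennreal (\<integral>x. (norm (f m x - g x))\<^sup>2 \<partial>M) \<le> ennreal ((1/8)^k)"
      using est[OF m] sqd[OF m] by (subst nn_integral_eq_integral[symmetric]) (auto simp: square_integrable_def)
    then show ?thesis by (subst (asm) ennreal_le_iff) auto
  qed
  have "(\<lambda>n. \<integral>x. (norm (f n x - g x))\<^sup>2 \<partial>M) \<longlonglongrightarrow> 0"
  proof (rule LIMSEQ_I)
    fix e :: real assume "e > 0"
    then obtain k where k: "(1/8::real)^k < e" using real_arch_pow_inv[of e "1/8"] by auto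
    have "norm ((\<integral>x. (norm (f n x - g x))\<^sup>2 \<partial>M) - 0) < e" if "n \<ge> N k" for n
      using small[OF that] k by simp
    then show "\<exists>no. \<forall>n\<ge>no. norm ((\<integral>x. (norm (f n x - g x))\<^sup>2 \<partial>M) - 0) < e" by blast
  qed
  then show ?thesis using sqg by blast
qed

section \<open>Pairs of a function and a gradient as a vector space\<close>

text \<open>
  With pointwise operations, pairs of a function and a gradient form a real vector space, on which
  the abstract theory can be instantiated.
\<close>

instantiation "fun" :: (type, scaleR) scaleR
begin
definition "scaleR c f = (\<lambda>x. c *\<^sub>R f x)"
instance ..
end

lemma scaleR_fun_apply [simp]: "(c *\<^sub>R f) x = c *\<^sub>R f x"
  by (simp add: scaleR_fun_def)

instance "fun" :: (type, real_vector) real_vector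
  by standard (simp_all add: fun_eq_iff scaleR_add_right scaleR_add_left)

type_synonym 'a jet = "('a \<Rightarrow> real) \<times> ('a \<Rightarrow> 'a)"

definition L2_jets :: "'a::euclidean_space set \<Rightarrow> 'a jet set" where
  "L2_jets \<Omega> = {p. L2 \<Omega> (fst p) \<and> L2 \<Omega> (snd p)}"

definition mass :: "'a::euclidean_space set \<Rightarrow> 'a jet \<Rightarrow> 'a jet \<Rightarrow> real" where
  "mass \<Omega> p q = (\<integral>x. fst p x * fst q x \<partial>lebesgue_on \<Omega>)"

definition energy :: "'a::euclidean_space set \<Rightarrow> 'a jet \<Rightarrow> 'a jet \<Rightarrow> real" where
  "energy \<Omega> p q = (\<integral>x. snd p x \<bullet> snd q x \<partial>lebesgue_on \<Omega>)"

definition sobolev :: "'a::euclidean_space set \<Rightarrow> 'a jet set" where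
  "sobolev \<Omega> = {p. H1_0 \<Omega> (fst p) (snd p)}"

definition jet :: "('a::euclidean_space \<Rightarrow> real) \<Rightarrow> 'a jet" where
  "jet \<phi> = (\<phi>, grad \<phi>)"

abbreviation sobolev_square :: "'a::euclidean_space set \<Rightarrow> 'a jet \<Rightarrow> real" where
  "sobolev_square \<Omega> p \<equiv> energy \<Omega> p p + mass \<Omega> p p"

lemma subspace_L2_jets: "subspace (L2_jets \<Omega>)"
proof (rule subspaceI)
  show "0 \<in> L2_jets \<Omega>"
    by (simp add: L2_jets_def L2_iff zero_prod_def zero_fun_def square_integrable_zero)
  show "x + y \<in> L2_jets \<Omega>" if "x \<in> L2_jets \<Omega>" "y \<in> L2_jets \<Omega>" for x y
    using that by (simp add: L2_jets_def L2_iff plus_fun_def square_integrable_add)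
  show "c *\<^sub>R x \<in> L2_jets \<Omega>" if "x \<in> L2_jets \<Omega>" for x c
    using that square_integrable_scale[of _ "fst x" c] square_integrable_scale[of _ "snd x" c]
    by (simp add: L2_jets_def L2_iff scaleR_fun_def)
qed

lemma mass_integrable: "p \<in> L2_jets \<Omega> \<Longrightarrow> q \<in> L2_jets \<Omega> \<Longrightarrow> integrable (lebesgue_on \<Omega>) (\<lambda>x. fst p x * fst q x)"
  using square_integrable_inner[of "lebesgue_on \<Omega>" "fst p" "fst q"] by (simp add: L2_jets_def L2_iff)

lemma energy_integrable: "p \<in> L2_jets \<Omega> \<Longrightarrow> q \<in> L2_jets \<Omega> \<Longrightarrow> integrable (lebesgue_on \<Omega>) (\<lambda>x. snd p x \<bullet> snd q x)"
  using square_integrable_inner[of "lebesgue_on \<Omega>" "snd p" "snd q"] by (simp add: L2_jets_def L2_iff)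

lemma psd_mass: "psd_form (L2_jets \<Omega>) (mass \<Omega>)"
proof
  show "subspace (L2_jets \<Omega>)" by (rule subspace_L2_jets)
  show "mass \<Omega> (p + q) r = mass \<Omega> p r + mass \<Omega> q r"
    if "p \<in> L2_jets \<Omega>" "q \<in> L2_jets \<Omega>" "r \<in> L2_jets \<Omega>" for p q r
    using that by (simp add: mass_def distrib_right mass_integrable)
  show "mass \<Omega> (c *\<^sub>R p) q = c * mass \<Omega> p q" for p q c
    by (simp add: mass_def mult.assoc)
  show "mass \<Omega> p q = mass \<Omega> q p" for p q by (simp add: mass_def mult.commute)
  show "0 \<le> mass \<Omega> p p" for p by (simp add: mass_def)
qed

lemma psd_energy: "psd_form (L2_jets \<Omega>) (energy \<Omega>)"
proof
  show "subspace (L2_jets \<Omega>)" by (rule subspace_L2_jets)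
  show "energy \<Omega> (p + q) r = energy \<Omega> p r + energy \<Omega> q r"
    if "p \<in> L2_jets \<Omega>" "q \<in> L2_jets \<Omega>" "r \<in> L2_jets \<Omega>" for p q r
    using that by (simp add: energy_def inner_add_left energy_integrable)
  show "energy \<Omega> (c *\<^sub>R p) q = c * energy \<Omega> p q" for p q c
    by (simp add: energy_def)
  show "energy \<Omega> p q = energy \<Omega> q p" for p q by (simp add: energy_def inner_commute)
  show "0 \<le> energy \<Omega> p p" for p by (simp add: energy_def)
qed

lemma mass_eq_0_iff:
  assumes "p \<in> L2_jets \<Omega>"
  shows "mass \<Omega> p p = 0 \<longleftrightarrow> (AE x in lebesgue_on \<Omega>. fst p x = 0)"
  unfolding mass_def using mass_integrable[OF assms assms]
  by (subst integral_nonneg_eq_0_iff_AE) auto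

section \<open>Test functions as jets\<close>

lemma lebesgue_on_eq_lborel:
  fixes f :: "'a::euclidean_space \<Rightarrow> 'b::euclidean_space"
  assumes "open \<Omega>" "\<And>x. x \<notin> \<Omega> \<Longrightarrow> f x = 0" "f \<in> borel_measurable borel"
  shows "(\<integral>x. f x \<partial>lebesgue_on \<Omega>) = (\<integral>x. f x \<partial>lborel)"
    and "integrable (lebesgue_on \<Omega>) f \<longleftrightarrow> integrable lborel f"
proof -
  have m: "\<Omega> \<inter> space lebesgue \<in> sets lebesgue" using assms(1) by simp
  have f: "(\<lambda>x. indicator \<Omega> x *\<^sub>R f x) = f" using assms(2) by (auto simp: indicator_def fun_eq_iff)
  show "(\<integral>x. f x \<partial>lebesgue_on \<Omega>) = (\<integral>x. f x \<partial>lborel)"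
    using assms(3) by (simp add: integral_restrict_space[OF m] f integral_completion)
  show "integrable (lebesgue_on \<Omega>) f \<longleftrightarrow> integrable lborel f"
    using assms(3) by (simp add: integrable_restrict_space[OF m] f integrable_completion)
qed

lemma borel_measurable_lebesgue_on:
  fixes f :: "'a::euclidean_space \<Rightarrow> 'b::euclidean_space"
  shows "f \<in> borel_measurable borel \<Longrightarrow> f \<in> borel_measurable (lebesgue_on \<Omega>)"
  by (intro measurable_restrict_space1 measurable_completion) simp

lemma test_function_grad_borel: "test_function \<Omega> \<phi> \<Longrightarrow> grad \<phi> \<in> borel_measurable borel"
  by (rule borel_measurable_continuous_onI, erule test_function_continuous_grad)

lemma test_function_L2:
  assumes "open \<Omega>" "test_function \<Omega> \<phi>"
  shows "L2 \<Omega> \<phi>" "L2 \<Omega> (grad \<phi>)"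
proof -
  have "integrable (lebesgue_on \<Omega>) (\<lambda>x. (\<phi> x)\<^sup>2)"
    by (subst lebesgue_on_eq_lborel(2)[OF assms(1)])
       (use test_function_power2_integrable[OF assms(2)] test_function_outside[OF assms(2)]
          test_function_borel[OF assms(2)] in auto)
  then show "L2 \<Omega> \<phi>"
    using assms by (simp add: L2_def borel_measurable_lebesgue_on test_function_borel)
  have "integrable (lebesgue_on \<Omega>) (\<lambda>x. (norm (grad \<phi> x))\<^sup>2)"
    by (subst lebesgue_on_eq_lborel(2)[OF assms(1)])
       (use test_function_norm_grad_integrable[OF assms(2)] test_function_grad_outside[OF assms(2)]
          test_function_grad_borel[OF assms(2)] in auto)
  then show "L2 \<Omega> (grad \<phi>)"
    using assms by (simp add: L2_def borel_measurable_lebesgue_on test_function_grad_borel)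
qed

lemma jet_in_L2_jets: "open \<Omega> \<Longrightarrow> test_function \<Omega> \<phi> \<Longrightarrow> jet \<phi> \<in> L2_jets \<Omega>"
  by (simp add: L2_jets_def jet_def test_function_L2)

lemma mass_jet:
  assumes "open \<Omega>" "test_function \<Omega> \<phi>"
  shows "mass \<Omega> (jet \<phi>) (jet \<phi>) = square_integral \<phi>"
  unfolding mass_def jet_def
  by (subst lebesgue_on_eq_lborel(1)[OF assms(1)])
     (use test_function_outside[OF assms(2)] test_function_borel[OF assms(2)] in \<open>auto simp: power2_eq_square\<close>)

lemma energy_jet:
  assumes "open \<Omega>" "test_function \<Omega> \<phi>"
  shows "energy \<Omega> (jet \<phi>) (jet \<phi>) = dirichlet_integral \<phi>"
  unfolding energy_def jet_def
  by (subst lebesgue_on_eq_lborel(1)[OF assms(1)])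
     (use test_function_grad_outside[OF assms(2)] test_function_grad_borel[OF assms(2)] in \<open>auto simp: power2_norm_eq_inner\<close>)

lemma jet_add: "test_function \<Omega> f \<Longrightarrow> test_function \<Omega> g \<Longrightarrow> jet (\<lambda>x. f x + g x) = jet f + jet g"
  by (simp add: jet_def grad_add plus_fun_def)

lemma jet_scale: "test_function \<Omega> f \<Longrightarrow> jet (\<lambda>x. c * f x) = c *\<^sub>R jet f"
  by (simp add: jet_def grad_scale scaleR_fun_def)

lemma jet_zero: "jet (\<lambda>x. 0) = 0"
  by (simp add: jet_def grad_zero zero_prod_def zero_fun_def)

lemma energy_mass_diff:
  assumes "p \<in> L2_jets \<Omega>" "q \<in> L2_jets \<Omega>"
  shows "(\<integral>x. (fst p x - fst q x)\<^sup>2 + (norm (snd p x - snd q x))\<^sup>2 \<partial>lebesgue_on \<Omega>)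
    = sobolev_square \<Omega> (p - q)"
proof -
  have d: "p - q \<in> L2_jets \<Omega>" using assms by (rule subspace_diff[OF subspace_L2_jets])
  show ?thesis
    using energy_integrable[OF d d] mass_integrable[OF d d]
    by (simp add: energy_def mass_def power2_eq_square dot_square_norm)
qed

lemma weak_gradient_jet:
  assumes "open \<Omega>" "test_function \<Omega> \<phi>"
  shows "weak_gradient \<Omega> \<phi> (grad \<phi>)"
  unfolding weak_gradient_def
proof (intro allI impI ballI)
  fix \<psi> and b :: 'a assume \<psi>: "test_function \<Omega> \<psi>" and b: "b \<in> Basis"
  have "(\<integral>x. \<phi> x * frechet_derivative \<psi> (at x) b \<partial>lebesgue_on \<Omega>) = (\<integral>x. \<phi> x * frechet_derivative \<psi> (at x) b \<partial>lborel)"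
    by (rule lebesgue_on_eq_lborel(1)[OF assms(1)])
       (use test_function_outside[OF assms(2)] test_function_borel[OF assms(2)]
          test_function_borel[OF test_function_frechet_derivative[OF \<psi> b]] in auto)
  moreover have "(\<integral>x. (grad \<phi> x \<bullet> b) * \<psi> x \<partial>lebesgue_on \<Omega>) = (\<integral>x. (grad \<phi> x \<bullet> b) * \<psi> x \<partial>lborel)"
    by (rule lebesgue_on_eq_lborel(1)[OF assms(1)])
       (use test_function_outside[OF \<psi>] test_function_borel[OF \<psi>] test_function_grad_borel[OF assms(2)] in auto)
  ultimately show "(\<integral>x. \<phi> x * frechet_derivative \<psi> (at x) b \<partial>lebesgue_on \<Omega>)
      = - (\<integral>x. (grad \<phi> x \<bullet> b) * \<psi> x \<partial>lebesgue_on \<Omega>)"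
    using integration_by_parts[OF assms(2) \<psi> b] by simp
qed

text \<open>
  With \<open>q1\<close> and \<open>q2\<close> built from the test function, the two sides of the identity that defines weak
  gradients become products for the forms \<open>mass\<close> and \<open>energy\<close>, which are continuous.
\<close>

lemma jet_limit_weak_gradient:
  assumes \<Omega>: "open \<Omega>" and p: "p \<in> L2_jets \<Omega>" and \<phi>: "\<And>j. test_function \<Omega> (\<phi> j)"
    and lim: "(\<lambda>j. energy \<Omega> (jet (\<phi> j) - p) (jet (\<phi> j) - p)) \<longlonglongrightarrow> 0"
      "(\<lambda>j. mass \<Omega> (jet (\<phi> j) - p) (jet (\<phi> j) - p)) \<longlonglongrightarrow> 0"
  shows "weak_gradient \<Omega> (fst p) (snd p)"
  unfolding weak_gradient_def
proof (intro allI impI ballI)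
  interpret A: psd_form "L2_jets \<Omega>" "energy \<Omega>" by (rule psd_energy)
  interpret B: psd_form "L2_jets \<Omega>" "mass \<Omega>" by (rule psd_mass)
  fix \<psi> and b :: 'a assume \<psi>: "test_function \<Omega> \<psi>" and b: "b \<in> Basis"
  define q1 :: "'a jet" where "q1 = ((\<lambda>x. frechet_derivative \<psi> (at x) b), (\<lambda>x. 0))"
  define q2 :: "'a jet" where "q2 = ((\<lambda>x. 0), (\<lambda>x. \<psi> x *\<^sub>R b))"
  have q1: "q1 \<in> L2_jets \<Omega>"
    using test_function_L2(1)[OF \<Omega> test_function_frechet_derivative[OF \<psi> b]]
    by (simp add: q1_def L2_jets_def L2_iff square_integrable_zero)
  have q2: "q2 \<in> L2_jets \<Omega>"
    using test_function_L2(1)[OF \<Omega> \<psi>] b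
    by (auto simp: q2_def L2_jets_def L2_iff square_integrable_zero square_integrable_def)
  have J: "jet (\<phi> j) \<in> L2_jets \<Omega>" for j by (rule jet_in_L2_jets[OF \<Omega> \<phi>])
  have "(\<lambda>j. mass \<Omega> (jet (\<phi> j)) q1) \<longlonglongrightarrow> mass \<Omega> p q1"
    using q1 B.zero_left[of 0] B.S_closed(4) by (intro B.form_tendsto[OF J p lim(2)]) auto
  moreover have "(\<lambda>j. energy \<Omega> (jet (\<phi> j)) q2) \<longlonglongrightarrow> energy \<Omega> p q2"
    using q2 A.zero_left[of 0] A.S_closed(4) by (intro A.form_tendsto[OF J p lim(1)]) auto
  moreover have "mass \<Omega> (jet (\<phi> j)) q1 = - energy \<Omega> (jet (\<phi> j)) q2" for j
    using weak_gradient_jet[OF \<Omega> \<phi>, of j] \<psi> b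
    by (simp add: weak_gradient_def mass_def energy_def q1_def q2_def jet_def mult.commute)
  ultimately have "mass \<Omega> p q1 = - energy \<Omega> p q2"
    using LIMSEQ_unique[OF _ tendsto_minus] by simp
  then show "(\<integral>x. fst p x * frechet_derivative \<psi> (at x) b \<partial>lebesgue_on \<Omega>)
      = - (\<integral>x. (snd p x \<bullet> b) * \<psi> x \<partial>lebesgue_on \<Omega>)"
    by (simp add: mass_def energy_def q1_def q2_def mult.commute)
qed

text \<open>
  Approximability by test functions implies the weak gradient condition. What remains is the closure
  of the jets of test functions, for which linearity and completeness are formal.
\<close>

lemma sobolev_iff:
  assumes \<Omega>: "open \<Omega>"
  shows "p \<in> sobolev \<Omega> \<longleftrightarrow> p \<in> L2_jets \<Omega> \<and> (\<exists>\<phi>. (\<forall>j. test_function \<Omega> (\<phi> j)) \<and>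
    (\<lambda>j. sobolev_square \<Omega> (jet (\<phi> j) - p)) \<longlonglongrightarrow> 0)"
proof -
  interpret A: psd_form "L2_jets \<Omega>" "energy \<Omega>" by (rule psd_energy)
  interpret B: psd_form "L2_jets \<Omega>" "mass \<Omega>" by (rule psd_mass)
  have e: "(\<integral>x. (fst p x - \<phi> x)\<^sup>2 + (norm (snd p x - grad \<phi> x))\<^sup>2 \<partial>lebesgue_on \<Omega>)
      = sobolev_square \<Omega> (jet \<phi> - p)"
    if "p \<in> L2_jets \<Omega>" "test_function \<Omega> \<phi>" for \<phi>
    using energy_mass_diff[OF jet_in_L2_jets[OF \<Omega> that(2)] that(1)]
    by (simp add: jet_def power2_commute norm_minus_commute)
  show ?thesis
  proof
    assume "p \<in> sobolev \<Omega>"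
    then have H: "H1_0 \<Omega> (fst p) (snd p)" by (simp add: sobolev_def)
    then have p: "p \<in> L2_jets \<Omega>" by (simp add: H1_0_def H1_def L2_jets_def)
    obtain \<phi> where \<phi>: "\<And>j. test_function \<Omega> (\<phi> j)"
      "(\<lambda>j. \<integral>x. (fst p x - \<phi> j x)\<^sup>2 + (norm (snd p x - grad (\<phi> j) x))\<^sup>2 \<partial>lebesgue_on \<Omega>) \<longlonglongrightarrow> 0"
      using H unfolding H1_0_def by blast
    then show "p \<in> L2_jets \<Omega> \<and> (\<exists>\<phi>. (\<forall>j. test_function \<Omega> (\<phi> j)) \<and>
       (\<lambda>j. sobolev_square \<Omega> (jet (\<phi> j) - p)) \<longlonglongrightarrow> 0)"
      using p e[OF p \<phi>(1)] by auto
  next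
    assume "p \<in> L2_jets \<Omega> \<and> (\<exists>\<phi>. (\<forall>j. test_function \<Omega> (\<phi> j)) \<and>
       (\<lambda>j. sobolev_square \<Omega> (jet (\<phi> j) - p)) \<longlonglongrightarrow> 0)"
    then obtain \<phi> where p: "p \<in> L2_jets \<Omega>" and \<phi>: "\<And>j. test_function \<Omega> (\<phi> j)" and
      lim: "(\<lambda>j. sobolev_square \<Omega> (jet (\<phi> j) - p)) \<longlonglongrightarrow> 0" by blast
    have J: "jet (\<phi> j) - p \<in> L2_jets \<Omega>" for j using jet_in_L2_jets[OF \<Omega> \<phi>] p by auto
    have "(\<lambda>j. energy \<Omega> (jet (\<phi> j) - p) (jet (\<phi> j) - p)) \<longlonglongrightarrow> 0"
      "(\<lambda>j. mass \<Omega> (jet (\<phi> j) - p) (jet (\<phi> j) - p)) \<longlonglongrightarrow> 0"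
      by (rule tendsto_sandwich[OF _ _ tendsto_const lim]; use A.nonneg[OF J] B.nonneg[OF J] in simp)+
    then have "weak_gradient \<Omega> (fst p) (snd p)" by (rule jet_limit_weak_gradient[OF \<Omega> p \<phi>])
    then have "H1 \<Omega> (fst p) (snd p)" using p by (simp add: H1_def L2_jets_def)
    then show "p \<in> sobolev \<Omega>" unfolding sobolev_def H1_0_def using \<phi> lim by (auto intro!: exI[of _ \<phi>] simp: e[OF p \<phi>])
  qed
qed

lemma jet_in_sobolev:
  assumes "open \<Omega>" "test_function \<Omega> \<phi>"
  shows "jet \<phi> \<in> sobolev \<Omega>"
proof -
  interpret A: psd_form "L2_jets \<Omega>" "energy \<Omega>" by (rule psd_energy)
  interpret B: psd_form "L2_jets \<Omega>" "mass \<Omega>" by (rule psd_mass)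
  show ?thesis unfolding sobolev_iff[OF assms(1)]
    using assms A.zero_left[OF A.S_closed(4)] B.zero_left[OF B.S_closed(4)]
    by (auto intro!: jet_in_L2_jets exI[of _ "\<lambda>j. \<phi>"])
qed

lemma subspace_sobolev:
  assumes \<Omega>: "open \<Omega>"
  shows "subspace (sobolev \<Omega>)"
proof (rule subspaceI)
  interpret A: psd_form "L2_jets \<Omega>" "energy \<Omega>" by (rule psd_energy)
  interpret B: psd_form "L2_jets \<Omega>" "mass \<Omega>" by (rule psd_mass)
  show "0 \<in> sobolev \<Omega>" using jet_in_sobolev[OF \<Omega> test_function_zero] by (simp add: jet_zero)
  fix p assume "p \<in> sobolev \<Omega>"
  then obtain \<phi> where p: "p \<in> L2_jets \<Omega>" and \<phi>: "\<And>j. test_function \<Omega> (\<phi> j)" and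
    limp: "(\<lambda>j. sobolev_square \<Omega> (jet (\<phi> j) - p)) \<longlonglongrightarrow> 0" unfolding sobolev_iff[OF \<Omega>] by blast
  have Jp: "jet (\<phi> j) - p \<in> L2_jets \<Omega>" for j using jet_in_L2_jets[OF \<Omega> \<phi>] p by auto
  show "c *\<^sub>R p \<in> sobolev \<Omega>" for c
  proof -
    have "(\<lambda>j. c\<^sup>2 * sobolev_square \<Omega> (jet (\<phi> j) - p)) \<longlonglongrightarrow> 0" using tendsto_mult_right_zero[OF limp] .
    moreover have "sobolev_square \<Omega> (jet (\<lambda>x. c * \<phi> j x) - c *\<^sub>R p) = c\<^sup>2 * sobolev_square \<Omega> (jet (\<phi> j) - p)" for j
    proof -
      have "jet (\<lambda>x. c * \<phi> j x) - c *\<^sub>R p = c *\<^sub>R (jet (\<phi> j) - p)"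
        by (simp add: jet_scale[OF \<phi>] scaleR_diff_right)
      then show ?thesis using Jp[of j]
        by (simp only: A.scale_left A.scale_right B.scale_left B.scale_right A.S_closed power2_eq_square distrib_left mult.assoc)
    qed
    ultimately show ?thesis unfolding sobolev_iff[OF \<Omega>] using p \<phi>
      by (auto intro!: exI[of _ "\<lambda>j x. c * \<phi> j x"] test_function_scale)
  qed
  fix q assume "q \<in> sobolev \<Omega>"
  then obtain \<psi> where q: "q \<in> L2_jets \<Omega>" and \<psi>: "\<And>j. test_function \<Omega> (\<psi> j)" and
    limq: "(\<lambda>j. sobolev_square \<Omega> (jet (\<psi> j) - q)) \<longlonglongrightarrow> 0" unfolding sobolev_iff[OF \<Omega>] by blast
  have Jq: "jet (\<psi> j) - q \<in> L2_jets \<Omega>" for j using jet_in_L2_jets[OF \<Omega> \<psi>] q by auto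
  have "(\<lambda>j. 2 * sobolev_square \<Omega> (jet (\<phi> j) - p) + 2 * sobolev_square \<Omega> (jet (\<psi> j) - q)) \<longlonglongrightarrow> 2 * 0 + 2 * 0"
    by (intro tendsto_intros limp limq)
  then have lim2: "(\<lambda>j. 2 * sobolev_square \<Omega> (jet (\<phi> j) - p) + 2 * sobolev_square \<Omega> (jet (\<psi> j) - q)) \<longlonglongrightarrow> 0" by simp
  have "(\<lambda>j. sobolev_square \<Omega> (jet (\<lambda>x. \<phi> j x + \<psi> j x) - (p + q))) \<longlonglongrightarrow> 0"
  proof (rule tendsto_sandwich[OF _ _ tendsto_const lim2]; rule always_eventually; rule allI)
    fix j
    have e: "jet (\<lambda>x. \<phi> j x + \<psi> j x) - (p + q) = (jet (\<phi> j) - p) + (jet (\<psi> j) - q)"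
      by (simp add: jet_add[OF \<phi> \<psi>])
    show "sobolev_square \<Omega> (jet (\<lambda>x. \<phi> j x + \<psi> j x) - (p + q)) \<le> 2 * sobolev_square \<Omega> (jet (\<phi> j) - p) + 2 * sobolev_square \<Omega> (jet (\<psi> j) - q)"
      unfolding e using A.add_le[OF Jp Jq, of j j] B.add_le[OF Jp Jq, of j j] by (simp add: algebra_simps)
    show "0 \<le> sobolev_square \<Omega> (jet (\<lambda>x. \<phi> j x + \<psi> j x) - (p + q))"
      unfolding e using A.nonneg B.nonneg Jp Jq by (intro add_nonneg_nonneg) auto
  qed
  then show "p + q \<in> sobolev \<Omega>" unfolding sobolev_iff[OF \<Omega>] using p q \<phi> \<psi>
    by (auto intro!: exI[of _ "\<lambda>j x. \<phi> j x + \<psi> j x"] test_function_add)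
qed

text \<open>
  The weak gradient of a null function vanishes: its product with the gradient of a test function
  \<open>\<psi>\<close> is minus the product of the null function with the second derivatives of \<open>\<psi>\<close>, and the gradient
  itself is a limit of gradients of test functions.
\<close>

lemma sobolev_mass_null:
  assumes \<Omega>: "open \<Omega>" and p: "p \<in> sobolev \<Omega>" and null: "mass \<Omega> p p = 0"
  shows "energy \<Omega> p p = 0"
proof -
  interpret A: psd_form "L2_jets \<Omega>" "energy \<Omega>" by (rule psd_energy)
  interpret B: psd_form "L2_jets \<Omega>" "mass \<Omega>" by (rule psd_mass)
  obtain \<phi> where pL: "p \<in> L2_jets \<Omega>" and \<phi>: "\<And>j. test_function \<Omega> (\<phi> j)" and
    lim: "(\<lambda>j. sobolev_square \<Omega> (jet (\<phi> j) - p)) \<longlonglongrightarrow> 0"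
    using p unfolding sobolev_iff[OF \<Omega>] by blast
  have J: "jet (\<phi> j) \<in> L2_jets \<Omega>" for j by (rule jet_in_L2_jets[OF \<Omega> \<phi>])
  have Jd: "jet (\<phi> j) - p \<in> L2_jets \<Omega>" for j using J pL by auto
  have lA: "(\<lambda>j. energy \<Omega> (jet (\<phi> j) - p) (jet (\<phi> j) - p)) \<longlonglongrightarrow> 0"
    by (rule tendsto_sandwich[OF _ _ tendsto_const lim]; use A.nonneg[OF Jd] B.nonneg[OF Jd] in simp)
  have "energy \<Omega> p (jet \<psi>) = 0" if \<psi>: "test_function \<Omega> \<psi>" for \<psi>
  proof -
    have gb: "grad \<psi> x \<bullet> b = frechet_derivative \<psi> (at x) b" if "b \<in> Basis" for x b
      using grad_inner[OF test_function_differentiable[OF \<psi>]] by simp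
    have int: "integrable (lebesgue_on \<Omega>) (\<lambda>x. (snd p x \<bullet> b) * frechet_derivative \<psi> (at x) b)" if b: "b \<in> Basis" for b
    proof -
      have "((\<lambda>x. 0), (\<lambda>x. frechet_derivative \<psi> (at x) b *\<^sub>R b)) \<in> L2_jets \<Omega>"
        using test_function_L2(1)[OF \<Omega> test_function_frechet_derivative[OF \<psi> b]] b
        by (auto simp: L2_jets_def L2_iff square_integrable_zero square_integrable_def)
      from energy_integrable[OF pL this] show ?thesis by (simp add: mult.commute)
    qed
    have zero: "(\<integral>x. (snd p x \<bullet> b) * frechet_derivative \<psi> (at x) b \<partial>lebesgue_on \<Omega>) = 0" if b: "b \<in> Basis" for b
    proof -
      let ?\<eta> = "\<lambda>x. frechet_derivative \<psi> (at x) b"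
      have \<eta>: "test_function \<Omega> ?\<eta>" by (rule test_function_frechet_derivative[OF \<psi> b])
      have "(\<integral>x. fst p x * frechet_derivative ?\<eta> (at x) b \<partial>lebesgue_on \<Omega>) = - (\<integral>x. (snd p x \<bullet> b) * ?\<eta> x \<partial>lebesgue_on \<Omega>)"
        using p \<eta> b unfolding sobolev_def H1_0_def H1_def weak_gradient_def by blast
      moreover have "mass \<Omega> p (jet (\<lambda>x. frechet_derivative ?\<eta> (at x) b)) = 0"
        by (rule B.null_orthogonal[OF pL jet_in_L2_jets[OF \<Omega> test_function_frechet_derivative[OF \<eta> b]] null])
      ultimately show ?thesis by (simp add: mass_def jet_def)
    qed
    have "energy \<Omega> p (jet \<psi>) = (\<integral>x. (\<Sum>b\<in>Basis. (snd p x \<bullet> b) * frechet_derivative \<psi> (at x) b) \<partial>lebesgue_on \<Omega>)"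
      unfolding energy_def jet_def by (subst euclidean_inner) (simp add: gb cong: sum.cong)
    also have "\<dots> = 0" using int zero by (simp add: Bochner_Integration.integral_sum)
    finally show ?thesis .
  qed
  then have "(\<lambda>j. energy \<Omega> (jet (\<phi> j)) p) = (\<lambda>j. 0)" using \<phi> A.sym[OF pL J] by metis
  moreover have "(\<lambda>j. energy \<Omega> (jet (\<phi> j)) p) \<longlonglongrightarrow> energy \<Omega> p p"
    using pL A.zero_left[of 0] A.S_closed(4) by (intro A.form_tendsto[OF J pL lA]) auto
  ultimately show ?thesis by (simp add: LIMSEQ_const_iff)
qed

lemma sobolev_complete:
  assumes \<Omega>: "open \<Omega>" and X: "\<And>n. X n \<in> sobolev \<Omega>"
    and cauchy: "\<And>e. e > 0 \<Longrightarrow> \<exists>N. \<forall>m\<ge>N. \<forall>n\<ge>N.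
      sobolev_square \<Omega> (X m - X n) < e"
  shows "\<exists>p\<in>sobolev \<Omega>. (\<lambda>n. sobolev_square \<Omega> (X n - p)) \<longlonglongrightarrow> 0"
proof -
  interpret A: psd_form "L2_jets \<Omega>" "energy \<Omega>" by (rule psd_energy)
  interpret B: psd_form "L2_jets \<Omega>" "mass \<Omega>" by (rule psd_mass)
  have XL: "X n \<in> L2_jets \<Omega>" for n using X[of n] unfolding sobolev_iff[OF \<Omega>] by blast
  have XD: "X m - X n \<in> L2_jets \<Omega>" for m n using XL by auto
  have mB: "mass \<Omega> (p - q) (p - q) = (\<integral>x. (norm (fst p x - fst q x))\<^sup>2 \<partial>lebesgue_on \<Omega>)" for p q
    by (simp add: mass_def power2_eq_square)
  have mA: "energy \<Omega> (p - q) (p - q) = (\<integral>x. (norm (snd p x - snd q x))\<^sup>2 \<partial>lebesgue_on \<Omega>)" for p q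
    by (simp add: energy_def power2_norm_eq_inner)
  have "\<exists>g. square_integrable (lebesgue_on \<Omega>) g \<and> (\<lambda>n. \<integral>x. (norm (fst (X n) x - g x))\<^sup>2 \<partial>lebesgue_on \<Omega>) \<longlonglongrightarrow> 0"
  proof (rule L2_complete)
    fix e :: real assume "e > 0"
    then obtain N where "\<forall>m\<ge>N. \<forall>n\<ge>N. sobolev_square \<Omega> (X m - X n) < e" using cauchy by blast
    then have "\<forall>m\<ge>N. \<forall>n\<ge>N. mass \<Omega> (X m - X n) (X m - X n) < e" using A.nonneg[OF XD] by (smt (verit))
    then show "\<exists>N. \<forall>m\<ge>N. \<forall>n\<ge>N. (\<integral>x. (norm (fst (X m) x - fst (X n) x))\<^sup>2 \<partial>lebesgue_on \<Omega>) < e"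
      unfolding mB by blast
  qed (use XL in \<open>simp add: L2_jets_def L2_iff\<close>)
  then obtain u where u: "square_integrable (lebesgue_on \<Omega>) u"
    "(\<lambda>n. \<integral>x. (norm (fst (X n) x - u x))\<^sup>2 \<partial>lebesgue_on \<Omega>) \<longlonglongrightarrow> 0" by blast
  have "\<exists>g. square_integrable (lebesgue_on \<Omega>) g \<and> (\<lambda>n. \<integral>x. (norm (snd (X n) x - g x))\<^sup>2 \<partial>lebesgue_on \<Omega>) \<longlonglongrightarrow> 0"
  proof (rule L2_complete)
    fix e :: real assume "e > 0"
    then obtain N where "\<forall>m\<ge>N. \<forall>n\<ge>N. sobolev_square \<Omega> (X m - X n) < e" using cauchy by blast
    then have "\<forall>m\<ge>N. \<forall>n\<ge>N. energy \<Omega> (X m - X n) (X m - X n) < e" using B.nonneg[OF XD] by (smt (verit))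
    then show "\<exists>N. \<forall>m\<ge>N. \<forall>n\<ge>N. (\<integral>x. (norm (snd (X m) x - snd (X n) x))\<^sup>2 \<partial>lebesgue_on \<Omega>) < e"
      unfolding mA by blast
  qed (use XL in \<open>simp add: L2_jets_def L2_iff\<close>)
  then obtain g where g: "square_integrable (lebesgue_on \<Omega>) g"
    "(\<lambda>n. \<integral>x. (norm (snd (X n) x - g x))\<^sup>2 \<partial>lebesgue_on \<Omega>) \<longlonglongrightarrow> 0" by blast
  define p where "p = (u, g)"
  have pL: "p \<in> L2_jets \<Omega>" using u g by (simp add: p_def L2_jets_def L2_iff)
  have XpL: "X n - p \<in> L2_jets \<Omega>" for n using XL pL by auto
  have lim: "(\<lambda>n. sobolev_square \<Omega> (X n - p)) \<longlonglongrightarrow> 0"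
    using tendsto_add[OF g(2) u(2)] by (simp add: mA mB p_def)
  have "\<exists>\<psi>. test_function \<Omega> \<psi> \<and> sobolev_square \<Omega> (jet \<psi> - X n) < 1 / real (Suc n)" for n
  proof -
    obtain \<phi> where \<phi>: "\<And>j. test_function \<Omega> (\<phi> j)" and l: "(\<lambda>j. sobolev_square \<Omega> (jet (\<phi> j) - X n)) \<longlonglongrightarrow> 0"
      using X[of n] unfolding sobolev_iff[OF \<Omega>] by blast
    have "\<forall>\<^sub>F j in sequentially. sobolev_square \<Omega> (jet (\<phi> j) - X n) < 1 / real (Suc n)"
      using order_tendstoD(2)[OF l, of "1 / real (Suc n)"] by simp
    then show ?thesis using \<phi> by (auto simp: eventually_sequentially)
  qed
  then obtain \<psi> where \<psi>: "\<And>n. test_function \<Omega> (\<psi> n)" "\<And>n. sobolev_square \<Omega> (jet (\<psi> n) - X n) < 1 / real (Suc n)"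
    by metis
  have J: "jet (\<psi> n) - X n \<in> L2_jets \<Omega>" for n using jet_in_L2_jets[OF \<Omega> \<psi>(1)] XL by auto
  have "(\<lambda>n. 2 * (1 / real (Suc n)) + 2 * sobolev_square \<Omega> (X n - p)) \<longlonglongrightarrow> 2 * 0 + 2 * 0"
    using LIMSEQ_Suc[OF lim_1_over_n] by (intro tendsto_intros lim) simp
  then have lim2: "(\<lambda>n. 2 * (1 / real (Suc n)) + 2 * sobolev_square \<Omega> (X n - p)) \<longlonglongrightarrow> 0" by simp
  have "(\<lambda>n. sobolev_square \<Omega> (jet (\<psi> n) - p)) \<longlonglongrightarrow> 0"
  proof (rule tendsto_sandwich[OF _ _ tendsto_const lim2]; rule always_eventually; rule allI)
    fix n
    have e: "jet (\<psi> n) - p = (jet (\<psi> n) - X n) + (X n - p)" by simp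
    show "sobolev_square \<Omega> (jet (\<psi> n) - p) \<le> 2 * (1 / real (Suc n)) + 2 * sobolev_square \<Omega> (X n - p)"
      unfolding e using A.add_le[OF J XpL, of n n] B.add_le[OF J XpL, of n n] \<psi>(2)[of n] by argo
    have "jet (\<psi> n) - p \<in> L2_jets \<Omega>" using A.S_closed(1)[OF J XpL, of n n] by simp
    then show "0 \<le> sobolev_square \<Omega> (jet (\<psi> n) - p)" using A.nonneg B.nonneg by (intro add_nonneg_nonneg) auto
  qed
  then have "p \<in> sobolev \<Omega>" unfolding sobolev_iff[OF \<Omega>] using pL \<psi>(1) by blast
  then show ?thesis using lim by blast
qed

text \<open>
  The functionals of \<open>compactness_inequality\<close> are products, for the form \<open>mass\<close>, with indicator
  functions of cells. Hence they are bounded, and the inequality passes from test functions to their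
  closure.
\<close>

theorem sobolev_form_pair:
  fixes \<Omega> :: "'a::euclidean_space set"
  assumes \<Omega>: "open \<Omega>" "bounded \<Omega>"
  shows "form_pair (sobolev \<Omega>) (energy \<Omega>) (mass \<Omega>)"
proof -
  interpret A: psd_form "L2_jets \<Omega>" "energy \<Omega>" by (rule psd_energy)
  interpret B: psd_form "L2_jets \<Omega>" "mass \<Omega>" by (rule psd_mass)
  have sub: "p \<in> L2_jets \<Omega>" if "p \<in> sobolev \<Omega>" for p using that unfolding sobolev_iff[OF \<Omega>(1)] by blast
  show ?thesis
  proof
    show "subspace (sobolev \<Omega>)" by (rule subspace_sobolev[OF \<Omega>(1)])
  next
    fix \<epsilon> :: real assume "\<epsilon> > 0"
    obtain C :: "'a set set" and c where C: "finite C" "c > 0" "\<And>Q. Q \<in> C \<Longrightarrow> Q \<in> sets borel \<and> emeasure lborel Q < \<infinity>"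
      and ineq: "\<And>\<phi>. test_function \<Omega> \<phi> \<Longrightarrow> square_integral \<phi> \<le> \<epsilon> * dirichlet_integral \<phi>
        + (\<Sum>Q\<in>C. c * (\<integral>x. indicator Q x * \<phi> x \<partial>lborel)\<^sup>2)"
      using compactness_inequality[OF \<Omega>(2) \<open>\<epsilon> > 0\<close>] by blast
    define q :: "'a set \<Rightarrow> 'a jet" where "q = (\<lambda>Q. (indicator Q, (\<lambda>x. 0)))"
    have q: "q Q \<in> L2_jets \<Omega>" if "Q \<in> C" for Q
    proof -
      have "integrable lborel (indicat_real Q)" using C(3)[OF that] by simp
      then have "integrable lebesgue (indicat_real Q)" using C(3)[OF that] by (simp add: integrable_completion)
      then have "integrable (lebesgue_on \<Omega>) (indicat_real Q)" using \<Omega>(1)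
        using integrable_mult_indicator[of \<Omega> lebesgue "indicat_real Q"]
        by (simp add: integrable_restrict_space)
      moreover have "(\<lambda>x. (indicat_real Q x)\<^sup>2) = indicat_real Q" by (auto simp: indicator_def)
      moreover have "indicat_real Q \<in> borel_measurable (lebesgue_on \<Omega>)" using C(3)[OF that]
        by (intro borel_measurable_lebesgue_on) auto
      ultimately have "L2 \<Omega> (indicat_real Q)" by (simp add: L2_def)
      then show ?thesis by (simp add: q_def L2_jets_def L2_iff square_integrable_zero)
    qed
    define l where "l = (\<lambda>Q p. sqrt c * mass \<Omega> p (q Q))"
    have est: "mass \<Omega> p p \<le> \<epsilon> * energy \<Omega> p p + (\<Sum>Q\<in>C. (l Q p)\<^sup>2)" if p: "p \<in> sobolev \<Omega>" for p
    proof -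
      obtain \<phi> where \<phi>: "\<And>j. test_function \<Omega> (\<phi> j)" and
        lim: "(\<lambda>j. sobolev_square \<Omega> (jet (\<phi> j) - p)) \<longlonglongrightarrow> 0"
        using p unfolding sobolev_iff[OF \<Omega>(1)] by blast
      have pL: "p \<in> L2_jets \<Omega>" using sub p by blast
      have J: "jet (\<phi> j) \<in> L2_jets \<Omega>" for j by (rule jet_in_L2_jets[OF \<Omega>(1) \<phi>])
      have Jd: "jet (\<phi> j) - p \<in> L2_jets \<Omega>" for j using J pL by auto
      have lA: "(\<lambda>j. energy \<Omega> (jet (\<phi> j) - p) (jet (\<phi> j) - p)) \<longlonglongrightarrow> 0"
        and lB: "(\<lambda>j. mass \<Omega> (jet (\<phi> j) - p) (jet (\<phi> j) - p)) \<longlonglongrightarrow> 0"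
        by (rule tendsto_sandwich[OF _ _ tendsto_const lim]; use A.nonneg[OF Jd] B.nonneg[OF Jd] in simp)+
      have l1: "(\<lambda>j. l Q (jet (\<phi> j))) \<longlonglongrightarrow> l Q p" if "Q \<in> C" for Q
        unfolding l_def using q[OF that] B.zero_left[of 0] B.S_closed(4)
        by (intro tendsto_mult tendsto_const B.form_tendsto[OF J pL lB]) auto
      have "(\<lambda>j. \<epsilon> * energy \<Omega> (jet (\<phi> j)) (jet (\<phi> j)) + (\<Sum>Q\<in>C. (l Q (jet (\<phi> j)))\<^sup>2))
          \<longlonglongrightarrow> \<epsilon> * energy \<Omega> p p + (\<Sum>Q\<in>C. (l Q p)\<^sup>2)"
        by (intro tendsto_add tendsto_mult tendsto_const tendsto_sum tendsto_power l1 A.form_tendsto[OF J pL lA J pL lA])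
      moreover have "(\<lambda>j. mass \<Omega> (jet (\<phi> j)) (jet (\<phi> j))) \<longlonglongrightarrow> mass \<Omega> p p"
        by (rule B.form_tendsto[OF J pL lB J pL lB])
      moreover have "mass \<Omega> (jet (\<phi> j)) (jet (\<phi> j)) \<le> \<epsilon> * energy \<Omega> (jet (\<phi> j)) (jet (\<phi> j)) + (\<Sum>Q\<in>C. (l Q (jet (\<phi> j)))\<^sup>2)" for j
      proof -
        have "(l Q (jet (\<phi> j)))\<^sup>2 = c * (\<integral>x. indicator Q x * \<phi> j x \<partial>lborel)\<^sup>2" if "Q \<in> C" for Q
        proof -
          have "mass \<Omega> (jet (\<phi> j)) (q Q) = (\<integral>x. \<phi> j x * indicator Q x \<partial>lborel)"
            unfolding mass_def jet_def q_def fst_conv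
            by (rule lebesgue_on_eq_lborel(1)[OF \<Omega>(1)])
               (use test_function_outside[OF \<phi>] test_function_borel[OF \<phi>] C(3)[OF that] in auto)
          then show ?thesis using C(2) by (simp add: l_def power_mult_distrib mult.commute)
        qed
        then show ?thesis using ineq[OF \<phi>[of j]] by (simp add: mass_jet[OF \<Omega>(1) \<phi>] energy_jet[OF \<Omega>(1) \<phi>])
      qed
      ultimately show ?thesis by (intro LIMSEQ_le) auto
    qed
    obtain f where f: "bij_betw f {0..<card C} C" using ex_bij_betw_nat_finite[OF C(1)] by blast
    define K where "K = Max (insert 0 ((\<lambda>Q. c * mass \<Omega> (q Q) (q Q)) ` C))"
    have fC: "f i \<in> C" if "i < card C" for i using f that by (auto simp: bij_betw_def)
    have "(l Q p)\<^sup>2 \<le> K * (energy \<Omega> p p + mass \<Omega> p p)" if "Q \<in> C" "p \<in> sobolev \<Omega>" for Q p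
    proof -
      have K: "c * mass \<Omega> (q Q) (q Q) \<le> K" "0 \<le> K" unfolding K_def using C(1) that by (auto intro!: Max_ge)
      have "(l Q p)\<^sup>2 = c * (mass \<Omega> p (q Q))\<^sup>2" using C(2) by (simp add: l_def power_mult_distrib)
      also have "\<dots> \<le> c * (mass \<Omega> p p * mass \<Omega> (q Q) (q Q))"
        using C(2) B.Cauchy_Schwarz[OF sub[OF that(2)] q[OF that(1)]] by (intro mult_left_mono) auto
      also have "\<dots> = (c * mass \<Omega> (q Q) (q Q)) * mass \<Omega> p p" by simp
      also have "\<dots> \<le> K * (energy \<Omega> p p + mass \<Omega> p p)"
        using K A.nonneg[OF sub[OF that(2)]] B.nonneg[OF sub[OF that(2)]] by (intro mult_mono) auto
      finally show ?thesis .
    qed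
    moreover have "l Q (p + p') = l Q p + l Q p'" if "Q \<in> C" "p \<in> sobolev \<Omega>" "p' \<in> sobolev \<Omega>" for Q p p'
      using that sub q by (simp add: l_def B.add_left distrib_left)
    moreover have "l Q (a *\<^sub>R p) = a * l Q p" if "Q \<in> C" "p \<in> sobolev \<Omega>" for Q p a
      using that sub q by (simp add: l_def B.scale_left)
    moreover have "(\<Sum>i<card C. (l (f i) p)\<^sup>2) = (\<Sum>Q\<in>C. (l Q p)\<^sup>2)" for p
      using sum.reindex_bij_betw[OF f, of "\<lambda>Q. (l Q p)\<^sup>2"] by (simp add: atLeast0LessThan)
    ultimately show "\<exists>(k::nat) l K.
        (\<forall>i<k. (\<forall>p\<in>sobolev \<Omega>. \<forall>q\<in>sobolev \<Omega>. l i (p + q) = l i p + l i q) \<and>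
               (\<forall>c. \<forall>p\<in>sobolev \<Omega>. l i (c *\<^sub>R p) = c * l i p) \<and>
               (\<forall>p\<in>sobolev \<Omega>. (l i p)\<^sup>2 \<le> K * (energy \<Omega> p p + mass \<Omega> p p))) \<and>
        (\<forall>p\<in>sobolev \<Omega>. mass \<Omega> p p \<le> \<epsilon> * energy \<Omega> p p + (\<Sum>i<k. (l i p)\<^sup>2))"
      using est fC by (intro exI[of _ "card C"] exI[of _ "\<lambda>i. l (f i)"] exI[of _ K]) auto
  next
    fix X :: "nat \<Rightarrow> 'a jet"
    assume "\<And>n. X n \<in> sobolev \<Omega>" "\<And>e. e > 0 \<Longrightarrow> \<exists>N. \<forall>m\<ge>N. \<forall>n\<ge>N.
      sobolev_square \<Omega> (X m - X n) < e"
    then show "\<exists>p\<in>sobolev \<Omega>. (\<lambda>n. sobolev_square \<Omega> (X n - p)) \<longlonglongrightarrow> 0"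
      by (rule sobolev_complete[OF \<Omega>(1)])
  qed (use sub A.add_left B.add_left A.scale_left B.scale_left A.sym B.sym A.nonneg B.nonneg
         sobolev_mass_null[OF \<Omega>(1)] in simp_all)
qed

section \<open>Dirichlet eigenvalues and eigensystems\<close>

lemma dirichlet_eigenspace_eq:
  assumes "open \<Omega>" "bounded \<Omega>"
  shows "dirichlet_eigenspace \<Omega> \<mu> = fst ` form_pair.eigen (sobolev \<Omega>) (energy \<Omega>) (mass \<Omega>) \<mu>"
proof -
  interpret f: form_pair "sobolev \<Omega>" "energy \<Omega>" "mass \<Omega>" by (rule sobolev_form_pair[OF assms])
  have "u \<in> dirichlet_eigenspace \<Omega> \<mu> \<longleftrightarrow> (\<exists>g. (u, g) \<in> f.eigen \<mu>)" for u
    unfolding dirichlet_eigenspace_def f.eigen_def by (simp add: sobolev_def energy_def mass_def)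
  then show ?thesis by force
qed

lemma fst_sum_scale: "fst (\<Sum>i\<in>I. c i *\<^sub>R (p i :: 'a::euclidean_space jet)) x = (\<Sum>i\<in>I. c i * fst (p i) x)"
  by (induction I rule: infinite_finite_induct) auto

text \<open>
  The combination has square integral equal to the sum of the squared coefficients.
\<close>

lemma eigensystem_AE_independent:
  assumes \<Omega>: "open \<Omega>" "bounded \<Omega>"
    and sys: "form_pair.eigensystem (sobolev \<Omega>) (energy \<Omega>) (mass \<Omega>) I e \<nu>"
    and null: "AE x in lebesgue_on \<Omega>. (\<Sum>i\<in>I. c i * fst (e i) x) = 0"
  shows "\<forall>i\<in>I. c i = 0"
proof -
  interpret f: form_pair "sobolev \<Omega>" "energy \<Omega>" "mass \<Omega>" by (rule sobolev_form_pair[OF \<Omega>])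
  let ?p = "\<Sum>i\<in>I. c i *\<^sub>R e i"
  have fin: "finite I" by (rule f.eigensystem_finite[OF sys])
  have "?p \<in> sobolev \<Omega>" using f.eigensystem_in_S[OF sys] by auto
  then have "?p \<in> L2_jets \<Omega>" using sobolev_iff[OF \<Omega>(1)] by blast
  moreover have "AE x in lebesgue_on \<Omega>. fst ?p x = 0" using null by (simp add: fst_sum_scale)
  ultimately have "mass \<Omega> ?p ?p = 0" by (simp add: mass_eq_0_iff)
  then have "(\<Sum>i\<in>I. (c i)\<^sup>2) = 0" by (simp add: f.eigensystem_sum_B[OF sys])
  then show ?thesis using fin by (simp add: sum_nonneg_eq_0_iff)
qed

text \<open>
  Orthonormal eigenvectors of a complete system give a basis of the eigenspace modulo null functions.
  That the size of such a basis is unique is a dimension count in both directions.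
\<close>

theorem dirichlet_multiplicity_iff:
  assumes \<Omega>: "open \<Omega>" "bounded \<Omega>"
    and sys: "form_pair.complete_below (sobolev \<Omega>) (energy \<Omega>) (mass \<Omega>) b I e \<nu>" and \<mu>: "\<mu> < b"
  shows "dirichlet_multiplicity \<Omega> \<mu> J \<longleftrightarrow> J = card {i\<in>I. \<nu> i = \<mu>}"
proof -
  interpret f: form_pair "sobolev \<Omega>" "energy \<Omega>" "mass \<Omega>" by (rule sobolev_form_pair[OF \<Omega>])
  let ?K = "{i\<in>I. \<nu> i = \<mu>}"
  have es: "f.eigensystem I e \<nu>" using sys by (simp add: f.complete_below_def)
  have K: "f.eigensystem ?K e \<nu>" by (rule f.eigensystem_subset[OF es]) auto
  have finK: "finite ?K" by (rule f.eigensystem_finite[OF K])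
  have eK: "e i \<in> f.eigen \<mu>" if "i \<in> ?K" for i using K that by (auto simp: f.eigensystem_def)
  have L2: "p \<in> L2_jets \<Omega>" if "p \<in> sobolev \<Omega>" for p using that sobolev_iff[OF \<Omega>(1)] by blast
  have E: "dirichlet_eigenspace \<Omega> \<mu> = fst ` f.eigen \<mu>" by (rule dirichlet_eigenspace_eq[OF \<Omega>])
  have spanK: "AE x in lebesgue_on \<Omega>. fst p x = (\<Sum>i\<in>?K. mass \<Omega> p (e i) * fst (e i) x)" if p: "p \<in> f.eigen \<mu>" for p
  proof -
    let ?r = "p - (\<Sum>i\<in>?K. mass \<Omega> p (e i) *\<^sub>R e i)"
    have "mass \<Omega> ?r ?r = 0" by (rule f.eigenspace_basis[OF sys \<mu> p])
    moreover have "?r \<in> sobolev \<Omega>" using f.eigen_in_S[OF p] f.eigensystem_in_S[OF K] by auto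
    ultimately have "AE x in lebesgue_on \<Omega>. fst ?r x = 0" using mass_eq_0_iff[OF L2] by blast
    then show ?thesis by (simp add: fst_sum_scale)
  qed
  show ?thesis
  proof
    assume "dirichlet_multiplicity \<Omega> \<mu> J"
    then obtain u where u: "\<And>i. i \<in> {1..J} \<Longrightarrow> u i \<in> dirichlet_eigenspace \<Omega> \<mu>"
      and ind: "\<And>c. (AE x in lebesgue_on \<Omega>. (\<Sum>i\<in>{1..J}. c i * u i x) = 0) \<Longrightarrow> \<forall>i\<in>{1..J}. c i = 0"
      and span: "\<And>v. v \<in> dirichlet_eigenspace \<Omega> \<mu> \<Longrightarrow> \<exists>c. AE x in lebesgue_on \<Omega>. v x = (\<Sum>i\<in>{1..J}. c i * u i x)"
      unfolding dirichlet_multiplicity_def by blast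
    have "\<forall>i\<in>{1..J}. \<exists>p\<in>f.eigen \<mu>. fst p = u i" using u unfolding E by (metis imageE)
    from bchoice[OF this[unfolded Bex_def]] obtain p where p: "\<forall>i\<in>{1..J}. p i \<in> f.eigen \<mu> \<and> fst (p i) = u i" by blast
    show "J = card ?K"
    proof (rule antisym)
      show "J \<le> card ?K"
      proof (rule ccontr)
        assume "\<not> J \<le> card ?K"
        then obtain c where c: "\<exists>i\<in>{1..J}. c i \<noteq> 0" "\<forall>j\<in>?K. (\<Sum>i\<in>{1..J}. c i * mass \<Omega> (p i) (e j)) = 0"
          using homogeneous_system_nontrivial[of ?K "{1..J}" "\<lambda>i j. mass \<Omega> (p i) (e j)"] finK by auto
        define q where "q = (\<Sum>i\<in>{1..J}. c i *\<^sub>R p i)"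
        have q: "q \<in> f.eigen \<mu>" unfolding q_def
          using p by (intro subspace_sum subspace_scale f.subspace_eigen) auto
        have "mass \<Omega> q (e j) = 0" if "j \<in> ?K" for j
        proof -
          have "p i \<in> sobolev \<Omega>" if "i \<in> {1..J}" for i using p that f.eigen_in_S by blast
          then show ?thesis
            unfolding q_def using c(2) that f.eigensystem_in_S[OF K that] by (subst f.B.sum_left) auto
        qed
        then have "AE x in lebesgue_on \<Omega>. fst q x = 0" using spanK[OF q] by (auto elim!: AE_mp intro!: AE_I2)
        then have "AE x in lebesgue_on \<Omega>. (\<Sum>i\<in>{1..J}. c i * u i x) = 0"
          unfolding q_def fst_sum_scale using p by simp
        then show False using ind c(1) by blast
      qed
      show "card ?K \<le> J"
      proof (rule ccontr)
        assume "\<not> card ?K \<le> J"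
        have "\<forall>k\<in>?K. \<exists>a. AE x in lebesgue_on \<Omega>. fst (e k) x = (\<Sum>i\<in>{1..J}. a i * u i x)"
          using span eK unfolding E by blast
        from bchoice[OF this] obtain a where
          a: "\<forall>k\<in>?K. AE x in lebesgue_on \<Omega>. fst (e k) x = (\<Sum>i\<in>{1..J}. a k i * u i x)" ..
        obtain c where c: "\<exists>k\<in>?K. c k \<noteq> 0" "\<forall>i\<in>{1..J}. (\<Sum>k\<in>?K. c k * a k i) = 0"
          using homogeneous_system_nontrivial[of "{1..J}" ?K a] finK \<open>\<not> card ?K \<le> J\<close> by auto
        have "AE x in lebesgue_on \<Omega>. \<forall>k\<in>?K. fst (e k) x = (\<Sum>i\<in>{1..J}. a k i * u i x)"
          using a finK by (intro AE_finite_allI) auto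
        then have "AE x in lebesgue_on \<Omega>. (\<Sum>k\<in>?K. c k * fst (e k) x) = 0"
        proof eventually_elim
          case (elim x)
          have "(\<Sum>k\<in>?K. c k * fst (e k) x) = (\<Sum>k\<in>?K. \<Sum>i\<in>{1..J}. c k * a k i * u i x)"
            using elim by (intro sum.cong) (auto simp: sum_distrib_left mult.assoc)
          also have "\<dots> = (\<Sum>i\<in>{1..J}. (\<Sum>k\<in>?K. c k * a k i) * u i x)"
            by (subst sum.swap) (simp add: sum_distrib_right)
          also have "\<dots> = 0" using c(2) by simp
          finally show ?case .
        qed
        then show False using eigensystem_AE_independent[OF \<Omega> K] c(1) by blast
      qed
    qed
  next
    assume J: "J = card ?K"
    obtain g where g: "bij_betw g {1..J} ?K" using ex_bij_betw_nat_finite_1[OF finK] unfolding J by blast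
    have gK: "g i \<in> ?K" if "i \<in> {1..J}" for i using bij_betwE[OF g] that by blast
    show "dirichlet_multiplicity \<Omega> \<mu> J"
      unfolding dirichlet_multiplicity_def
    proof (intro exI[of _ "\<lambda>i. fst (e (g i))"] conjI ballI allI impI)
      show "fst (e (g i)) \<in> dirichlet_eigenspace \<Omega> \<mu>" if "i \<in> {1..J}" for i
        unfolding E using eK[OF gK[OF that]] by blast
    next
      fix c i assume null: "AE x in lebesgue_on \<Omega>. (\<Sum>i\<in>{1..J}. c i * fst (e (g i)) x) = 0" and i: "i \<in> {1..J}"
      define h where "h = inv_into {1..J} g"
      have h: "h (g i) = i" if "i \<in> {1..J}" for i
        using g that by (simp add: h_def bij_betw_def inv_into_f_f)
      have "(\<Sum>k\<in>?K. c (h k) * fst (e k) x) = (\<Sum>i\<in>{1..J}. c i * fst (e (g i)) x)" for x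
        using sum.reindex_bij_betw[OF g, of "\<lambda>k. c (h k) * fst (e k) x"] h by simp
      then have "AE x in lebesgue_on \<Omega>. (\<Sum>k\<in>?K. c (h k) * fst (e k) x) = 0" using null by simp
      then have "\<forall>k\<in>?K. c (h k) = 0" by (rule eigensystem_AE_independent[OF \<Omega> K])
      then show "c i = 0" using gK[OF i] h[OF i] by metis
    next
      fix v assume "v \<in> dirichlet_eigenspace \<Omega> \<mu>"
      then obtain p where p: "p \<in> f.eigen \<mu>" "v = fst p" unfolding E by blast
      have "(\<Sum>i\<in>?K. mass \<Omega> p (e i) * fst (e i) x) = (\<Sum>i\<in>{1..J}. mass \<Omega> p (e (g i)) * fst (e (g i)) x)" for x
        using sum.reindex_bij_betw[OF g, of "\<lambda>k. mass \<Omega> p (e k) * fst (e k) x"] by simp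
      then show "\<exists>c. AE x in lebesgue_on \<Omega>. v x = (\<Sum>i\<in>{1..J}. c i * fst (e (g i)) x)"
        using spanK[OF p(1)] unfolding p(2) by (intro exI[of _ "\<lambda>i. mass \<Omega> p (e (g i))"]) simp
    qed
  qed
qed

section \<open>Stability of the counting functions\<close>

text \<open>
  Within distance \<open>4 * \<eta>\<close> of \<open>\<mu>\<close> the counting function of \<open>\<nu>1\<close> jumps only at \<open>\<mu>\<close>, and so takes two
  values. The comparisons, which lose only a shift by \<open>s\<close>, force the counting function of \<open>\<nu>2\<close> to
  have the first value from \<open>\<mu> - 3 * \<eta>\<close> to \<open>\<mu> - s\<close> and the second one beyond \<open>\<mu> + s\<close>. A counting
  function that does not change on an interval has no point there.
\<close>

lemma counting_stability:
  fixes \<nu>1 :: "'i \<Rightarrow> real" and \<nu>2 :: "'j \<Rightarrow> real"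
  assumes fin: "finite I1" "finite I2" and s: "0 \<le> s" "s \<le> \<eta>" "\<eta> > 0"
    and iso: "\<And>i. i \<in> I1 \<Longrightarrow> \<nu>1 i \<noteq> \<mu> \<Longrightarrow> \<bar>\<nu>1 i - \<mu>\<bar> > 4 * \<eta>"
    and c12: "\<And>\<kappa>. \<bar>\<kappa> - \<mu>\<bar> \<le> 4 * \<eta> \<Longrightarrow> \<kappa> + s \<le> \<mu> + 3 * \<eta> \<Longrightarrow> card {i\<in>I1. \<nu>1 i < \<kappa>} \<le> card {i\<in>I2. \<nu>2 i < \<kappa> + s}"
    and c21: "\<And>\<kappa>. \<bar>\<kappa> - \<mu>\<bar> \<le> 4 * \<eta> \<Longrightarrow> \<kappa> \<le> \<mu> + 3 * \<eta> \<Longrightarrow> card {i\<in>I2. \<nu>2 i < \<kappa>} \<le> card {i\<in>I1. \<nu>1 i < \<kappa> + s}"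
    and top: "\<And>i. i \<in> I2 \<Longrightarrow> \<nu>2 i < \<mu> + 3 * \<eta>"
  shows "\<And>i. i \<in> I2 \<Longrightarrow> \<bar>\<nu>2 i - \<mu>\<bar> < 2 * \<eta> \<Longrightarrow> \<bar>\<nu>2 i - \<mu>\<bar> \<le> s"
    and "card {i\<in>I2. \<bar>\<nu>2 i - \<mu>\<bar> < 2 * \<eta>} = card {i\<in>I1. \<nu>1 i = \<mu>}"
proof -
  define n0 where "n0 = card {i\<in>I1. \<nu>1 i < \<mu>}"
  define J where "J = card {i\<in>I1. \<nu>1 i = \<mu>}"
  have low: "card {i\<in>I1. \<nu>1 i < \<kappa>} = n0" if "\<mu> - 4 * \<eta> \<le> \<kappa>" "\<kappa> \<le> \<mu>" for \<kappa>
  proof -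
    have "{i\<in>I1. \<nu>1 i < \<kappa>} = {i\<in>I1. \<nu>1 i < \<mu>}" using iso that by force
    then show ?thesis by (simp add: n0_def)
  qed
  have high: "card {i\<in>I1. \<nu>1 i < \<kappa>} = n0 + J" if "\<mu> < \<kappa>" "\<kappa> \<le> \<mu> + 4 * \<eta>" for \<kappa>
  proof -
    have "{i\<in>I1. \<nu>1 i < \<kappa>} = {i\<in>I1. \<nu>1 i < \<mu>} \<union> {i\<in>I1. \<nu>1 i = \<mu>}" using iso that by force
    moreover have "card ({i\<in>I1. \<nu>1 i < \<mu>} \<union> {i\<in>I1. \<nu>1 i = \<mu>}) = n0 + J"
      unfolding n0_def J_def using fin by (intro card_Un_disjoint) auto
    ultimately show ?thesis by simp
  qed
  have mono2: "card {i\<in>I2. \<nu>2 i < a} \<le> card {i\<in>I2. \<nu>2 i < b}" if "a \<le> b" for a b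
    using fin that by (intro card_mono) auto
  have gap: "\<not> (a \<le> \<nu>2 i \<and> \<nu>2 i < b)" if "i \<in> I2" "card {i\<in>I2. \<nu>2 i < b} \<le> card {i\<in>I2. \<nu>2 i < a}" for i a b
  proof
    assume i: "a \<le> \<nu>2 i \<and> \<nu>2 i < b"
    then have "{i\<in>I2. \<nu>2 i < a} \<subset> {i\<in>I2. \<nu>2 i < b}" using \<open>i \<in> I2\<close> by force
    then have "card {i\<in>I2. \<nu>2 i < a} < card {i\<in>I2. \<nu>2 i < b}" using fin by (intro psubset_card_mono) auto
    then show False using that by simp
  qed
  have lo1: "card {i\<in>I2. \<nu>2 i < \<mu> - s} \<le> n0"
    using c21[of "\<mu> - s"] low[of \<mu>] s by simp
  have lo2: "n0 \<le> card {i\<in>I2. \<nu>2 i < \<mu> - 3 * \<eta>}"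
    using c12[of "\<mu> - 4 * \<eta>"] low[of "\<mu> - 4 * \<eta>"] mono2[of "\<mu> - 4 * \<eta> + s" "\<mu> - 3 * \<eta>"] s by simp
  have lo_eq: "card {i\<in>I2. \<nu>2 i < \<mu> - 3 * \<eta>} = n0"
    using lo1 lo2 mono2[of "\<mu> - 3 * \<eta>" "\<mu> - s"] s by simp
  have hi1: "card {i\<in>I2. \<nu>2 i < \<mu> + 3 * \<eta>} \<le> n0 + J"
    using c21[of "\<mu> + 3 * \<eta>"] high[of "\<mu> + 3 * \<eta> + s"] s by simp
  have hi2: "n0 + J \<le> card {i\<in>I2. \<nu>2 i < \<kappa> + s}" if "\<mu> < \<kappa>" "\<kappa> \<le> \<mu> + \<eta>" for \<kappa>
    using c12[of \<kappa>] high[of \<kappa>] that s by simp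
  have noL: "\<not> (\<mu> - 3 * \<eta> \<le> \<nu>2 i \<and> \<nu>2 i < \<mu> - s)" if "i \<in> I2" for i
    by (rule gap[OF that]) (use lo1 lo2 in linarith)
  have noR: "\<nu>2 i \<le> \<mu> + s" if i: "i \<in> I2" for i
  proof (rule ccontr)
    assume "\<not> \<nu>2 i \<le> \<mu> + s"
    define \<kappa> where "\<kappa> = min (\<nu>2 i - s) (\<mu> + \<eta>)"
    have \<kappa>: "\<mu> < \<kappa>" "\<kappa> \<le> \<mu> + \<eta>" "\<kappa> + s \<le> \<nu>2 i" using \<open>\<not> \<nu>2 i \<le> \<mu> + s\<close> s by (auto simp: \<kappa>_def)
    have "\<not> (\<kappa> + s \<le> \<nu>2 i \<and> \<nu>2 i < \<mu> + 3 * \<eta>)" by (rule gap[OF i]) (use hi1 hi2[OF \<kappa>(1,2)] in linarith)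
    then show False using \<kappa>(3) top[OF i] by simp
  qed
  show near: "\<bar>\<nu>2 i - \<mu>\<bar> \<le> s" if "i \<in> I2" "\<bar>\<nu>2 i - \<mu>\<bar> < 2 * \<eta>" for i
    using noL[OF that(1)] noR[OF that(1)] that(2) s by (auto simp: abs_le_iff abs_less_iff)
  have all: "card I2 = n0 + J"
  proof -
    have "I2 = {i\<in>I2. \<nu>2 i < \<mu> + 3 * \<eta>}" using top by auto
    moreover have "n0 + J \<le> card {i\<in>I2. \<nu>2 i < \<mu> + 3 * \<eta>}"
      using hi2[of "\<mu> + \<eta>"] mono2[of "\<mu> + \<eta> + s" "\<mu> + 3 * \<eta>"] s by simp
    ultimately show ?thesis using hi1 by simp
  qed
  have "{i\<in>I2. \<bar>\<nu>2 i - \<mu>\<bar> < 2 * \<eta>} = I2 - {i\<in>I2. \<nu>2 i < \<mu> - 3 * \<eta>}"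
  proof (intro equalityI subsetI)
    fix i assume "i \<in> I2 - {i\<in>I2. \<nu>2 i < \<mu> - 3 * \<eta>}"
    then have i: "i \<in> I2" "\<mu> - 3 * \<eta> \<le> \<nu>2 i" by auto
    then have "\<mu> - s \<le> \<nu>2 i" "\<nu>2 i \<le> \<mu> + s" using noL[OF i(1)] noR[OF i(1)] by auto
    then show "i \<in> {i\<in>I2. \<bar>\<nu>2 i - \<mu>\<bar> < 2 * \<eta>}" using i s by (simp add: abs_less_iff)
  qed (use s in auto)
  then show "card {i\<in>I2. \<bar>\<nu>2 i - \<mu>\<bar> < 2 * \<eta>} = card {i\<in>I1. \<nu>1 i = \<mu>}"
    using all lo_eq fin by (simp add: card_Diff_subset J_def)
qed

section \<open>Comparing two domains\<close>

lemma domain_transplantation_count: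
  fixes \<Omega> \<Omega>' :: "'a::euclidean_space set"
  assumes \<Omega>: "open \<Omega>" "bounded \<Omega>" and \<Omega>': "open \<Omega>'" "bounded \<Omega>'"
    and into: "\<And>\<phi>. test_function \<Omega> \<phi> \<Longrightarrow> test_function \<Omega>' (\<lambda>x. \<phi> (\<Psi> x))"
    and en: "\<And>\<phi>. test_function \<Omega> \<phi> \<Longrightarrow> dirichlet_integral (\<lambda>x. \<phi> (\<Psi> x)) \<le> (1 + \<delta>) * dirichlet_integral \<phi>"
    and ma: "\<And>\<phi>. test_function \<Omega> \<phi> \<Longrightarrow> (1 - \<delta>) * square_integral \<phi> \<le> square_integral (\<lambda>x. \<phi> (\<Psi> x))"
    and \<delta>: "0 \<le> \<delta>" "\<delta> < 1"
    and sys: "form_pair.complete_below (sobolev \<Omega>) (energy \<Omega>) (mass \<Omega>) \<kappa>1 I1 e1 \<nu>1"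
      "form_pair.complete_below (sobolev \<Omega>') (energy \<Omega>') (mass \<Omega>') \<kappa>2 I2 e2 \<nu>2"
    and le: "(1 + \<delta>) * \<kappa>1 \<le> (1 - \<delta>) * \<kappa>2"
  shows "card I1 \<le> card I2"
proof (rule transplantation_count[OF sobolev_form_pair[OF \<Omega>] sobolev_form_pair[OF \<Omega>'] _ _ _ _ _ _ _ _ \<delta> sys le])
  let ?D = "jet ` {\<phi>. test_function \<Omega> \<phi>}"
  let ?T = "\<lambda>p :: 'a jet. jet (\<lambda>x. fst p (\<Psi> x))"
  have fst_jet: "fst (jet \<phi>) = \<phi>" for \<phi> :: "'a \<Rightarrow> real" by (simp add: jet_def)
  show "?D \<subseteq> sobolev \<Omega>" using jet_in_sobolev[OF \<Omega>(1)] by blast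
  show "\<exists>X. (\<forall>n. X n \<in> ?D) \<and> (\<lambda>n. sobolev_square \<Omega> (X n - p)) \<longlonglongrightarrow> 0"
    if p: "p \<in> sobolev \<Omega>" for p
  proof -
    obtain \<phi> where "\<forall>j. test_function \<Omega> (\<phi> j)"
      "(\<lambda>j. sobolev_square \<Omega> (jet (\<phi> j) - p)) \<longlonglongrightarrow> 0"
      using p unfolding sobolev_iff[OF \<Omega>(1)] by blast
    then show ?thesis by (intro exI[of _ "\<lambda>j. jet (\<phi> j)"]) auto
  qed
  show "subspace ?D"
  proof (rule subspaceI)
    show "0 \<in> ?D" using jet_zero test_function_zero by (metis (mono_tags, lifting) imageI mem_Collect_eq)
    show "x + y \<in> ?D" if xy: "x \<in> ?D" "y \<in> ?D" for x y
    proof -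
      obtain f g where "x = jet f" "y = jet g" "test_function \<Omega> f" "test_function \<Omega> g" using xy by blast
      then show ?thesis using jet_add[of \<Omega> f g] test_function_add[of \<Omega> f g] by (intro image_eqI[of _ _ "\<lambda>x. f x + g x"]) auto
    qed
    show "c *\<^sub>R x \<in> ?D" if x: "x \<in> ?D" for x c
    proof -
      obtain f where "x = jet f" "test_function \<Omega> f" using x by blast
      then show ?thesis using jet_scale[of \<Omega> f c] test_function_scale[of \<Omega> f c] by (intro image_eqI[of _ _ "\<lambda>x. c * f x"]) auto
    qed
  qed
  show "?T p \<in> sobolev \<Omega>'" if "p \<in> ?D" for p
    using that into by (auto simp: fst_jet intro!: jet_in_sobolev[OF \<Omega>'(1)])
  show "?T (p + q) = ?T p + ?T q" if "p \<in> ?D" "q \<in> ?D" for p q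
    using that by (auto simp: fst_jet intro!: jet_add[OF into into])
  show "?T (c *\<^sub>R p) = c *\<^sub>R ?T p" if "p \<in> ?D" for p c
    using that by (auto simp: fst_jet intro!: jet_scale[OF into])
  show "energy \<Omega>' (?T p) (?T p) \<le> (1 + \<delta>) * energy \<Omega> p p" if "p \<in> ?D" for p
    using that into en by (auto simp: fst_jet energy_jet[OF \<Omega>(1)] energy_jet[OF \<Omega>'(1)])
  show "(1 - \<delta>) * mass \<Omega> p p \<le> mass \<Omega>' (?T p) (?T p)" if "p \<in> ?D" for p
    using that into ma by (auto simp: fst_jet mass_jet[OF \<Omega>(1)] mass_jet[OF \<Omega>'(1)])
qed

text \<open>
  Any listing repeats each value as often as its multiplicity prescribes, so that a listed value has
  positive multiplicity and occurs in the complete system.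
\<close>

lemma listing_of_eigensystem:
  assumes \<Omega>: "open \<Omega>" "bounded \<Omega>"
    and sys: "form_pair.complete_below (sobolev \<Omega>) (energy \<Omega>) (mass \<Omega>) b I e \<nu>"
    and U: "\<And>\<mu>. \<mu> \<in> U \<Longrightarrow> \<mu> < b" and J: "card {i\<in>I. \<nu> i \<in> U} = J"
  shows "\<exists>\<Lambda>. lists_eigenvalues_in \<Omega> U J \<Lambda>"
    and "\<And>\<Lambda> k. lists_eigenvalues_in \<Omega> U J \<Lambda> \<Longrightarrow> k \<in> {1..J} \<Longrightarrow> \<exists>i\<in>I. \<nu> i \<in> U \<and> \<Lambda> k = \<nu> i"
proof -
  interpret f: form_pair "sobolev \<Omega>" "energy \<Omega>" "mass \<Omega>" by (rule sobolev_form_pair[OF \<Omega>])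
  have fin: "finite I" using sys f.eigensystem_finite unfolding f.complete_below_def by blast
  let ?K = "{i\<in>I. \<nu> i \<in> U}"
  have finK: "finite ?K" using fin by simp
  obtain g where g: "bij_betw g {1..J} ?K" using ex_bij_betw_nat_finite_1[OF finK] unfolding J by blast
  have "lists_eigenvalues_in \<Omega> U J (\<lambda>k. \<nu> (g k))"
    unfolding lists_eigenvalues_in_def
  proof (intro conjI ballI)
    show "\<nu> (g k) \<in> U" if "k \<in> {1..J}" for k using bij_betwE[OF g] that by blast
    fix \<mu> assume \<mu>: "\<mu> \<in> U"
    have "g ` {k\<in>{1..J}. \<nu> (g k) = \<mu>} = {i\<in>I. \<nu> i = \<mu>}"
    proof (intro equalityI subsetI)
      fix i assume "i \<in> {i\<in>I. \<nu> i = \<mu>}"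
      then have i: "i \<in> ?K" "\<nu> i = \<mu>" using \<mu> by auto
      have "i \<in> g ` {1..J}" using i(1) bij_betw_imp_surj_on[OF g] by simp
      then obtain k where "k \<in> {1..J}" "g k = i" by blast
      then show "i \<in> g ` {k\<in>{1..J}. \<nu> (g k) = \<mu>}" using i by auto
    qed (use bij_betwE[OF g] in auto)
    moreover have "inj_on g {k\<in>{1..J}. \<nu> (g k) = \<mu>}"
      using g unfolding bij_betw_def by (auto intro: inj_on_subset)
    ultimately have "card {k\<in>{1..J}. \<nu> (g k) = \<mu>} = card {i\<in>I. \<nu> i = \<mu>}"
      using card_image[of g "{k\<in>{1..J}. \<nu> (g k) = \<mu>}"] by simp
    then show "dirichlet_multiplicity \<Omega> \<mu> (card {k\<in>{1..J}. \<nu> (g k) = \<mu>})"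
      using dirichlet_multiplicity_iff[OF \<Omega> sys U[OF \<mu>]] by simp
  qed
  then show "\<exists>\<Lambda>. lists_eigenvalues_in \<Omega> U J \<Lambda>" by blast
  fix \<Lambda> k assume L: "lists_eigenvalues_in \<Omega> U J \<Lambda>" and k: "k \<in> {1..J}"
  then have U': "\<Lambda> k \<in> U" and "dirichlet_multiplicity \<Omega> (\<Lambda> k) (card {l\<in>{1..J}. \<Lambda> l = \<Lambda> k})"
    by (auto simp: lists_eigenvalues_in_def)
  then have "card {l\<in>{1..J}. \<Lambda> l = \<Lambda> k} = card {i\<in>I. \<nu> i = \<Lambda> k}"
    using dirichlet_multiplicity_iff[OF \<Omega> sys U[OF U']] by simp
  moreover have "card {l\<in>{1..J}. \<Lambda> l = \<Lambda> k} \<noteq> 0" using k by auto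
  ultimately have "{i\<in>I. \<nu> i = \<Lambda> k} \<noteq> {}" by (metis card.empty)
  then show "\<exists>i\<in>I. \<nu> i \<in> U \<and> \<Lambda> k = \<nu> i" using U' by force
qed

section \<open>Stability of the Dirichlet eigenvalues\<close>

theorem corollary3p9:
  fixes M :: real
    and N :: nat
    and Z :: "nat \<Rightarrow> 'a::euclidean_space cylinder"
    and \<Omega>\<^sub>1 :: "'a set"
    and h\<^sub>1 :: "nat \<Rightarrow> 'a \<Rightarrow> real"
    and \<Lambda> :: "nat \<Rightarrow> real"
    and m J :: nat
  assumes "M > 0"
    and "\<forall>k\<in>{1..N}. valid_cylinder (Z k)"
    and "lipschitz_domain_with M N Z h\<^sub>1 \<Omega>\<^sub>1"
    and "\<forall>k\<in>{1..N}. h\<^sub>1 k 0 = 0"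
    and "strict_mono_on {1..} \<Lambda>"
    and "\<Lambda> ` {1..} = {\<mu>. dirichlet_eigenvalue \<Omega>\<^sub>1 \<mu>}"
    and "m \<ge> 1"
    and "dirichlet_multiplicity \<Omega>\<^sub>1 (\<Lambda> m) J"
  shows "\<exists>C. \<exists>\<epsilon>>0. \<exists>d\<^sub>0>0. \<forall>\<Omega>\<^sub>2\<in>lipschitz_class M N Z.
           hausdorff_dist \<Omega>\<^sub>1 \<Omega>\<^sub>2 < d\<^sub>0 \<longrightarrow>
             (\<exists>\<Lambda>\<^sub>2. lists_eigenvalues_in \<Omega>\<^sub>2 (ball (\<Lambda> m) \<epsilon>) J \<Lambda>\<^sub>2) \<and>
             (\<forall>\<Lambda>\<^sub>2. lists_eigenvalues_in \<Omega>\<^sub>2 (ball (\<Lambda> m) \<epsilon>) J \<Lambda>\<^sub>2 \<longrightarrow>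
                (\<forall>k\<in>{1..J}. \<bar>\<Lambda>\<^sub>2 k - \<Lambda> m\<bar> \<le> C * hausdorff_dist \<Omega>\<^sub>1 \<Omega>\<^sub>2))"
proof -
  define \<mu> where "\<mu> = \<Lambda> m"
  have o1: "open \<Omega>\<^sub>1" "bounded \<Omega>\<^sub>1" "\<Omega>\<^sub>1 \<noteq> {}"
    using assms(3) by (auto simp: lipschitz_domain_with_def bounded_domain_def)
  obtain P :: "'a set" and \<beta> e C0 d1 where field: "finite P" "\<forall>p\<in>P. test_function UNIV (\<beta> p) \<and> norm (e p :: 'a) = 1"
    and C0: "C0 \<ge> 0" "d1 > 0"
    and push': "\<forall>\<Omega>\<^sub>2\<in>lipschitz_class M N Z. \<forall>x. hausdorff_dist \<Omega>\<^sub>1 \<Omega>\<^sub>2 < d1 \<longrightarrow>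
        (x + (C0 * hausdorff_dist \<Omega>\<^sub>1 \<Omega>\<^sub>2) *\<^sub>R (\<Sum>p\<in>P. \<beta> p x *\<^sub>R e p) \<in> \<Omega>\<^sub>1 \<longrightarrow> x \<in> \<Omega>\<^sub>2) \<and>
        (x + (C0 * hausdorff_dist \<Omega>\<^sub>1 \<Omega>\<^sub>2) *\<^sub>R (\<Sum>p\<in>P. \<beta> p x *\<^sub>R e p) \<in> \<Omega>\<^sub>2 \<longrightarrow> x \<in> \<Omega>\<^sub>1)"
    using transversal_field[OF assms(1-3)] by (elim exE conjE) (rule that)
  note push = push'[rule_format, THEN conjunct1] push'[rule_format, THEN conjunct2]
  interpret V: smooth_field P \<beta> e using field by unfold_locales auto
  obtain L where L: "L > 0" and trans: "\<And>t \<phi> \<Omega>\<^sub>1. 0 \<le> t \<Longrightarrow> t * L \<le> 1 \<Longrightarrow> test_function \<Omega>\<^sub>1 \<phi> \<Longrightarrow>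
     (\<forall>\<Omega>\<^sub>2. (\<forall>x. x + t *\<^sub>R V.field x \<in> \<Omega>\<^sub>1 \<longrightarrow> x \<in> \<Omega>\<^sub>2) \<longrightarrow> test_function \<Omega>\<^sub>2 (\<lambda>x. \<phi> (x + t *\<^sub>R V.field x))) \<and>
     dirichlet_integral (\<lambda>x. \<phi> (x + t *\<^sub>R V.field x)) \<le> (1 + L * t) * dirichlet_integral \<phi> \<and>
     (1 - L * t) * square_integral \<phi> \<le> square_integral (\<lambda>x. \<phi> (x + t *\<^sub>R V.field x))"
    using V.transplantation_estimates by blast
  interpret f1: form_pair "sobolev \<Omega>\<^sub>1" "energy \<Omega>\<^sub>1" "mass \<Omega>\<^sub>1" by (rule sobolev_form_pair[OF o1(1,2)])
  obtain I1 :: "nat set" and e1 \<nu>1 where sys1: "f1.complete_below (\<mu> + 1) I1 e1 \<nu>1"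
    using f1.complete_below_exists by blast
  have fin1: "finite I1" using sys1 f1.eigensystem_finite unfolding f1.complete_below_def by blast
  have J: "J = card {i\<in>I1. \<nu>1 i = \<mu>}"
    using assms(8) dirichlet_multiplicity_iff[OF o1(1,2) sys1, of \<mu> J] by (simp add: \<mu>_def)
  \<comment> \<open>The eigenvalue \<open>\<mu>\<close> is isolated because only finitely many eigenvalues are below \<open>\<mu> + 1\<close>.\<close>
  define \<eta> where "\<eta> = Min (insert 1 ((\<lambda>i. \<bar>\<nu>1 i - \<mu>\<bar>) ` {i\<in>I1. \<nu>1 i \<noteq> \<mu>})) / 5"
  have \<eta>: "\<eta> > 0" "5 * \<eta> \<le> 1" "\<And>i. i \<in> I1 \<Longrightarrow> \<nu>1 i \<noteq> \<mu> \<Longrightarrow> 5 * \<eta> \<le> \<bar>\<nu>1 i - \<mu>\<bar>"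
    using fin1 by (auto simp: \<eta>_def)
  have iso: "\<bar>\<nu>1 i - \<mu>\<bar> > 4 * \<eta>" if "i \<in> I1" "\<nu>1 i \<noteq> \<mu>" for i using \<eta>(1) \<eta>(3)[OF that] by linarith
  define C where "C = 4 * (L * C0) * (\<bar>\<mu>\<bar> + 1)"
  have C: "C \<ge> 0" using L C0 by (simp add: C_def)
  define d0 where "d0 = Min {d1, 1 / (2 * L * C0 + 1), \<eta> / (C + 1)}"
  have d0: "d0 > 0" using C0 L \<eta> C by (auto simp: d0_def add_nonneg_pos)
  have main: "(\<exists>\<Lambda>\<^sub>2. lists_eigenvalues_in \<Omega>\<^sub>2 (ball \<mu> (2 * \<eta>)) J \<Lambda>\<^sub>2) \<and>
             (\<forall>\<Lambda>\<^sub>2. lists_eigenvalues_in \<Omega>\<^sub>2 (ball \<mu> (2 * \<eta>)) J \<Lambda>\<^sub>2 \<longrightarrow>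
                (\<forall>k\<in>{1..J}. \<bar>\<Lambda>\<^sub>2 k - \<mu>\<bar> \<le> C * hausdorff_dist \<Omega>\<^sub>1 \<Omega>\<^sub>2))"
    if \<Omega>2: "\<Omega>\<^sub>2 \<in> lipschitz_class M N Z" and small: "hausdorff_dist \<Omega>\<^sub>1 \<Omega>\<^sub>2 < d0" for \<Omega>\<^sub>2
  proof -
    have o2: "open \<Omega>\<^sub>2" "bounded \<Omega>\<^sub>2" "\<Omega>\<^sub>2 \<noteq> {}"
      using \<Omega>2 by (auto simp: lipschitz_class_def lipschitz_domain_with_def bounded_domain_def)
    define d where "d = hausdorff_dist \<Omega>\<^sub>1 \<Omega>\<^sub>2"
    have d: "0 \<le> d"
      using hausdorff_dist_infdist(1)[OF o1(2) o2(2) o1(3) o2(3)] o1(3) infdist_nonneg order_trans unfolding d_def by blast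
    have dsmall: "d < d1" "2 * L * C0 * d \<le> 1" "C * d \<le> \<eta>"
    proof -
      have b: "d < d1" "d < 1 / (2 * L * C0 + 1)" "d < \<eta> / (C + 1)" using small by (auto simp: d0_def d_def)
      show "d < d1" by (rule b)
      have "0 < 2 * L * C0 + 1" using L C0 by (simp add: add_nonneg_pos)
      then have "d * (2 * L * C0 + 1) < 1" using b(2) by (subst (asm) pos_less_divide_eq)
      then show "2 * L * C0 * d \<le> 1" using d by (simp add: algebra_simps)
      have "d * (C + 1) < \<eta>" using b(3) C by (subst (asm) pos_less_divide_eq) auto
      then show "C * d \<le> \<eta>" using d by (simp add: algebra_simps)
    qed
    define t where "t = C0 * d"
    define \<delta> where "\<delta> = L * t"
    define s where "s = C * d"
    have t: "0 \<le> t" using C0 d by (simp add: t_def)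
    have \<delta>: "0 \<le> \<delta>" "\<delta> \<le> 1/2" using t L dsmall(2) by (auto simp: \<delta>_def t_def)
    have s: "0 \<le> s" "s \<le> \<eta>" using C d dsmall(3) by (auto simp: s_def)
    have sd: "s = 4 * \<delta> * (\<bar>\<mu>\<bar> + 1)" by (simp add: s_def \<delta>_def t_def C_def)
    \<comment> \<open>A shift by \<open>s\<close> absorbs the factor \<open>(1 + \<delta>) / (1 - \<delta>)\<close> for all \<open>\<kappa>\<close> at distance at most 1 from \<open>\<mu>\<close>,
      because \<open>\<delta> \<le> 1/2\<close>.\<close>
    have shift: "(1 + \<delta>) * \<kappa> \<le> (1 - \<delta>) * (\<kappa> + s)" if "\<bar>\<kappa> - \<mu>\<bar> \<le> 4 * \<eta>" for \<kappa>
    proof -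
      have "\<kappa> \<le> \<bar>\<mu>\<bar> + 1" using that \<eta>(1,2) by linarith
      then have "2 * \<delta> * \<kappa> \<le> 2 * \<delta> * (\<bar>\<mu>\<bar> + 1)" using \<delta> by (intro mult_left_mono) auto
      also have "\<dots> = 1/2 * s" by (simp add: sd)
      also have "\<dots> \<le> (1 - \<delta>) * s" using \<delta> s by (intro mult_right_mono) auto
      finally show ?thesis by (simp add: algebra_simps)
    qed
    have \<delta>1: "\<delta> < 1" "t * L \<le> 1" using \<delta> by (auto simp: \<delta>_def mult.commute)
    let ?\<Psi> = "\<lambda>x. x + t *\<^sub>R V.field x"
    have into12: "x \<in> \<Omega>\<^sub>2" if "?\<Psi> x \<in> \<Omega>\<^sub>1" for x
      using push(1)[OF \<Omega>2, of x] dsmall(1) that unfolding t_def d_def V.field_def by blast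
    have into21: "x \<in> \<Omega>\<^sub>1" if "?\<Psi> x \<in> \<Omega>\<^sub>2" for x
      using push(2)[OF \<Omega>2, of x] dsmall(1) that unfolding t_def d_def V.field_def by blast
    have T12: "test_function \<Omega>\<^sub>2 (\<lambda>x. \<phi> (?\<Psi> x))" if "test_function \<Omega>\<^sub>1 \<phi>" for \<phi>
      using trans[OF t \<delta>1(2) that] into12 by blast
    have T21: "test_function \<Omega>\<^sub>1 (\<lambda>x. \<phi> (?\<Psi> x))" if "test_function \<Omega>\<^sub>2 \<phi>" for \<phi>
      using trans[OF t \<delta>1(2) that] into21 by blast
    have en: "dirichlet_integral (\<lambda>x. \<phi> (?\<Psi> x)) \<le> (1 + \<delta>) * dirichlet_integral \<phi>"
      and ma: "(1 - \<delta>) * square_integral \<phi> \<le> square_integral (\<lambda>x. \<phi> (?\<Psi> x))" if "test_function \<Omega> \<phi>" for \<phi> \<Omega>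
      using trans[OF t \<delta>1(2) that] unfolding \<delta>_def by blast+
    interpret f2: form_pair "sobolev \<Omega>\<^sub>2" "energy \<Omega>\<^sub>2" "mass \<Omega>\<^sub>2" by (rule sobolev_form_pair[OF o2(1,2)])
    obtain I2 :: "nat set" and e2 \<nu>2 where sys2: "f2.complete_below (\<mu> + 3 * \<eta>) I2 e2 \<nu>2"
      using f2.complete_below_exists by blast
    have fin2: "finite I2" using sys2 f2.eigensystem_finite unfolding f2.complete_below_def by blast
    have top2: "\<nu>2 i < \<mu> + 3 * \<eta>" if "i \<in> I2" for i using sys2 that by (auto simp: f2.complete_below_def)
    have c12: "card {i\<in>I1. \<nu>1 i < \<kappa>} \<le> card {i\<in>I2. \<nu>2 i < \<kappa> + s}"
      if "\<bar>\<kappa> - \<mu>\<bar> \<le> 4 * \<eta>" "\<kappa> + s \<le> \<mu> + 3 * \<eta>" for \<kappa>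
    proof (rule domain_transplantation_count[OF o1(1,2) o2(1,2) T12 en ma \<delta>(1) \<delta>1(1) _ _ shift[OF that(1)]])
      show "f1.complete_below \<kappa> {i\<in>I1. \<nu>1 i < \<kappa>} e1 \<nu>1"
        using that \<eta>(1,2) by (intro f1.complete_below_restrict[OF sys1]) (simp add: abs_le_iff)
      show "f2.complete_below (\<kappa> + s) {i\<in>I2. \<nu>2 i < \<kappa> + s} e2 \<nu>2"
        using that by (intro f2.complete_below_restrict[OF sys2])
    qed
    have c21: "card {i\<in>I2. \<nu>2 i < \<kappa>} \<le> card {i\<in>I1. \<nu>1 i < \<kappa> + s}"
      if "\<bar>\<kappa> - \<mu>\<bar> \<le> 4 * \<eta>" "\<kappa> \<le> \<mu> + 3 * \<eta>" for \<kappa>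
    proof (rule domain_transplantation_count[OF o2(1,2) o1(1,2) T21 en ma \<delta>(1) \<delta>1(1) _ _ shift[OF that(1)]])
      show "f2.complete_below \<kappa> {i\<in>I2. \<nu>2 i < \<kappa>} e2 \<nu>2"
        using that by (intro f2.complete_below_restrict[OF sys2])
      show "f1.complete_below (\<kappa> + s) {i\<in>I1. \<nu>1 i < \<kappa> + s} e1 \<nu>1"
        using that s \<eta>(1,2) by (intro f1.complete_below_restrict[OF sys1]) simp
    qed
    note stab = counting_stability[OF fin1 fin2 s \<eta>(1) iso c12 c21 top2]
    have ball: "\<nu> \<in> ball \<mu> (2 * \<eta>) \<longleftrightarrow> \<bar>\<nu> - \<mu>\<bar> < 2 * \<eta>" for \<nu> by (simp add: dist_real_def abs_minus_commute)
    have card2: "card {i\<in>I2. \<nu>2 i \<in> ball \<mu> (2 * \<eta>)} = J" unfolding ball J by (rule stab(2))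
    have below: "\<nu> < \<mu> + 3 * \<eta>" if "\<nu> \<in> ball \<mu> (2 * \<eta>)" for \<nu>
      using that \<eta>(1) unfolding ball by (simp add: abs_less_iff)
    have "\<bar>\<Lambda>\<^sub>2 k - \<mu>\<bar> \<le> C * hausdorff_dist \<Omega>\<^sub>1 \<Omega>\<^sub>2"
      if ls: "lists_eigenvalues_in \<Omega>\<^sub>2 (ball \<mu> (2 * \<eta>)) J \<Lambda>\<^sub>2" "k \<in> {1..J}" for \<Lambda>\<^sub>2 k
    proof -
      obtain i where "i \<in> I2" "\<nu>2 i \<in> ball \<mu> (2 * \<eta>)" "\<Lambda>\<^sub>2 k = \<nu>2 i" using listing_of_eigensystem(2)[OF o2(1,2) sys2 _ card2 ls] below by blast
      then show ?thesis using stab(1)[of i] unfolding ball s_def d_def by simp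
    qed
    moreover have "\<exists>\<Lambda>\<^sub>2. lists_eigenvalues_in \<Omega>\<^sub>2 (ball \<mu> (2 * \<eta>)) J \<Lambda>\<^sub>2"
      by (rule listing_of_eigensystem(1)[OF o2(1,2) sys2 _ card2]) (rule below)
    ultimately show ?thesis by blast
  qed
  have "2 * \<eta> > 0" using \<eta>(1) by simp
  then show ?thesis using main d0 unfolding \<mu>_def by blast
qed

end
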